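(* For every fixed $k \le 10$, given an $m$-edge graph $H$ as input, the number of subgraphs of $H$ isomorphic to the path $P_k$ can be computed in $\widetilde{O}(m^2)$ time.
   Context: $P_k$ is the path on $k$ vertices. Model: unit-cost RAM; the host graph is given by a representation allowing adjacency queries in $\widetilde{O}(1)$ time and iteration over all edges $xy$ ordered by $x$ in $\widetilde{O}(m)$ time; $\widetilde{O}$ hides factors polylogarithmic in the input size. *)

theory Defs
  imports Complex_Main
begin

type_synonym 'a graph = "'a set \<times> 'a set set"

abbreviation verts :: "'a graph \<Rightarrow> 'a set" where
  "verts \<equiv> fst"

abbreviation edges :: "'a graph \<Rightarrow> 'a set set" where
  "edges \<equiv> snd"

definition simple_graph :: "'a graph \<Rightarrow> bool" where
  "simple_graph G \<longleftrightarrow> finite (verts G) \<and> (\<forall>e\<in>edges G. e \<subseteq> verts G \<and> card e = 2)"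

definition subgraph_of :: "'a graph \<Rightarrow> 'a graph \<Rightarrow> bool" where
  "subgraph_of S H \<longleftrightarrow> simple_graph S \<and> verts S \<subseteq> verts H \<and> edges S \<subseteq> edges H"

definition isomorphic :: "'a graph \<Rightarrow> 'b graph \<Rightarrow> bool" where
  "isomorphic G H \<longleftrightarrow>
    (\<exists>f. bij_betw f (verts G) (verts H) \<and>
         (\<forall>u\<in>verts G. \<forall>v\<in>verts G. {u, v} \<in> edges G \<longleftrightarrow> {f u, f v} \<in> edges H))"

definition path_graph :: "nat \<Rightarrow> nat graph" where
  "path_graph k = ({..<k}, {{i, Suc i} |i. Suc i < k})"

definition count_subgraphs :: "'b graph \<Rightarrow> 'a graph \<Rightarrow> nat" where
  "count_subgraphs F H = card {S. subgraph_of S H \<and> isomorphic S F}"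

definition graph_size :: "'a graph \<Rightarrow> nat" where
  "graph_size H = card (verts H) + card (edges H)"

text \<open>The shift by 2 makes the logarithm at least 1 for every input size.\<close>

definition polylog :: "real \<Rightarrow> nat \<Rightarrow> nat \<Rightarrow> real" where
  "polylog C c N = C * log 2 (real N + 2) ^ c"

text \<open>
  A representation of the host graph is seen by the machine only through an adjacency test and a
  sequential scan of a list of ordered pairs. The cost of a test may depend on its arguments. The
  cost of advancing the scan may depend on the position, so that a bound on the cost of a complete
  scan is an amortised one.
\<close>

record graph_rep =
  adjacent :: "nat \<Rightarrow> nat \<Rightarrow> bool"
  adj_cost :: "nat \<Rightarrow> nat \<Rightarrow> nat"
  edge_list :: "(nat \<times> nat) list"
  scan_cost :: "nat \<Rightarrow> nat"

text \<open>
  Each edge is listed in both orientations, so the pairs with a given first component \<open>x\<close> form a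
  contiguous block listing the neighbours of \<open>x\<close>, in an arbitrary order.
\<close>

definition represents :: "graph_rep \<Rightarrow> nat graph \<Rightarrow> bool" where
  "represents R H \<longleftrightarrow>
     (\<forall>x\<in>verts H. \<forall>y\<in>verts H. adjacent R x y \<longleftrightarrow> {x, y} \<in> edges H) \<and>
     distinct (edge_list R) \<and>
     set (edge_list R) = {(x, y). {x, y} \<in> edges H} \<and>
     sorted (map fst (edge_list R))"

text \<open>
  Adjacency tests take polylogarithmic time, and a complete scan takes time linear in the number of
  edges up to a polylogarithmic factor. The last summand is the cost of detecting the end of the
  list. An edgeless graph is treated as having one edge, since no time bound can be 0.
\<close>

definition efficient_rep :: "real \<Rightarrow> nat \<Rightarrow> graph_rep \<Rightarrow> nat graph \<Rightarrow> bool" where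
  "efficient_rep A a R H \<longleftrightarrow>
     (\<forall>x\<in>verts H. \<forall>y\<in>verts H. real (adj_cost R x y) \<le> polylog A a (graph_size H)) \<and>
     real (\<Sum>i\<le>length (edge_list R). scan_cost R i)
       \<le> real (max 1 (card (edges H))) * polylog A a (graph_size H)"

text \<open>
  Random access machine. Operands are addresses of memory cells, except for the second argument of
  \<open>Const\<close>, which is a literal, and the last argument of \<open>Jump\<close>, \<open>JumpLess\<close> and \<open>NextEdge\<close>, which is
  a position in the program.
\<close>

datatype instr =
    Const nat nat
  | Add nat nat nat
  | Sub nat nat nat
  | Mul nat nat nat
  | Div nat nat nat
  | Load nat nat
  | Store nat nat
  | Jump nat
  | JumpLess nat nat nat
  | Adj nat nat nat
  | NextEdge nat nat nat
  | Rewind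
  | Halt

text \<open>Program counter, memory, position of the edge scan.\<close>

type_synonym config = "nat \<times> (nat \<Rightarrow> nat) \<times> nat"

text \<open>
  One step, together with its cost; \<open>None\<close> means that the machine is stuck. Memory cells hold words,
  i.e. numbers below \<open>w\<close>: an instruction whose result is not a word gets stuck. This excludes the
  abuse of unit-cost arithmetic on long numbers. Every instruction costs one unit, and accesses
  to the host graph additionally cost what the representation charges for them.
\<close>

definition put :: "nat \<Rightarrow> nat \<Rightarrow> nat \<Rightarrow> (nat \<Rightarrow> nat) \<Rightarrow> (nat \<Rightarrow> nat) option" where
  "put w i v M = (if v < w then Some (M(i := v)) else None)"

fun step_instr :: "nat \<Rightarrow> graph_rep \<Rightarrow> instr \<Rightarrow> config \<Rightarrow> (config \<times> nat) option" where
  "step_instr w R (Const i c) (pc, M, p) =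
     map_option (\<lambda>M'. ((Suc pc, M', p), 1)) (put w i c M)"
| "step_instr w R (Add i j l) (pc, M, p) =
     map_option (\<lambda>M'. ((Suc pc, M', p), 1)) (put w i (M j + M l) M)"
| "step_instr w R (Sub i j l) (pc, M, p) =
     map_option (\<lambda>M'. ((Suc pc, M', p), 1)) (put w i (M j - M l) M)"
| "step_instr w R (Mul i j l) (pc, M, p) =
     map_option (\<lambda>M'. ((Suc pc, M', p), 1)) (put w i (M j * M l) M)"
| "step_instr w R (Div i j l) (pc, M, p) =
     map_option (\<lambda>M'. ((Suc pc, M', p), 1)) (put w i (M j div M l) M)"
| "step_instr w R (Load i j) (pc, M, p) =
     map_option (\<lambda>M'. ((Suc pc, M', p), 1)) (put w i (M (M j)) M)"
| "step_instr w R (Store i j) (pc, M, p) =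
     map_option (\<lambda>M'. ((Suc pc, M', p), 1)) (put w (M i) (M j) M)"
| "step_instr w R (Jump t) (pc, M, p) = Some ((t, M, p), 1)"
| "step_instr w R (JumpLess i j t) (pc, M, p) =
     Some ((if M i < M j then t else Suc pc, M, p), 1)"
| "step_instr w R (Adj i j l) (pc, M, p) =
     map_option (\<lambda>M'. ((Suc pc, M', p), 1 + adj_cost R (M j) (M l)))
       (put w i (if adjacent R (M j) (M l) then 1 else 0) M)"
| "step_instr w R (NextEdge i j t) (pc, M, p) =
     (if p < length (edge_list R) then
        map_option (\<lambda>M'. ((Suc pc, M', Suc p), 1 + scan_cost R p))
          (Option.bind (put w i (fst (edge_list R ! p)) M) (put w j (snd (edge_list R ! p))))
      else Some ((t, M, p), 1 + scan_cost R p))"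
| "step_instr w R Rewind (pc, M, p) = Some ((Suc pc, M, 0), 1)"
| "step_instr w R Halt (pc, M, p) = None"

inductive runs :: "nat \<Rightarrow> graph_rep \<Rightarrow> instr list \<Rightarrow> config \<Rightarrow> nat \<Rightarrow> nat \<Rightarrow> bool"
  for w :: nat and R :: graph_rep and P :: "instr list" where
  halt: "pc < length P \<Longrightarrow> P ! pc = Halt \<Longrightarrow> runs w R P (pc, M, p) 1 (M 0)"
| step: "pc < length P \<Longrightarrow> step_instr w R (P ! pc) (pc, M, p) = Some (s, c) \<Longrightarrow>
         runs w R P s t r \<Longrightarrow> runs w R P (pc, M, p) (c + t) r"

text \<open>
  \<open>computes w R P x t r\<close>: with word bound \<open>w\<close>, program \<open>P\<close>, started with \<open>x\<close> in cell 0, all other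
  cells 0 and the scan at the beginning, halts after total cost \<open>t\<close> with \<open>r\<close> in cell 0.
\<close>

definition computes :: "nat \<Rightarrow> graph_rep \<Rightarrow> instr list \<Rightarrow> nat \<Rightarrow> nat \<Rightarrow> nat \<Rightarrow> bool" where
  "computes w R P x t r \<longleftrightarrow> x < w \<and> runs w R P (0, (\<lambda>_. 0)(0 := x), 0) t r"

end

theory Submission
  imports Defs "HOL-Library.FuncSet"
begin

text \<open>
  Deletion--contraction on the constraints that the vertices of a path be pairwise distinct expresses
  the number of injective walks as an integer combination of homomorphism counts of the quotients of
  \<open>P\<^sub>k\<close>, i.e. of graphs traced out by words with at most ten letters. In such a graph some edge
  \<open>pq\<close> meets all cycles, apart from a few words that are cut by a letter into two parts with this
  property. For each of the \<open>m\<close> possible images \<open>ab\<close> of \<open>pq\<close> the rest of the graph is a forest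
  with vertex weights, so its homomorphisms are counted by dynamic programming along the forest in
  \<open>O(m)\<close> steps; a cut letter is handled by first tabulating the counts of one part for each image
  of that letter. That every word admits such an anchor edge or cut is checked by enumeration.
\<close>

section \<open>Structured programs with counting loops and their translation to machine code\<close>

section \<open>Executions and code fragments\<close>

text \<open>The word of a quotient graph depends on \<open>k\<close> alone, so it can be turned into
  a pair of vector expressions before any host graph is seen, and the program is compiled once from
  the list of these pairs. This is why the existence statements choose the expressions outside the
  host graph. Each operation of an expression is a bounded number of passes over the edge list; the
  loop over anchor edges gives the second factor \<open>m\<close>. A word with a cut letter would
  need two anchor edges at once and hence cubic time; tabulating one part by the image of the cut
  letter replaces two nested loops by two consecutive ones. Two features of the machine shape the
  rest. Words are bounded, so every intermediate value carries a polynomial bound whose exponent is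
  read off the expression. Subtraction is truncated, so the positive and the negative terms of the
  integer combination are summed separately and subtracted once. A path with at least two vertices
  is traversed in two directions, whence the final division by 2.\<close>

inductive steps :: "nat \<Rightarrow> graph_rep \<Rightarrow> instr list \<Rightarrow> config \<Rightarrow> nat \<Rightarrow> config \<Rightarrow> bool"
  for w :: nat and R :: graph_rep and P :: "instr list" where
  none: "steps w R P s 0 s"
| more: "pc < length P \<Longrightarrow> step_instr w R (P ! pc) (pc, M, p) = Some (s, c) \<Longrightarrow>
         steps w R P s t s' \<Longrightarrow> steps w R P (pc, M, p) (c + t) s'"

lemma steps_trans:
  "steps w R P s t s' \<Longrightarrow> steps w R P s' t' s'' \<Longrightarrow> steps w R P s (t + t') s''"
  by (induction rule: steps.induct) (auto simp: add.assoc intro: steps.more)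

lemma steps_runs:
  "steps w R P s t s' \<Longrightarrow> runs w R P s' t' r \<Longrightarrow> runs w R P s (t + t') r"
  by (induction rule: steps.induct) (auto simp: add.assoc intro: runs.step)

definition code_at :: "instr list \<Rightarrow> nat \<Rightarrow> instr list \<Rightarrow> bool" where
  "code_at P pc code \<longleftrightarrow> (\<exists>xs ys. P = xs @ code @ ys \<and> length xs = pc)"

lemma code_at_append:
  "code_at P pc (xs @ ys) \<longleftrightarrow> code_at P pc xs \<and> code_at P (pc + length xs) ys"
proof
  assume "code_at P pc (xs @ ys)"
  then obtain us vs where "P = us @ (xs @ ys) @ vs" "length us = pc"
    unfolding code_at_def by blast
  then have "P = us @ xs @ (ys @ vs) \<and> length us = pc"
    "P = (us @ xs) @ ys @ vs \<and> length (us @ xs) = pc + length xs"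
    by auto
  then show "code_at P pc xs \<and> code_at P (pc + length xs) ys"
    unfolding code_at_def by blast
next
  assume "code_at P pc xs \<and> code_at P (pc + length xs) ys"
  then obtain us vs us' vs' where *: "P = us @ xs @ vs" "length us = pc"
    "P = us' @ ys @ vs'" "length us' = pc + length xs"
    unfolding code_at_def by blast
  then have "us' = us @ xs"
    by (metis append.assoc append_eq_append_conv length_append)
  with * show "code_at P pc (xs @ ys)"
    unfolding code_at_def by (metis append.assoc)
qed

lemma code_at_Cons:
  "code_at P pc (i # ys) \<longleftrightarrow> pc < length P \<and> P ! pc = i \<and> code_at P (Suc pc) ys"
proof -
  have "code_at P pc [i] \<longleftrightarrow> pc < length P \<and> P ! pc = i"
  proof
    assume "pc < length P \<and> P ! pc = i"
    then have "P = take pc P @ [i] @ drop (Suc pc) P \<and> length (take pc P) = pc"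
      by (auto simp: id_take_nth_drop[symmetric])
    then show "code_at P pc [i]" unfolding code_at_def by blast
  qed (auto simp: code_at_def)
  then show ?thesis using code_at_append[of P pc "[i]" ys] by simp
qed

lemma code_at_Nil: "code_at P pc [] \<longleftrightarrow> pc \<le> length P"
proof
  assume "pc \<le> length P"
  then have "P = take pc P @ [] @ drop pc P \<and> length (take pc P) = pc" by simp
  then show "code_at P pc []" unfolding code_at_def by blast
qed (auto simp: code_at_def)

lemma steps_code:
  assumes "code_at P pc (i # code)" "step_instr w R i (pc, M, p) = Some (s, c)"
    "steps w R P s t s'"
  shows "steps w R P (pc, M, p) (c + t) s'"
  using assms by (auto simp: code_at_Cons code_at_Nil intro: steps.more)

section \<open>A language with registers, arrays and counting loops\<close>

type_synonym store = "(nat \<Rightarrow> nat) \<times> (nat \<Rightarrow> nat \<Rightarrow> nat)"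

text \<open>All loops share one range, the positions of the edge list, so the running time depends
  only on the syntax and on \<open>L\<close>. There is no conditional: case distinctions are
  replaced by multiplication with 0/1 flags.\<close>

datatype cmd =
    CConst nat nat
  | CAdd nat nat nat
  | CSub nat nat nat
  | CMul nat nat nat
  | CDiv nat nat nat
  | CGet nat nat nat
  | CPut nat nat nat
  | CSeq cmd cmd
  | CFor nat cmd

abbreviation seqs :: "cmd list \<Rightarrow> cmd \<Rightarrow> cmd" where
  "seqs cs c \<equiv> foldr CSeq cs c"

definition set_reg :: "nat \<Rightarrow> nat \<Rightarrow> store \<Rightarrow> store" where
  "set_reg r v \<sigma> = ((fst \<sigma>)(r := v), snd \<sigma>)"

definition set_arr :: "nat \<Rightarrow> nat \<Rightarrow> nat \<Rightarrow> store \<Rightarrow> store" where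
  "set_arr j x v \<sigma> = (fst \<sigma>, (snd \<sigma>)(j := (snd \<sigma> j)(x := v)))"

fun exec :: "nat \<Rightarrow> cmd \<Rightarrow> store \<Rightarrow> store" where
  "exec L (CConst r c) \<sigma> = set_reg r c \<sigma>"
| "exec L (CAdd r s t) \<sigma> = set_reg r (fst \<sigma> s + fst \<sigma> t) \<sigma>"
| "exec L (CSub r s t) \<sigma> = set_reg r (fst \<sigma> s - fst \<sigma> t) \<sigma>"
| "exec L (CMul r s t) \<sigma> = set_reg r (fst \<sigma> s * fst \<sigma> t) \<sigma>"
| "exec L (CDiv r s t) \<sigma> = set_reg r (fst \<sigma> s div fst \<sigma> t) \<sigma>"
| "exec L (CGet r j s) \<sigma> = set_reg r (snd \<sigma> j (fst \<sigma> s)) \<sigma>"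
| "exec L (CPut j s r) \<sigma> = set_arr j (fst \<sigma> s) (fst \<sigma> r) \<sigma>"
| "exec L (CSeq c d) \<sigma> = exec L d (exec L c \<sigma>)"
| "exec L (CFor r c) \<sigma> =
     set_reg r L (fold (\<lambda>i \<sigma>. exec L c (set_reg r i \<sigma>)) [0..<L] \<sigma>)"

text \<open>Overflow is kept apart from meaning: \<open>exec\<close> computes with unbounded
  numbers, and \<open>ok\<close> says that every value and every array index met on the way is at
  most \<open>B\<close>, so that the machine does not get stuck.\<close>

fun ok :: "nat \<Rightarrow> nat \<Rightarrow> cmd \<Rightarrow> store \<Rightarrow> bool" where
  "ok B L (CConst r c) \<sigma> \<longleftrightarrow> c \<le> B"
| "ok B L (CAdd r s t) \<sigma> \<longleftrightarrow> fst \<sigma> s + fst \<sigma> t \<le> B"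
| "ok B L (CSub r s t) \<sigma> \<longleftrightarrow> fst \<sigma> s - fst \<sigma> t \<le> B"
| "ok B L (CMul r s t) \<sigma> \<longleftrightarrow> fst \<sigma> s * fst \<sigma> t \<le> B"
| "ok B L (CDiv r s t) \<sigma> \<longleftrightarrow> fst \<sigma> s div fst \<sigma> t \<le> B"
| "ok B L (CGet r j s) \<sigma> \<longleftrightarrow> fst \<sigma> s \<le> B \<and> snd \<sigma> j (fst \<sigma> s) \<le> B"
| "ok B L (CPut j s r) \<sigma> \<longleftrightarrow> fst \<sigma> s \<le> B \<and> fst \<sigma> r \<le> B"
| "ok B L (CSeq c d) \<sigma> \<longleftrightarrow> ok B L c \<sigma> \<and> ok B L d (exec L c \<sigma>)"
| "ok B L (CFor r c) \<sigma> \<longleftrightarrow>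
     (\<forall>i<L. ok B L c (set_reg r i (fold (\<lambda>i \<sigma>. exec L c (set_reg r i \<sigma>)) [0..<i] \<sigma>)))"

fun cost :: "nat \<Rightarrow> cmd \<Rightarrow> nat" where
  "cost L (CGet r j s) = 5"
| "cost L (CPut j s r) = 5"
| "cost L (CSeq c d) = cost L c + cost L d"
| "cost L (CFor r c) = 3 + L * (cost L c + 3)"
| "cost L _ = 1"

fun loop_depth :: "cmd \<Rightarrow> nat" where
  "loop_depth (CSeq c d) = max (loop_depth c) (loop_depth d)"
| "loop_depth (CFor r c) = Suc (loop_depth c)"
| "loop_depth _ = 0"

fun written :: "cmd \<Rightarrow> nat set" where
  "written (CConst r c) = {r}"
| "written (CAdd r s t) = {r}"
| "written (CSub r s t) = {r}"
| "written (CMul r s t) = {r}"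
| "written (CDiv r s t) = {r}"
| "written (CGet r j s) = {r}"
| "written (CPut j s r) = {}"
| "written (CSeq c d) = written c \<union> written d"
| "written (CFor r c) = insert r (written c)"

text \<open>Register \<open>r\<close> lives in cell \<open>r + 5\<close>.\<close>

fun width :: "cmd \<Rightarrow> nat" where
  "width (CConst r c) = r + 6"
| "width (CAdd r s t) = max r (max s t) + 6"
| "width (CSub r s t) = max r (max s t) + 6"
| "width (CMul r s t) = max r (max s t) + 6"
| "width (CDiv r s t) = max r (max s t) + 6"
| "width (CGet r j s) = max r (max s j) + 6"
| "width (CPut j s r) = max r (max s j) + 6"
| "width (CSeq c d) = max (width c) (width d)"
| "width (CFor r c) = max (r + 6) (width c)"

text \<open>\<open>exec\<close> assigns the counter afresh in each round, while the compiled loop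
  increments its cell; the two agree because the body leaves the counter alone.\<close>

fun wf_loops :: "cmd \<Rightarrow> bool" where
  "wf_loops (CSeq c d) \<longleftrightarrow> wf_loops c \<and> wf_loops d"
| "wf_loops (CFor r c) \<longleftrightarrow> r \<notin> written c \<and> wf_loops c"
| "wf_loops _ \<longleftrightarrow> True"

lemma exec_not_written: "r \<notin> written c \<Longrightarrow> fst (exec L c \<sigma>) r = fst \<sigma> r"
proof (induction c arbitrary: \<sigma>)
  case (CFor q c)
  have "fst (fold (\<lambda>i \<sigma>. exec L c (set_reg q i \<sigma>)) is \<sigma>) r = fst \<sigma> r" for "is"
    using CFor by (induction "is" arbitrary: \<sigma>) (auto simp: set_reg_def)
  with CFor show ?case by (simp add: set_reg_def)
qed (auto simp: set_reg_def set_arr_def)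

text \<open>Each nesting level multiplies the cost by \<open>L\<close> up to a constant. The base
  \<open>L + 1\<close> keeps the bound valid for an empty edge list.\<close>

lemma cost_le: "\<exists>K. \<forall>L. cost L c \<le> K * (L + 1) ^ loop_depth c"
proof (induction c)
  case (CSeq c d)
  then obtain K K' where K: "\<And>L. cost L c \<le> K * (L + 1) ^ loop_depth c"
    "\<And>L. cost L d \<le> K' * (L + 1) ^ loop_depth d" by blast
  have "cost L (CSeq c d) \<le> (K + K') * (L + 1) ^ loop_depth (CSeq c d)" for L
  proof -
    have "K * (L + 1) ^ loop_depth c \<le> K * (L + 1) ^ loop_depth (CSeq c d)"
      "K' * (L + 1) ^ loop_depth d \<le> K' * (L + 1) ^ loop_depth (CSeq c d)"
      by (intro mult_le_mono2 power_increasing; simp)+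
    with K[of L] have "cost L c \<le> K * (L + 1) ^ loop_depth (CSeq c d)"
      "cost L d \<le> K' * (L + 1) ^ loop_depth (CSeq c d)"
      using order.trans by blast+
    then show ?thesis unfolding add_mult_distrib cost.simps by (rule add_mono)
  qed
  then show ?case by blast
next
  case (CFor r c)
  then obtain K where K: "\<And>L. cost L c \<le> K * (L + 1) ^ loop_depth c" by blast
  have "cost L (CFor r c) \<le> (K + 3) * (L + 1) ^ loop_depth (CFor r c)" for L
  proof -
    let ?p = "(L + 1) ^ loop_depth c"
    have "1 \<le> ?p" by simp
    have "cost L (CFor r c) \<le> 3 + L * (K * ?p + 3)"
      using K[of L] by simp
    also have "\<dots> \<le> 3 * ?p + L * (K * ?p + 3 * ?p)"
      using \<open>1 \<le> ?p\<close> by (intro add_mono mult_le_mono2) auto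
    also have "\<dots> \<le> (K + 3) * ((L + 1) * ?p)"
      by (simp add: algebra_simps)
    finally show ?thesis by (simp add: mult.assoc)
  qed
  then show ?case by blast
qed (auto intro: exI[of _ 5])

lemma loop_invariant:
  assumes "Inv 0 \<sigma>"
    and "\<And>i \<sigma>. i < L \<Longrightarrow> Inv i \<sigma> \<Longrightarrow>
      ok B L c (set_reg r i \<sigma>) \<and> Inv (Suc i) (exec L c (set_reg r i \<sigma>))"
  shows "ok B L (CFor r c) \<sigma> \<and> (\<exists>\<tau>. Inv L \<tau> \<and> exec L (CFor r c) \<sigma> = set_reg r L \<tau>)"
proof -
  have "i \<le> L \<Longrightarrow> Inv i (fold (\<lambda>i \<sigma>. exec L c (set_reg r i \<sigma>)) [0..<i] \<sigma>)" for i
    using assms by (induction i) auto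
  with assms(2) show ?thesis
    by (metis exec.simps(9) less_imp_le_nat ok.simps(9) order_refl)
qed

section \<open>Compilation\<close>

fun compile :: "nat \<Rightarrow> cmd \<Rightarrow> instr list" where
  "compile pc (CConst r c) = [Const (r + 5) c]"
| "compile pc (CAdd r s t) = [Add (r + 5) (s + 5) (t + 5)]"
| "compile pc (CSub r s t) = [Sub (r + 5) (s + 5) (t + 5)]"
| "compile pc (CMul r s t) = [Mul (r + 5) (s + 5) (t + 5)]"
| "compile pc (CDiv r s t) = [Div (r + 5) (s + 5) (t + 5)]"
| "compile pc (CGet r j s) = [Const 0 j, Mul 1 (s + 5) 2, Add 0 0 1, Add 0 0 2, Load (r + 5) 0]"
| "compile pc (CPut j s r) = [Const 0 j, Mul 1 (s + 5) 2, Add 0 0 1, Add 0 0 2, Store 0 (r + 5)]"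
| "compile pc (CSeq c d) = (let code = compile pc c in code @ compile (pc + length code) d)"
| "compile pc (CFor r c) = (let code = compile (pc + 3) c in
     [Const (r + 5) 0, JumpLess (r + 5) 4 (pc + 3), Jump (pc + 5 + length code)] @ code @
     [Add (r + 5) (r + 5) 3, Jump (pc + 1)])"

text \<open>
  Cells 0 and 1 are scratch, cells 2, 3, 4 hold \<open>S\<close>, 1 and the loop bound \<open>L\<close>, register \<open>r\<close> is
  cell \<open>r + 5\<close>, and entry \<open>x\<close> of array \<open>j\<close> is cell \<open>(x + 1) * S + j\<close>.
\<close>

definition encodes :: "nat \<Rightarrow> nat \<Rightarrow> store \<Rightarrow> (nat \<Rightarrow> nat) \<Rightarrow> bool" where
  "encodes S L \<sigma> M \<longleftrightarrow> M 2 = S \<and> M 3 = 1 \<and> M 4 = L \<and>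
     (\<forall>r. r + 5 < S \<longrightarrow> M (r + 5) = fst \<sigma> r) \<and>
     (\<forall>j x. j < S \<longrightarrow> M ((x + 1) * S + j) = snd \<sigma> j x)"

text \<open>The arrays are interleaved in rows of width \<open>S\<close>: row \<open>x + 1\<close>
  holds entry \<open>x\<close> of every array, and row 0 the registers. Thus \<open>S\<close> is
  fixed at compile time although the lengths of the arrays depend on the input.\<close>

lemma address_inj:
  fixes x y j i S :: nat
  assumes "j < S" "i < S"
  shows "(x + 1) * S + j = (y + 1) * S + i \<longleftrightarrow> x = y \<and> j = i"
proof
  assume eq: "(x + 1) * S + j = (y + 1) * S + i"
  have "((x + 1) * S + j) div S = x + 1" "((y + 1) * S + i) div S = y + 1"
    using assms by (subst div_mult_self3; simp)+
  with eq have "x + 1 = y + 1" by metis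
  with eq show "x = y \<and> j = i" by simp
qed simp

lemma encodes_scratch: "encodes S L \<sigma> M \<Longrightarrow> i < 2 \<Longrightarrow> 5 < S \<Longrightarrow> encodes S L \<sigma> (M(i := v))"
  unfolding encodes_def by (auto simp: less_2_cases_iff)

lemma encodes_set_reg:
  assumes "encodes S L \<sigma> M" "r + 5 < S"
  shows "encodes S L (set_reg r v \<sigma>) (M(r + 5 := v))"
proof -
  have "r + 5 < (x + 1) * S + j" for x j using assms(2) by simp
  then have "(x + 1) * S + j \<noteq> r + 5" for x j by (metis less_irrefl)
  with assms show ?thesis unfolding encodes_def set_reg_def by auto
qed

lemma encodes_set_arr:
  assumes "encodes S L \<sigma> M" "j < S" "5 < S"
  shows "encodes S L (set_arr j x v \<sigma>) (M((x + 1) * S + j := v))"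
proof -
  have "i < (x + 1) * S + j" if "i < S" for i using that by simp
  then have "i \<noteq> (x + 1) * S + j" if "i < S" for i using that by (metis less_irrefl)
  moreover have "(y + 1) * S + i = (x + 1) * S + j \<longleftrightarrow> y = x \<and> i = j" if "i < S" for i y
    using address_inj that assms(2) by blast
  ultimately show ?thesis
    using assms unfolding encodes_def set_arr_def fst_conv snd_conv fun_upd_apply by simp
qed

text \<open>An index of at most \<open>B\<close> leads to an address below
  \<open>(B + 2) * S\<close>, so this one inequality makes all partial results of the address
  computation words.\<close>

lemma steps_address:
  assumes "encodes S L \<sigma> M" "j < S" "s + 5 < S" "fst \<sigma> s \<le> B" "(B + 2) * S < w"
    and "code_at P pc [Const 0 j, Mul 1 (s + 5) 2, Add 0 0 1, Add 0 0 2]"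
  shows "\<exists>M'. steps w R P (pc, M, p) 4 (pc + 4, M', p) \<and> encodes S L \<sigma> M' \<and>
    M' 0 = (fst \<sigma> s + 1) * S + j"
proof -
  let ?x = "fst \<sigma> s"
  have "?x * S \<le> B * S" using assms(4) by simp
  moreover have "(B + 2) * S = B * S + S + S" by simp
  ultimately have w: "j < w" "?x * S < w" "j + ?x * S < w" "j + ?x * S + S < w"
    using assms(2,5) by linarith+
  have M: "M (s + 5) = ?x" "M 2 = S" using assms unfolding encodes_def by auto
  let ?M = "M(0 := j, 1 := ?x * S, 0 := j + ?x * S, 0 := j + ?x * S + S)"
  have "steps w R P (pc, M, p) (1 + (1 + (1 + (1 + 0)))) (pc + 4, ?M, p)"
  proof (rule steps_code[OF assms(6)])
    show "steps w R P (Suc pc, M(0 := j), p) (1 + (1 + (1 + 0))) (pc + 4, ?M, p)"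
    proof (rule steps_code[where code = "[]"])
      show "steps w R P (Suc (Suc pc), M(0 := j, 1 := ?x * S), p) (1 + (1 + 0)) (pc + 4, ?M, p)"
      proof (rule steps_code[where code = "[]"])
        show "steps w R P (Suc (Suc (Suc pc)), M(0 := j, 1 := ?x * S, 0 := j + ?x * S), p)
          (1 + 0) (pc + 4, ?M, p)"
          using assms(6) w M
          by (intro steps_code[of _ _ "Add 0 0 2" "[]"])
            (auto simp: code_at_Cons code_at_Nil put_def eval_nat_numeral intro: steps.none)
      qed (use assms(6) w M in \<open>auto simp: code_at_Cons code_at_Nil put_def\<close>)
    qed (use assms(6) w M in \<open>auto simp: code_at_Cons code_at_Nil put_def\<close>)
  qed (use w M in \<open>auto simp: put_def\<close>)
  moreover have "encodes S L \<sigma> ?M"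
    using assms by (intro encodes_scratch) auto
  ultimately show ?thesis
    by (intro exI[of _ ?M]) (simp add: algebra_simps eval_nat_numeral)
qed

lemma steps_compile:
  assumes "encodes S L \<sigma> M" "ok B L c \<sigma>" "wf_loops c" "width c \<le> S" "L \<le> B" "(B + 2) * S < w"
    and "code_at P pc (compile pc c)"
  shows "\<exists>M'. steps w R P (pc, M, p) (cost L c) (pc + length (compile pc c), M', p) \<and>
    encodes S L (exec L c \<sigma>) M'"
proof -
  have "5 < S" using assms(4) by (induction c) auto
  then have "(B + 2) * 1 \<le> (B + 2) * S" by (intro mult_le_mono2) simp
  also note assms(6)
  finally have w: "v < w" if "v \<le> B + 1" for v using that by simp
  have simple: "\<exists>M'. steps w R P (pc, M, p) 1 (pc + 1, M', p) \<and> encodes S L (set_reg r v \<sigma>) M'"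
    if "encodes S L \<sigma> M" "r + 5 < S" "v \<le> B" "code_at P pc [i]"
      "step_instr w R i (pc, M, p) = map_option (\<lambda>M'. ((Suc pc, M', p), 1)) (put w (r + 5) v M)"
    for pc \<sigma> M r v i
  proof -
    have "steps w R P (pc, M, p) (1 + 0) (pc + 1, M(r + 5 := v), p)"
      using that w[of v] by (intro steps_code[OF that(4)]) (auto simp: put_def intro: steps.none)
    with encodes_set_reg[OF that(1,2)] show ?thesis by auto
  qed
  show ?thesis
    using assms
  proof (induction c arbitrary: pc \<sigma> M)
    case (CConst r v)
    then show ?case using simple[of \<sigma> M r v pc] by simp
  next
    case (CAdd r s t)
    then show ?case
      using simple[of \<sigma> M r "M (s + 5) + M (t + 5)" pc] by (simp add: encodes_def)
  next
    case (CSub r s t)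
    then show ?case
      using simple[of \<sigma> M r "M (s + 5) - M (t + 5)" pc] by (simp add: encodes_def)
  next
    case (CMul r s t)
    then show ?case
      using simple[of \<sigma> M r "M (s + 5) * M (t + 5)" pc] by (simp add: encodes_def)
  next
    case (CDiv r s t)
    then show ?case
      using simple[of \<sigma> M r "M (s + 5) div M (t + 5)" pc] by (simp add: encodes_def)
  next
    case (CGet r j s)
    then have "j < S" "s + 5 < S" "r + 5 < S" by auto
    with CGet obtain M' where M': "steps w R P (pc, M, p) 4 (pc + 4, M', p)" "encodes S L \<sigma> M'"
      "M' 0 = (fst \<sigma> s + 1) * S + j"
      using steps_address[of S L \<sigma> M j s B w P pc R p] by (auto simp: code_at_Cons code_at_Nil)
    have v: "M' (M' 0) = snd \<sigma> j (fst \<sigma> s)"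
      using M' CGet.prems unfolding encodes_def by auto
    obtain M'' where M'': "steps w R P (pc + 4, M', p) 1 (pc + 5, M'', p)"
      "encodes S L (set_reg r (snd \<sigma> j (fst \<sigma> s)) \<sigma>) M''"
      using simple[OF M'(2), of r "M' (M' 0)" "pc + 4" "Load (r + 5) 0"] CGet.prems v \<open>r + 5 < S\<close>
      by (auto simp: code_at_Cons code_at_Nil eval_nat_numeral)
    from steps_trans[OF M'(1) M''(1)] M''(2) show ?case by (auto simp: eval_nat_numeral)
  next
    case (CPut j s r)
    then have "j < S" "s + 5 < S" "r + 5 < S" by auto
    with CPut obtain M' where M': "steps w R P (pc, M, p) 4 (pc + 4, M', p)" "encodes S L \<sigma> M'"
      "M' 0 = (fst \<sigma> s + 1) * S + j"
      using steps_address[of S L \<sigma> M j s B w P pc R p] by (auto simp: code_at_Cons code_at_Nil)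
    have v: "M' (r + 5) = fst \<sigma> r"
      using M' CPut.prems unfolding encodes_def by auto
    have "code_at P (pc + 4) [Store 0 (r + 5)]" "fst \<sigma> r < w"
      using CPut.prems w by (auto simp: code_at_Cons code_at_Nil eval_nat_numeral)
    then have "steps w R P (pc + 4, M', p) (1 + 0)
        (pc + 5, M'((fst \<sigma> s + 1) * S + j := fst \<sigma> r), p)"
      using v M'(3)
      by (intro steps_code[of _ _ "Store 0 (r + 5)"])
        (auto simp: put_def eval_nat_numeral simp del: mult_Suc intro: steps.none)
    from steps_trans[OF M'(1) this]
    have "steps w R P (pc, M, p) (cost L (CPut j s r)) (pc + length (compile pc (CPut j s r)),
        M'((fst \<sigma> s + 1) * S + j := fst \<sigma> r), p)"
      by (simp add: eval_nat_numeral)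
    with encodes_set_arr[OF M'(2) \<open>j < S\<close> \<open>5 < S\<close>] show ?case
      unfolding exec.simps by blast
  next
    case (CSeq c d)
    let ?pc = "pc + length (compile pc c)"
    have code: "code_at P pc (compile pc c)" "code_at P ?pc (compile ?pc d)"
      using CSeq.prems(7) by (simp_all add: Let_def code_at_append)
    obtain M' where M': "steps w R P (pc, M, p) (cost L c) (?pc, M', p)"
      "encodes S L (exec L c \<sigma>) M'"
      using CSeq.IH(1)[OF CSeq.prems(1) _ _ _ CSeq.prems(5,6) code(1)] CSeq.prems by auto
    obtain M'' where M'': "steps w R P (?pc, M', p) (cost L d)
        (?pc + length (compile ?pc d), M'', p)"
      "encodes S L (exec L d (exec L c \<sigma>)) M''"
      using CSeq.IH(2)[OF M'(2) _ _ _ CSeq.prems(5,6) code(2)] CSeq.prems by auto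
    from steps_trans[OF M'(1) M''(1)] M''(2) show ?case by (auto simp: Let_def add.assoc)
  next
    case (CFor r c)
    define code where "code = compile (pc + 3) c"
    define n where "n = length code"
    have code: "code_at P pc [Const (r + 5) 0]"
      "code_at P (pc + 1) [JumpLess (r + 5) 4 (pc + 3)]"
      "code_at P (pc + 2) [Jump (pc + 5 + n)]"
      "code_at P (pc + 3) code"
      "code_at P (pc + 3 + n) [Add (r + 5) (r + 5) 3]"
      "code_at P (pc + 3 + n + 1) [Jump (pc + 1)]"
      using CFor.prems(7)
      by (auto simp: Let_def code_at_append code_at_Cons code_at_Nil eval_nat_numeral code_def n_def)
    define f where "f = (\<lambda>i. fold (\<lambda>i \<sigma>. exec L c (set_reg r i \<sigma>)) [0..<i] \<sigma>)"
    have r: "r + 5 < S" "r \<notin> written c" using CFor.prems by auto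
    \<comment> \<open>Position \<open>pc + 1\<close> is the loop test. One round costs three units
      besides the body: the test, the increment and the jump back.\<close>
    have iter: "\<exists>M'. steps w R P (pc, M, p) (1 + i * (cost L c + 3)) (pc + 1, M', p) \<and>
      encodes S L (set_reg r i (f i)) M'" if "i \<le> L" for i
      using that
    proof (induction i)
      case 0
      have "f 0 = \<sigma>" by (simp add: f_def)
      with simple[OF CFor.prems(1) r(1), of 0 pc "Const (r + 5) 0"] code(1) show ?case by simp
    next
      case (Suc i)
      then obtain M1 where M1: "steps w R P (pc, M, p) (1 + i * (cost L c + 3)) (pc + 1, M1, p)"
        "encodes S L (set_reg r i (f i)) M1" by auto
      have "M1 (r + 5) = i" "M1 4 = L"
        using M1(2) r unfolding encodes_def set_reg_def by auto
      with Suc have s1: "steps w R P (pc + 1, M1, p) (1 + 0) (pc + 3, M1, p)"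
        by (intro steps_code[OF code(2)]) (auto intro: steps.none)
      have "ok B L c (set_reg r i (f i))" using CFor.prems Suc by (auto simp: f_def)
      with CFor.IH[OF M1(2), of "pc + 3"] CFor.prems code(4)
      obtain M2 where M2: "steps w R P (pc + 3, M1, p) (cost L c) (pc + 3 + n, M2, p)"
        "encodes S L (f (Suc i)) M2"
        by (auto simp: code_def n_def f_def)
      have "fst (f (Suc i)) r = i"
        using exec_not_written[OF r(2)] by (simp add: f_def set_reg_def)
      with M2(2) r(1) have "M2 (r + 5) = i" "M2 3 = 1" unfolding encodes_def by auto
      with simple[OF M2(2) r(1), of "Suc i" "pc + 3 + n" "Add (r + 5) (r + 5) 3"] code(5)
        Suc CFor.prems
      obtain M3 where M3: "steps w R P (pc + 3 + n, M2, p) 1 (pc + 3 + n + 1, M3, p)"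
        "encodes S L (set_reg r (Suc i) (f (Suc i))) M3"
        by auto
      have "steps w R P (pc + 3 + n + 1, M3, p) (1 + 0) (pc + 1, M3, p)"
        by (intro steps_code[OF code(6)]) (auto intro: steps.none)
      with M1 s1 M2 M3 have "steps w R P (pc, M, p)
        ((1 + i * (cost L c + 3)) + ((1 + 0) + (cost L c + (1 + (1 + 0))))) (pc + 1, M3, p)"
        by (blast intro: steps_trans)
      with M3(2) show ?case by (auto simp: algebra_simps eval_nat_numeral)
    qed
    from iter[of L] obtain M' where M': "steps w R P (pc, M, p) (1 + L * (cost L c + 3)) (pc + 1, M', p)"
      "encodes S L (set_reg r L (f L)) M'" by auto
    have "M' (r + 5) = L" "M' 4 = L"
      using M'(2) r unfolding encodes_def set_reg_def by auto
    moreover have "steps w R P (pc + 2, M', p) (1 + 0) (pc + 5 + n, M', p)"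
      by (intro steps_code[OF code(3)]) (auto intro: steps.none)
    ultimately have "steps w R P (pc + 1, M', p) (1 + (1 + 0)) (pc + 5 + n, M', p)"
      by (intro steps_code[OF code(2)]) auto
    note fin = steps_trans[OF M'(1) this]
    have "(1 + L * (cost L c + 3)) + (1 + (1 + 0)) = cost L (CFor r c)" by simp
    moreover have "pc + 5 + n = pc + length (compile pc (CFor r c))"
      by (simp add: Let_def code_def n_def)
    moreover have "set_reg r L (f L) = exec L (CFor r c) \<sigma>" by (simp add: f_def)
    ultimately show ?case using fin M'(2) by metis
  qed
qed

section \<open>Copying the edge list into arrays 0 and 1\<close>

definition edge_arrays :: "(nat \<times> nat) list \<Rightarrow> nat \<Rightarrow> nat \<Rightarrow> nat" where
  "edge_arrays E = (\<lambda>_ _. 0)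
     (0 := \<lambda>i. if i < length E then fst (E ! i) else 0,
      1 := \<lambda>i. if i < length E then snd (E ! i) else 0)"

definition copy_edge :: cmd where
  "copy_edge = CSeq (CPut 0 2 0) (CSeq (CPut 1 2 1) (CAdd 2 2 3))"

text \<open>Registers 0 and 1 receive a pair, register 2 counts the pairs and register 3 (cell 8)
  holds the increment 1. The copying code has 11 instructions and fills positions 4 to 14. At the
  end of the scan the jump to 16 moves the count into cell 4 as the loop bound, by adding register 4
  (cell 9), which is still 0.\<close>

definition prelude :: "nat \<Rightarrow> instr list" where
  "prelude S = [Const 2 S, Const 3 1, Const 8 1, NextEdge 5 6 16] @ compile 4 copy_edge @
     [Jump 3, Add 4 7 9]"

lemma length_prelude: "length (prelude S) = 17"
  by (simp add: prelude_def copy_edge_def)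

lemma steps_prelude:
  assumes "code_at P 0 (prelude S)" "11 \<le> S" "(B + 2) * S < w" "L = length (edge_list R)" "L \<le> B"
    and "\<And>x y. (x, y) \<in> set (edge_list R) \<Longrightarrow> x \<le> B \<and> y \<le> B"
  shows "\<exists>M \<sigma>. steps w R P (0, (\<lambda>_. 0)(0 := n), 0)
      (5 + (\<Sum>i\<le>L. scan_cost R i) + 13 * L) (17, M, L) \<and>
    encodes S L \<sigma> M \<and> snd \<sigma> = edge_arrays (edge_list R)"
proof -
  let ?E = "edge_list R"
  define M0 where "M0 = ((\<lambda>_::nat. 0::nat)(0 := n))"
  let ?M = "M0(2 := S, 3 := 1, 8 := 1)"
  have code: "code_at P 0 [Const 2 S, Const 3 1, Const 8 1]" "code_at P 3 [NextEdge 5 6 16]"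
    "code_at P 4 (compile 4 copy_edge)" "code_at P 15 [Jump 3]" "code_at P 16 [Add 4 7 9]"
    using assms(1) unfolding prelude_def
    by (auto simp: code_at_append code_at_Cons code_at_Nil copy_edge_def eval_nat_numeral)
  have "(B + 2) * 1 \<le> (B + 2) * S" using assms(2) by (intro mult_le_mono2) simp
  also note assms(3)
  finally have w: "v < w" if "v \<le> B + 1" for v using that by simp
  have "2 * S \<le> (B + 2) * S" by simp
  with assms(3) have "S < w" using assms(2) by linarith
  have start: "steps w R P (0, M0, 0) (1 + (1 + (1 + 0))) (3, ?M, 0)"
  proof (rule steps_code[OF code(1)])
    show "steps w R P (1, M0(2 := S), 0) (1 + (1 + 0)) (3, ?M, 0)"
    proof (rule steps_code[where code = "[]"])
      show "steps w R P (2, M0(2 := S, 3 := 1), 0) (1 + 0) (3, ?M, 0)"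
        using code(1) w[of 1]
        by (intro steps_code[where code = "[]" and i = "Const 8 1"])
          (auto simp: code_at_Cons code_at_Nil put_def eval_nat_numeral intro: steps.none)
    qed (use code(1) w[of 1] in \<open>auto simp: code_at_Cons code_at_Nil put_def eval_nat_numeral\<close>)
  qed (use \<open>S < w\<close> in \<open>auto simp: put_def\<close>)
  \<comment> \<open>The loop bound is unknown until the scan ends, so cell 4 still holds 0; this is
    harmless since \<open>copy_edge\<close> has no loop.\<close>
  have "encodes S 0 ((\<lambda>_. 0)(3 := 1), edge_arrays []) ?M"
    using assms(2) by (auto simp: encodes_def edge_arrays_def M0_def)
  have iter: "\<exists>M \<sigma>. steps w R P (0, M0, 0)
      (3 + (\<Sum>i<l. scan_cost R i) + 13 * l) (3, M, l) \<and>
    encodes S 0 \<sigma> M \<and> snd \<sigma> = edge_arrays (take l ?E) \<and> fst \<sigma> 2 = l \<and> fst \<sigma> 3 = 1 \<and>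
    fst \<sigma> 4 = 0" if "l \<le> L" for l
    using that
  proof (induction l)
    case 0
    have "steps w R P (0, M0, 0) 3 (3, ?M, 0)"
      using start by (simp add: numeral_3_eq_3)
    with \<open>encodes S 0 _ ?M\<close> have "\<exists>M. steps w R P (0, M0, 0) 3 (3, M, 0) \<and>
        encodes S 0 ((\<lambda>_. 0)(3 := 1), edge_arrays []) M"
      by blast
    then obtain M where "steps w R P (0, M0, 0) 3 (3, M, 0)"
      "encodes S 0 ((\<lambda>_. 0)(3 := 1), edge_arrays []) M" by blast
    then show ?case
      by (intro exI[of _ M] exI[of _ "((\<lambda>_. 0)(3 := 1), edge_arrays [])"])
        simp
  next
    case (Suc l)
    then obtain M \<sigma> where IH: "steps w R P (0, M0, 0)
        (3 + (\<Sum>i<l. scan_cost R i) + 13 * l) (3, M, l)"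
      "encodes S 0 \<sigma> M" "snd \<sigma> = edge_arrays (take l ?E)" "fst \<sigma> 2 = l" "fst \<sigma> 3 = 1"
      "fst \<sigma> 4 = 0" by auto
    obtain x y where xy: "?E ! l = (x, y)" by force
    with Suc assms(4) have "(x, y) \<in> set ?E" by (metis Suc_le_lessD nth_mem)
    with assms(6) have le: "x \<le> B" "y \<le> B" by auto
    let ?\<sigma> = "set_reg 1 y (set_reg 0 x \<sigma>)"
    let ?M' = "M(0 + 5 := x, 1 + 5 := y)"
    have enc: "encodes S 0 ?\<sigma> ?M'"
      using assms(2) IH(2) by (intro encodes_set_reg) auto
    have s1: "steps w R P (3, M, l) (1 + scan_cost R l + 0) (4, ?M', Suc l)"
      using le w[of x] w[of y] Suc assms(4) xy
      by (intro steps_code[OF code(2)]) (auto simp: put_def eval_nat_numeral intro: steps.none)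
    have "ok B 0 copy_edge ?\<sigma>"
      using le IH Suc assms(4,5) by (simp add: copy_edge_def set_reg_def set_arr_def)
    from steps_compile[OF enc this _ _ _ assms(3) code(3), of R "Suc l"] assms(2)
    obtain M'' where M'': "steps w R P (4, ?M', Suc l) 11 (15, M'', Suc l)"
      "encodes S 0 (exec 0 copy_edge ?\<sigma>) M''"
      by (auto simp: copy_edge_def)
    have "steps w R P (15, M'', Suc l) (1 + 0) (3, M'', Suc l)"
      by (intro steps_code[OF code(4)]) (auto intro: steps.none)
    from steps_trans[OF IH(1) steps_trans[OF s1 steps_trans[OF M''(1) this]]]
    have "steps w R P (0, M0, 0)
        (3 + (\<Sum>i<Suc l. scan_cost R i) + 13 * Suc l) (3, M'', Suc l)"
      by (simp add: algebra_simps)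
    moreover have "snd (exec 0 copy_edge ?\<sigma>) = edge_arrays (take (Suc l) ?E)"
      using Suc assms(4) IH xy
      by (auto simp: copy_edge_def set_reg_def set_arr_def edge_arrays_def fun_eq_iff
          take_Suc_conv_app_nth nth_append less_Suc_eq)
    moreover have "fst (exec 0 copy_edge ?\<sigma>) 2 = Suc l" "fst (exec 0 copy_edge ?\<sigma>) 3 = 1"
      "fst (exec 0 copy_edge ?\<sigma>) 4 = 0"
      using IH by (simp_all add: copy_edge_def set_reg_def set_arr_def)
    ultimately show ?case using M''(2) by blast
  qed
  from iter[of L] obtain M \<sigma> where it: "steps w R P (0, M0, 0)
        (3 + (\<Sum>i<L. scan_cost R i) + 13 * L) (3, M, L)"
      "encodes S 0 \<sigma> M" "snd \<sigma> = edge_arrays ?E" "fst \<sigma> 2 = L" "fst \<sigma> 4 = 0"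
    using assms(4) by auto
  have M: "M 7 = L" "M 9 = 0"
    using it assms(2) unfolding encodes_def by (auto dest: spec[of _ 2] spec[of _ 4])
  have "steps w R P (3, M, L) (1 + scan_cost R L + (1 + 0)) (17, M(4 := L), L)"
  proof (rule steps_code[OF code(2)])
    show "steps w R P (16, M, L) (1 + 0) (17, M(4 := L), L)"
      using M w[of L] assms(5) by (intro steps_code[OF code(5)]) (auto simp: put_def intro: steps.none)
  qed (use assms(4) in auto)
  from steps_trans[OF it(1) this]
  have "steps w R P (0, M0, 0) (5 + (\<Sum>i\<le>L. scan_cost R i) + 13 * L)
      (17, M(4 := L), L)"
    by (simp add: lessThan_Suc_atMost[symmetric] algebra_simps)
  moreover have "encodes S L \<sigma> (M(4 := L))"
    using it(2) assms(2) unfolding encodes_def by auto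
  ultimately show ?thesis using it(3) unfolding M0_def by blast
qed

section \<open>Linear-time evaluation of vector expressions\<close>

section \<open>Vector expressions over the vertices of an edge list\<close>

text \<open>
  \<open>Hot1\<close> and \<open>Hot2\<close> are the indicators of the two endpoints of the current anchor edge, \<open>Inp\<close> is a
  given vector, \<open>Step\<close> multiplies by the adjacency matrix and \<open>Tot\<close> yields the constant vector of the
  sum of all entries.
\<close>

datatype vexp = One | Hot1 | Hot2 | Inp | Step vexp | Tot vexp | Times vexp vexp

abbreviation support :: "(nat \<times> nat) list \<Rightarrow> nat set" where
  "support E \<equiv> fst ` set E"

text \<open>\<open>Tot\<close> ranges over the vertices that lie on an edge; isolated vertices lie
  on no path with two or more vertices.\<close>

fun ev :: "(nat \<times> nat) list \<Rightarrow> nat \<Rightarrow> nat \<Rightarrow> (nat \<Rightarrow> nat) \<Rightarrow> vexp \<Rightarrow> nat \<Rightarrow> nat" where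
  "ev E a b W One x = 1"
| "ev E a b W Hot1 x = of_bool (x = a)"
| "ev E a b W Hot2 x = of_bool (x = b)"
| "ev E a b W Inp x = W x"
| "ev E a b W (Step e) x = (\<Sum>p\<leftarrow>E. of_bool (fst p = x) * ev E a b W e (snd p))"
| "ev E a b W (Tot e) x = (\<Sum>y\<in>support E. ev E a b W e y)"
| "ev E a b W (Times e f) x = ev E a b W e x * ev E a b W f x"

text \<open>The table for one part of a cut word: entry \<open>x\<close> collects the anchor edges
  whose first end is \<open>x\<close>, the image of the cut letter.\<close>

definition rooted_sum :: "(nat \<times> nat) list \<Rightarrow> vexp \<Rightarrow> nat \<Rightarrow> nat" where
  "rooted_sum E e x = (\<Sum>p\<leftarrow>E. of_bool (fst p = x) * ev E (fst p) (snd p) (\<lambda>_. 0) e (fst p))"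

text \<open>The table of the first expression becomes the input vector of the second. For a word
  that has an anchor edge without being cut, \<open>One\<close> serves as a dummy first
  component.\<close>

definition anchored_sum :: "(nat \<times> nat) list \<Rightarrow> vexp \<times> vexp \<Rightarrow> nat" where
  "anchored_sum E t =
     (\<Sum>p\<leftarrow>E. ev E (fst p) (snd p) (rooted_sum E (fst t)) (snd t) (fst p))"

text \<open>Exponent of a bound \<open>Q\<close>: every sum over edges or vertices has at most
  \<open>Q\<close> terms and adds 1, products add, and \<open>g\<close> is the exponent granted to
  the input vector.\<close>

fun deg :: "nat \<Rightarrow> vexp \<Rightarrow> nat" where
  "deg g Inp = g"
| "deg g (Step e) = Suc (deg g e)"
| "deg g (Tot e) = Suc (deg g e)"
| "deg g (Times e f) = deg g e + deg g f"
| "deg g _ = 0"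

lemma sum_list_le_length:
  fixes f :: "'a \<Rightarrow> nat"
  shows "(\<And>x. x \<in> set xs \<Longrightarrow> f x \<le> c) \<Longrightarrow> (\<Sum>x\<leftarrow>xs. f x) \<le> length xs * c"
  by (induction xs) (auto simp: add_mono)

lemma ev_le:
  assumes "length E \<le> Q" "1 \<le> Q" "\<And>x. x \<in> support E \<union> snd ` set E \<Longrightarrow> W x \<le> Q ^ g"
    and "x \<in> support E \<union> snd ` set E"
  shows "ev E a b W e x \<le> Q ^ deg g e"
  using assms(4)
proof (induction e arbitrary: x)
  case (Step e)
  have "ev E a b W (Step e) x \<le> length E * Q ^ deg g e"
    unfolding ev.simps using Step by (intro sum_list_le_length) (auto simp: of_bool_def)
  also have "\<dots> \<le> Q * Q ^ deg g e" using assms(1) by simp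
  finally show ?case by simp
next
  case (Tot e)
  have "ev E a b W (Tot e) x \<le> card (support E) * Q ^ deg g e"
    unfolding ev.simps using Tot sum_bounded_above[of "support E" "ev E a b W e" "Q ^ deg g e"] by simp
  also have "card (support E) \<le> length E"
    using card_image_le[of "set E" fst] card_length[of E] by simp
  then have "card (support E) * Q ^ deg g e \<le> Q * Q ^ deg g e" using assms(1) by simp
  finally show ?case by simp
next
  case (Times e f)
  then show ?case by (simp add: power_add mult_mono)
qed (use assms in \<open>auto simp: of_bool_def\<close>)

section \<open>Evaluating vector expressions\<close>

text \<open>
  Registers 0 and 1 hold the anchor edge, 2 and 3 are loop counters, 9 and 10 are accumulators.
  Arrays 0 and 1 are the edge list, array 2 flags the first edge of each vertex, array 3 marks the
  vertices already seen, array 4 is the input vector.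
\<close>

definition fill :: "nat \<Rightarrow> nat \<Rightarrow> cmd" where
  "fill j c = CFor 3 (seqs [CGet 4 0 3, CConst 6 c] (CPut j 4 6))"

text \<open>The result goes to array \<open>j\<close> and scratch data to the arrays above it. In
  \<open>Times\<close> the second factor is evaluated from \<open>j + 2\<close> upwards and so
  spares the first one in \<open>j + 1\<close>. In \<open>Tot\<close> the first-occurrence flag lets
  a pass over the edges count each vertex once.\<close>

fun eval_cmd :: "nat \<Rightarrow> vexp \<Rightarrow> cmd" where
  "eval_cmd j One = fill j 1"
| "eval_cmd j Hot1 = seqs [fill j 0, CConst 6 1] (CPut j 0 6)"
| "eval_cmd j Hot2 = seqs [fill j 0, CConst 6 1] (CPut j 1 6)"
| "eval_cmd j Inp = CFor 3 (seqs [CGet 4 0 3, CGet 6 4 4] (CPut j 4 6))"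
| "eval_cmd j (Step e) = seqs [eval_cmd (j + 1) e, fill j 0]
     (CFor 3 (seqs [CGet 4 0 3, CGet 5 1 3, CGet 6 j 4, CGet 7 (j + 1) 5, CAdd 6 6 7] (CPut j 4 6)))"
| "eval_cmd j (Tot e) = seqs [eval_cmd (j + 1) e, CConst 8 0,
     CFor 3 (seqs [CGet 4 0 3, CGet 6 2 3, CGet 7 (j + 1) 4, CMul 7 6 7] (CAdd 8 8 7))]
     (CFor 3 (CSeq (CGet 4 0 3) (CPut j 4 8)))"
| "eval_cmd j (Times e f) = seqs [eval_cmd (j + 1) e, eval_cmd (j + 2) f]
     (CFor 3 (seqs [CGet 4 0 3, CGet 6 (j + 1) 4, CGet 7 (j + 2) 4, CMul 6 6 7] (CPut j 4 6)))"

definition same_except :: "nat set \<Rightarrow> nat set \<Rightarrow> store \<Rightarrow> store \<Rightarrow> bool" where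
  "same_except Rs As \<sigma> \<tau> \<longleftrightarrow>
     (\<forall>r. r \<notin> Rs \<longrightarrow> fst \<tau> r = fst \<sigma> r) \<and> (\<forall>j. j \<notin> As \<longrightarrow> snd \<tau> j = snd \<sigma> j)"

lemma same_except_refl: "same_except Rs As \<sigma> \<sigma>"
  by (simp add: same_except_def)

lemma same_except_trans:
  "same_except Rs As \<sigma> \<tau> \<Longrightarrow> same_except Rs' As' \<tau> \<upsilon> \<Longrightarrow> Rs \<subseteq> Rs'' \<Longrightarrow> Rs' \<subseteq> Rs'' \<Longrightarrow>
   As \<subseteq> As'' \<Longrightarrow> As' \<subseteq> As'' \<Longrightarrow> same_except Rs'' As'' \<sigma> \<upsilon>"
  unfolding same_except_def by (metis subsetD)

definition edges_stored :: "(nat \<times> nat) list \<Rightarrow> store \<Rightarrow> bool" where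
  "edges_stored E \<sigma> \<longleftrightarrow> (\<forall>i<length E. snd \<sigma> 0 i = fst (E ! i) \<and> snd \<sigma> 1 i = snd (E ! i) \<and>
     snd \<sigma> 2 i = of_bool (fst (E ! i) \<notin> support (take i E)))"

lemma edges_stored_mono:
  "edges_stored E \<sigma> \<Longrightarrow> same_except Rs As \<sigma> \<tau> \<Longrightarrow> As \<subseteq> {3..} \<Longrightarrow> edges_stored E \<tau>"
proof -
  assume *: "edges_stored E \<sigma>" "same_except Rs As \<sigma> \<tau>" "As \<subseteq> {3..}"
  then have "0 \<notin> As" "1 \<notin> As" "2 \<notin> As" by auto
  with * show ?thesis unfolding edges_stored_def same_except_def by simp
qed

lemma support_take_Suc:
  "i < length E \<Longrightarrow> support (take (Suc i) E) = insert (fst (E ! i)) (support (take i E))"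
  by (simp add: take_Suc_conv_app_nth)

text \<open>A pass over the pairs is a pass over the vertices: each vertex of
  \<open>support E\<close> is the first component of some pair, and meeting it again rewrites the
  same value \<open>h x\<close>.\<close>

lemma vertex_loop:
  assumes "L = length E"
    and body: "\<And>i \<tau>. i < L \<Longrightarrow> same_except {3..7} {j} \<sigma> \<tau> \<Longrightarrow>
      ok B L c (set_reg 3 i \<tau>) \<and>
      same_except {3..7} {j} \<tau> (exec L c (set_reg 3 i \<tau>)) \<and>
      snd (exec L c (set_reg 3 i \<tau>)) j = (snd \<tau> j)(fst (E ! i) := h (fst (E ! i)))"
  shows "ok B L (CFor 3 c) \<sigma> \<and> same_except {3..7} {j} \<sigma> (exec L (CFor 3 c) \<sigma>) \<and>
    (\<forall>x\<in>support E. snd (exec L (CFor 3 c) \<sigma>) j x = h x)"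
proof -
  let ?Inv = "\<lambda>i \<tau>. same_except {3..7} {j} \<sigma> \<tau> \<and> (\<forall>x\<in>support (take i E). snd \<tau> j x = h x)"
  have "ok B L (CFor 3 c) \<sigma> \<and> (\<exists>\<tau>. ?Inv L \<tau> \<and> exec L (CFor 3 c) \<sigma> = set_reg 3 L \<tau>)"
  proof (rule loop_invariant)
    fix i \<tau> assume i: "i < L" and inv: "?Inv i \<tau>"
    note b = body[OF i conjunct1[OF inv]]
    have "same_except {3..7} {j} \<sigma> (exec L c (set_reg 3 i \<tau>))"
      using same_except_trans[OF conjunct1[OF inv] conjunct1[OF conjunct2[OF b]]] by blast
    then show "ok B L c (set_reg 3 i \<tau>) \<and> ?Inv (Suc i) (exec L c (set_reg 3 i \<tau>))"
      using b inv i assms(1) by (simp add: support_take_Suc)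
  qed (simp add: same_except_refl)
  then obtain \<tau> where t: "ok B L (CFor 3 c) \<sigma>" "?Inv L \<tau>"
    "exec L (CFor 3 c) \<sigma> = set_reg 3 L \<tau>" by blast
  show ?thesis
    unfolding t(3) using t(1,2) assms(1)
    by (auto simp: same_except_def set_reg_def simp del: ok.simps)
qed

lemmas exec_simps = set_reg_def set_arr_def

lemma seq_simps:
  "exec L (seqs [] d) \<sigma> = exec L d \<sigma>"
  "exec L (seqs (c # cs) d) \<sigma> = exec L (seqs cs d) (exec L c \<sigma>)"
  "ok B L (seqs [] d) \<sigma> \<longleftrightarrow> ok B L d \<sigma>"
  "ok B L (seqs (c # cs) d) \<sigma> \<longleftrightarrow> ok B L c \<sigma> \<and> ok B L (seqs cs d) (exec L c \<sigma>)"
  by simp_all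

locale bounded_edges =
  fixes E :: "(nat \<times> nat) list" and L B :: nat
  assumes L: "L = length E" and LB: "L \<le> B" and one_le: "1 \<le> B"
    and sym: "snd ` set E \<subseteq> support E"
    and bounded: "\<And>x. x \<in> support E \<Longrightarrow> x \<le> B"
begin

lemma nth_bounded: "i < L \<Longrightarrow> fst (E ! i) \<in> support E \<and> snd (E ! i) \<in> support E \<and>
    fst (E ! i) \<le> B \<and> snd (E ! i) \<le> B \<and> i \<le> B"
  using L LB sym bounded nth_mem[of i E] by (auto simp: subset_iff)

lemma fill:
  assumes "edges_stored E \<sigma>" "3 \<le> j" "c \<le> B"
  shows "ok B L (fill j c) \<sigma> \<and> same_except {3..7} {j} \<sigma> (exec L (fill j c) \<sigma>) \<and>
    (\<forall>x\<in>support E. snd (exec L (fill j c) \<sigma>) j x = c)"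
  unfolding fill_def
proof (rule vertex_loop[OF L])
  fix i \<tau> assume *: "i < L" "same_except {3..7} {j} \<sigma> \<tau>"
  then have "edges_stored E \<tau>" using assms edges_stored_mono by auto
  then show "ok B L (seqs [CGet 4 0 3, CConst 6 c] (CPut j 4 6)) (set_reg 3 i \<tau>) \<and>
    same_except {3..7} {j} \<tau> (exec L (seqs [CGet 4 0 3, CConst 6 c] (CPut j 4 6)) (set_reg 3 i \<tau>)) \<and>
    snd (exec L (seqs [CGet 4 0 3, CConst 6 c] (CPut j 4 6)) (set_reg 3 i \<tau>)) j =
      (snd \<tau> j)(fst (E ! i) := c)"
    using * nth_bounded[of i] assms L
    by (auto simp: exec_simps same_except_def edges_stored_def)
qed

lemma take_sum_le:
  fixes f :: "nat \<times> nat \<Rightarrow> nat"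
  shows "(\<Sum>p\<leftarrow>take i E. f p) \<le> (\<Sum>p\<leftarrow>E. f p)"
proof -
  have "(\<Sum>p\<leftarrow>E. f p) = (\<Sum>p\<leftarrow>take i E. f p) + (\<Sum>p\<leftarrow>drop i E. f p)"
    by (metis append_take_drop_id map_append sum_list_append)
  then show ?thesis by simp
qed

text \<open>The frame condition carries the induction: evaluating a subexpression leaves the edge
  list, the flags, the input vector and the results already stored below its own array
  intact.\<close>

lemma eval_cmd:
  assumes "edges_stored E \<sigma>" "5 \<le> j" "fst \<sigma> 0 = a" "fst \<sigma> 1 = b"
    and "a \<in> support E" "b \<in> support E"
    and "\<And>x. x \<in> support E \<Longrightarrow> snd \<sigma> 4 x = W x" "\<And>x. x \<in> support E \<Longrightarrow> W x \<le> Q ^ g"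
    and "L \<le> Q" "1 \<le> Q" "Q ^ deg g e \<le> B"
  shows "ok B L (eval_cmd j e) \<sigma> \<and> same_except {3..8} {j..} \<sigma> (exec L (eval_cmd j e) \<sigma>) \<and>
    (\<forall>x\<in>support E. snd (exec L (eval_cmd j e) \<sigma>) j x = ev E a b W e x)"
  using assms
proof (induction e arbitrary: j \<sigma>)
  case One
  then show ?case
    using fill[of \<sigma> j 1] one_le by (auto simp: same_except_def)
next
  case Hot1
  then have f: "ok B L (fill j 0) \<sigma>" "same_except {3..7} {j} \<sigma> (exec L (fill j 0) \<sigma>)"
    "\<And>x. x \<in> support E \<Longrightarrow> snd (exec L (fill j 0) \<sigma>) j x = 0"
    using fill[of \<sigma> j 0] by auto
  with Hot1 bounded[of a] one_le show ?case
    by (auto simp: exec_simps same_except_def)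
next
  case Hot2
  then have f: "ok B L (fill j 0) \<sigma>" "same_except {3..7} {j} \<sigma> (exec L (fill j 0) \<sigma>)"
    "\<And>x. x \<in> support E \<Longrightarrow> snd (exec L (fill j 0) \<sigma>) j x = 0"
    using fill[of \<sigma> j 0] by auto
  with Hot2 bounded[of b] one_le show ?case
    by (auto simp: exec_simps same_except_def)
next
  case Inp
  let ?c = "seqs [CGet 4 0 3, CGet 6 4 4] (CPut j 4 6)"
  have "ok B L (CFor 3 ?c) \<sigma> \<and> same_except {3..7} {j} \<sigma> (exec L (CFor 3 ?c) \<sigma>) \<and>
    (\<forall>x\<in>support E. snd (exec L (CFor 3 ?c) \<sigma>) j x = W x)"
  proof (rule vertex_loop[OF L])
    fix i \<tau> assume *: "i < L" "same_except {3..7} {j} \<sigma> \<tau>"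
    then have e: "edges_stored E \<tau>" using Inp edges_stored_mono by auto
    have "snd \<tau> 4 = snd \<sigma> 4" using * Inp by (auto simp: same_except_def)
    then have "snd \<tau> 4 (fst (E ! i)) = W (fst (E ! i))" "W (fst (E ! i)) \<le> B"
      using Inp nth_bounded[OF *(1)] by (auto intro: order.trans[of _ "Q ^ g"])
    with e show "ok B L ?c (set_reg 3 i \<tau>) \<and>
      same_except {3..7} {j} \<tau> (exec L ?c (set_reg 3 i \<tau>)) \<and>
      snd (exec L ?c (set_reg 3 i \<tau>)) j = (snd \<tau> j)(fst (E ! i) := W (fst (E ! i)))"
      using * nth_bounded[of i] Inp L
      by (auto simp: exec_simps same_except_def edges_stored_def)
  qed
  then show ?case by (auto simp: same_except_def)
next
  case (Step e)
  let ?h = "ev E a b W e"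
  let ?sum = "\<lambda>i x. \<Sum>p\<leftarrow>take i E. of_bool (fst p = x) * ?h (snd p)"
  define \<sigma>1 where "\<sigma>1 = exec L (eval_cmd (j + 1) e) \<sigma>"
  define \<sigma>2 where "\<sigma>2 = exec L (fill j 0) \<sigma>1"
  have "Q ^ deg g e \<le> Q ^ deg g (Step e)" using Step.prems by (intro power_increasing) auto
  with Step.prems have Q: "Q ^ deg g e \<le> B" by linarith
  have s1: "ok B L (eval_cmd (j + 1) e) \<sigma>" "same_except {3..8} {j + 1..} \<sigma> \<sigma>1"
    "\<And>x. x \<in> support E \<Longrightarrow> snd \<sigma>1 (j + 1) x = ?h x"
    using Step.IH[of \<sigma> "j + 1"] Step.prems Q unfolding \<sigma>1_def by auto
  have "edges_stored E \<sigma>1" using edges_stored_mono[OF _ s1(2)] Step.prems by auto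
  with fill[of \<sigma>1 j 0] Step.prems
  have s2: "ok B L (fill j 0) \<sigma>1" "same_except {3..7} {j} \<sigma>1 \<sigma>2"
    "\<And>x. x \<in> support E \<Longrightarrow> snd \<sigma>2 j x = 0" unfolding \<sigma>2_def by auto
  have e2: "edges_stored E \<sigma>2" using edges_stored_mono[OF \<open>edges_stored E \<sigma>1\<close> s2(2)] Step.prems by auto
  let ?c = "seqs [CGet 4 0 3, CGet 5 1 3, CGet 6 j 4, CGet 7 (j + 1) 5, CAdd 6 6 7] (CPut j 4 6)"
  let ?Inv = "\<lambda>i \<tau>. same_except {3..7} {j} \<sigma>2 \<tau> \<and> (\<forall>x\<in>support E. snd \<tau> j x = ?sum i x)"
  have W': "\<And>x. x \<in> support E \<union> snd ` set E \<Longrightarrow> W x \<le> Q ^ g" using Step.prems sym by blast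
  \<comment> \<open>Only the complete sum is bounded through \<open>deg\<close>; the partial sums
    met during the loop inherit the bound by monotonicity.\<close>
  have le: "?sum (length E) x \<le> B" if "x \<in> support E" for x
    using ev_le[of E Q W g x a b "Step e"] W' Step.prems L that by simp
  have "ok B L (CFor 3 ?c) \<sigma>2 \<and> (\<exists>\<tau>. ?Inv L \<tau> \<and> exec L (CFor 3 ?c) \<sigma>2 = set_reg 3 L \<tau>)"
  proof (rule loop_invariant)
    show "?Inv 0 \<sigma>2" using s2 by (simp add: same_except_refl)
    fix i \<tau> assume i: "i < L" and inv: "?Inv i \<tau>"
    obtain x y where xy: "E ! i = (x, y)" by force
    have mem: "x \<in> support E" "y \<in> support E" "x \<le> B" "y \<le> B" "i \<le> B"
      using nth_bounded[OF i] xy by auto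
    have v: "snd \<tau> (j + 1) y = ?h y"
      using inv s1(3) s2(2) mem by (simp add: same_except_def)
    have st: "edges_stored E \<tau>" using edges_stored_mono[OF e2 conjunct1[OF inv]] Step.prems by auto
    have suc: "?sum (Suc i) z = ?sum i z + of_bool (x = z) * ?h y" for z
      using i L xy by (simp add: take_Suc_conv_app_nth)
    have "?sum (Suc i) x \<le> B" using le[OF mem(1)] take_sum_le[of _ "Suc i"] order.trans
      by fastforce
    then have "?sum i x + ?h y \<le> B" using suc[of x] by simp
    moreover have "?h y \<le> B" using ev_le[of E Q W g y a b e] W' Step.prems Q L mem by simp
    ultimately show "ok B L ?c (set_reg 3 i \<tau>) \<and> ?Inv (Suc i) (exec L ?c (set_reg 3 i \<tau>))"
      using i inv L Step.prems st xy v mem suc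
      by (auto simp: exec_simps same_except_def edges_stored_def simp del: One_nat_def)
  qed
  then obtain \<tau> where t: "ok B L (CFor 3 ?c) \<sigma>2" "?Inv L \<tau>"
    "exec L (CFor 3 ?c) \<sigma>2 = set_reg 3 L \<tau>" by blast
  have "same_except {3..8} {j..} \<sigma> (set_reg 3 L \<tau>)"
    using s1(2) s2(2) t(2) by (auto simp: same_except_def set_reg_def)
  moreover have "\<forall>x\<in>support E. snd (set_reg 3 L \<tau>) j x = ev E a b W (Step e) x"
    using t(2) L by (simp add: set_reg_def)
  ultimately show ?case
    unfolding eval_cmd.simps seq_simps \<sigma>1_def[symmetric] \<sigma>2_def[symmetric] t(3)
    using s1(1) s2(1) t(1) by blast
next
  case (Tot e)
  let ?h = "ev E a b W e"
  define \<sigma>1 where "\<sigma>1 = exec L (eval_cmd (j + 1) e) \<sigma>"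
  define \<sigma>2 where "\<sigma>2 = set_reg 8 0 \<sigma>1"
  have "Q ^ deg g e \<le> Q ^ deg g (Tot e)" using Tot.prems by (intro power_increasing) auto
  with Tot.prems have Q: "Q ^ deg g e \<le> B" by linarith
  have s1: "ok B L (eval_cmd (j + 1) e) \<sigma>" "same_except {3..8} {j + 1..} \<sigma> \<sigma>1"
    "\<And>x. x \<in> support E \<Longrightarrow> snd \<sigma>1 (j + 1) x = ?h x"
    using Tot.IH[of \<sigma> "j + 1"] Tot.prems Q unfolding \<sigma>1_def by auto
  have "edges_stored E \<sigma>1" using edges_stored_mono[OF _ s1(2)] Tot.prems by auto
  then have e2: "edges_stored E \<sigma>2" by (simp add: \<sigma>2_def edges_stored_def set_reg_def)
  let ?c = "seqs [CGet 4 0 3, CGet 6 2 3, CGet 7 (j + 1) 4, CMul 7 6 7] (CAdd 8 8 7)"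
  let ?Inv = "\<lambda>i \<tau>. same_except {3..8} {} \<sigma>2 \<tau> \<and> fst \<tau> 8 = (\<Sum>x\<in>support (take i E). ?h x)"
  have W': "\<And>x. x \<in> support E \<union> snd ` set E \<Longrightarrow> W x \<le> Q ^ g" using Tot.prems sym by blast
  have le: "(\<Sum>x\<in>support E. ?h x) \<le> B"
    using ev_le[of E Q W g a a b "Tot e"] W' Tot.prems L by simp
  have "ok B L (CFor 3 ?c) \<sigma>2 \<and> (\<exists>\<tau>. ?Inv L \<tau> \<and> exec L (CFor 3 ?c) \<sigma>2 = set_reg 3 L \<tau>)"
  proof (rule loop_invariant)
    show "?Inv 0 \<sigma>2" by (simp add: same_except_refl \<sigma>2_def set_reg_def)
    fix i \<tau> assume i: "i < L" and inv: "?Inv i \<tau>"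
    obtain x y where xy: "E ! i = (x, y)" by force
    have mem: "x \<in> support E" "x \<le> B" "i \<le> B"
      using nth_bounded[OF i] xy by auto
    have v: "snd \<tau> (j + 1) x = ?h x"
      using inv s1(3) mem by (simp add: same_except_def \<sigma>2_def set_reg_def)
    have st: "edges_stored E \<tau>" using edges_stored_mono[OF e2 conjunct1[OF inv]] Tot.prems by auto
    have suc: "(\<Sum>z\<in>support (take (Suc i) E). ?h z) =
        (\<Sum>z\<in>support (take i E). ?h z) + of_bool (x \<notin> support (take i E)) * ?h x"
      using i L xy by (auto simp: support_take_Suc insert_absorb)
    have "(\<Sum>z\<in>support (take (Suc i) E). ?h z) \<le> (\<Sum>z\<in>support E. ?h z)"
      by (intro sum_mono2) (auto dest: in_set_takeD)
    with le suc have "(\<Sum>z\<in>support (take i E). ?h z) + of_bool (x \<notin> support (take i E)) * ?h x \<le> B"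
      by linarith
    moreover have "?h x \<le> B" using ev_le[of E Q W g x a b e] W' Tot.prems Q L mem by simp
    ultimately show "ok B L ?c (set_reg 3 i \<tau>) \<and> ?Inv (Suc i) (exec L ?c (set_reg 3 i \<tau>))"
      using i inv L Tot.prems st xy v mem suc one_le
      by (auto simp: exec_simps same_except_def edges_stored_def simp del: One_nat_def)
  qed
  then obtain \<tau> where t: "ok B L (CFor 3 ?c) \<sigma>2" "?Inv L \<tau>"
    "exec L (CFor 3 ?c) \<sigma>2 = set_reg 3 L \<tau>" by blast
  define \<sigma>3 where "\<sigma>3 = set_reg 3 L \<tau>"
  have s3: "same_except {3..8} {} \<sigma>2 \<sigma>3" "fst \<sigma>3 8 = (\<Sum>x\<in>support E. ?h x)"
    using t(2) L by (auto simp: \<sigma>3_def same_except_def set_reg_def)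
  have e3: "edges_stored E \<sigma>3" using edges_stored_mono[OF e2 s3(1)] by auto
  let ?d = "CSeq (CGet 4 0 3) (CPut j 4 8)"
  have s4: "ok B L (CFor 3 ?d) \<sigma>3 \<and> same_except {3..7} {j} \<sigma>3 (exec L (CFor 3 ?d) \<sigma>3) \<and>
    (\<forall>x\<in>support E. snd (exec L (CFor 3 ?d) \<sigma>3) j x = (\<Sum>x\<in>support E. ?h x))"
  proof (rule vertex_loop[OF L])
    fix i \<tau> assume *: "i < L" "same_except {3..7} {j} \<sigma>3 \<tau>"
    then have e: "edges_stored E \<tau>" using e3 edges_stored_mono Tot.prems by auto
    have "fst \<tau> 8 = (\<Sum>x\<in>support E. ?h x)" using * s3 by (auto simp: same_except_def)
    with e show "ok B L ?d (set_reg 3 i \<tau>) \<and>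
      same_except {3..7} {j} \<tau> (exec L ?d (set_reg 3 i \<tau>)) \<and>
      snd (exec L ?d (set_reg 3 i \<tau>)) j = (snd \<tau> j)(fst (E ! i) := \<Sum>x\<in>support E. ?h x)"
      using * nth_bounded[of i] Tot.prems L le
      by (auto simp: exec_simps same_except_def edges_stored_def)
  qed
  have "same_except {3..8} {j..} \<sigma> (exec L (CFor 3 ?d) \<sigma>3)"
    using s1(2) s3(1) conjunct1[OF conjunct2[OF s4]]
    by (auto simp: same_except_def \<sigma>2_def set_reg_def simp del: exec.simps)
  moreover have "ok B L (CConst 8 0) \<sigma>1" "exec L (CConst 8 0) \<sigma>1 = \<sigma>2"
    by (simp_all add: \<sigma>2_def)
  ultimately show ?case
    unfolding eval_cmd.simps seq_simps \<sigma>1_def[symmetric] ev.simps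
    using s1(1) t(1,3) s4 \<sigma>3_def by metis
next
  case (Times e f)
  let ?h = "ev E a b W e" and ?k = "ev E a b W f"
  define \<sigma>1 where "\<sigma>1 = exec L (eval_cmd (j + 1) e) \<sigma>"
  define \<sigma>2 where "\<sigma>2 = exec L (eval_cmd (j + 2) f) \<sigma>1"
  have "Q ^ deg g e \<le> Q ^ deg g (Times e f)" "Q ^ deg g f \<le> Q ^ deg g (Times e f)"
    using Times.prems by (intro power_increasing; auto)+
  with Times.prems have Q: "Q ^ deg g e \<le> B" "Q ^ deg g f \<le> B" by linarith+
  have s1: "ok B L (eval_cmd (j + 1) e) \<sigma>" "same_except {3..8} {j + 1..} \<sigma> \<sigma>1"
    "\<And>x. x \<in> support E \<Longrightarrow> snd \<sigma>1 (j + 1) x = ?h x"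
    using Times.IH(1)[of \<sigma> "j + 1"] Times.prems Q unfolding \<sigma>1_def by auto
  have e1: "edges_stored E \<sigma>1" using edges_stored_mono[OF _ s1(2)] Times.prems by auto
  have "fst \<sigma>1 0 = a" "fst \<sigma>1 1 = b" "snd \<sigma>1 4 = snd \<sigma> 4"
    using s1(2) Times.prems by (auto simp: same_except_def)
  with e1 Times.IH(2)[of \<sigma>1 "j + 2"] Times.prems Q
  have s2: "ok B L (eval_cmd (j + 2) f) \<sigma>1" "same_except {3..8} {j + 2..} \<sigma>1 \<sigma>2"
    "\<And>x. x \<in> support E \<Longrightarrow> snd \<sigma>2 (j + 2) x = ?k x"
    unfolding \<sigma>2_def by auto
  have e2: "edges_stored E \<sigma>2" using edges_stored_mono[OF e1 s2(2)] Times.prems by auto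
  have h: "\<And>x. x \<in> support E \<Longrightarrow> snd \<sigma>2 (j + 1) x = ?h x"
    using s1(3) s2(2) by (auto simp: same_except_def)
  have W': "\<And>x. x \<in> support E \<union> snd ` set E \<Longrightarrow> W x \<le> Q ^ g" using Times.prems sym by blast
  have le: "?h x \<le> B" "?k x \<le> B" "?h x * ?k x \<le> B" if "x \<in> support E" for x
    using ev_le[of E Q W g x a b e] ev_le[of E Q W g x a b f]
      ev_le[of E Q W g x a b "Times e f"] W' Times.prems L that Q by auto
  let ?c = "seqs [CGet 4 0 3, CGet 6 (j + 1) 4, CGet 7 (j + 2) 4, CMul 6 6 7] (CPut j 4 6)"
  have s3: "ok B L (CFor 3 ?c) \<sigma>2 \<and> same_except {3..7} {j} \<sigma>2 (exec L (CFor 3 ?c) \<sigma>2) \<and>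
    (\<forall>x\<in>support E. snd (exec L (CFor 3 ?c) \<sigma>2) j x = ?h x * ?k x)"
  proof (rule vertex_loop[OF L])
    fix i \<tau> assume *: "i < L" "same_except {3..7} {j} \<sigma>2 \<tau>"
    then have e: "edges_stored E \<tau>" using e2 edges_stored_mono Times.prems by auto
    obtain x y where xy: "E ! i = (x, y)" by force
    have mem: "x \<in> support E" "x \<le> B" "i \<le> B"
      using nth_bounded[OF *(1)] xy by auto
    have "snd \<tau> (j + 1) x = ?h x" "snd \<tau> (j + 2) x = ?k x"
      using * h[OF mem(1)] s2(3)[OF mem(1)] by (auto simp: same_except_def)
    with e le[OF mem(1)] mem show "ok B L ?c (set_reg 3 i \<tau>) \<and>
      same_except {3..7} {j} \<tau> (exec L ?c (set_reg 3 i \<tau>)) \<and>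
      snd (exec L ?c (set_reg 3 i \<tau>)) j = (snd \<tau> j)(fst (E ! i) := ?h (fst (E ! i)) * ?k (fst (E ! i)))"
      using * Times.prems L xy
      by (auto simp: exec_simps same_except_def edges_stored_def simp del: One_nat_def)
  qed
  have "same_except {3..8} {j..} \<sigma> (exec L (CFor 3 ?c) \<sigma>2)"
    using s1(2) s2(2) conjunct1[OF conjunct2[OF s3]]
    by (auto simp: same_except_def simp del: exec.simps)
  then show ?case
    unfolding eval_cmd.simps seq_simps \<sigma>1_def[symmetric] \<sigma>2_def[symmetric] ev.simps
    using s1(1) s2(1) s3 by blast
qed

end

section \<open>Sums over anchor edges as loops around the evaluation\<close>

definition scatter :: "vexp \<Rightarrow> cmd" where
  "scatter e = CFor 2 (seqs [CGet 0 0 2, CGet 1 1 2, eval_cmd 5 e, CGet 6 5 0, CGet 7 4 0, CAdd 6 6 7]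
     (CPut 4 0 6))"

definition gather :: "nat \<Rightarrow> vexp \<Rightarrow> cmd" where
  "gather acc e = CFor 2 (seqs [CGet 0 0 2, CGet 1 1 2, eval_cmd 5 e, CGet 6 5 0] (CAdd acc acc 6))"

definition term_cmd :: "nat \<Rightarrow> vexp \<times> vexp \<Rightarrow> cmd" where
  "term_cmd acc t = seqs [fill 4 0, scatter (fst t)] (gather acc (snd t))"

fun terms_cmd :: "nat \<Rightarrow> (vexp \<times> vexp) list \<Rightarrow> cmd" where
  "terms_cmd acc [] = CConst 6 0"
| "terms_cmd acc (t # ts) = CSeq (term_cmd acc t) (terms_cmd acc ts)"

definition mark_first :: cmd where
  "mark_first = CFor 3 (seqs [CGet 4 0 3, CGet 6 3 4, CConst 7 1, CSub 6 7 6, CPut 2 3 6] (CPut 3 4 7))"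

definition main_cmd :: "(vexp \<times> vexp) list \<Rightarrow> (vexp \<times> vexp) list \<Rightarrow> cmd" where
  "main_cmd pos neg = seqs [mark_first, CConst 9 0, CConst 10 0, terms_cmd 9 pos, terms_cmd 10 neg,
     CSub 9 9 10, CConst 10 2] (CDiv 9 9 10)"

lemma eval_cmd_shape:
  "wf_loops (eval_cmd j e) \<and> loop_depth (eval_cmd j e) \<le> 1 \<and> written (eval_cmd j e) \<subseteq> {3..8}"
  by (induction e arbitrary: j) (auto simp: fill_def)

text \<open>Depth 2 is the source of the quadratic running time: a loop over the anchor edges around
  evaluations of depth at most 1. The terms themselves are unrolled into a sequence.\<close>

lemma main_cmd_shape: "wf_loops (main_cmd pos neg) \<and> loop_depth (main_cmd pos neg) \<le> 2"
proof -
  have "wf_loops (terms_cmd acc ts) \<and> loop_depth (terms_cmd acc ts) \<le> 2" if "3 \<le> acc" for acc ts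
  proof (induction ts)
    case (Cons t ts)
    have "2 \<notin> written (eval_cmd 5 e)" "loop_depth (eval_cmd 5 e) \<le> 1" "wf_loops (eval_cmd 5 e)" for e
      using eval_cmd_shape[of 5 e] by auto
    with Cons that show ?case
      by (auto simp: term_cmd_def fill_def scatter_def gather_def)
  qed simp
  then show ?thesis by (auto simp: main_cmd_def mark_first_def)
qed

text \<open>A semantic condition, restricted to anchor edges in \<open>E\<close>: the expressions
  are obtained from existence statements that fix their values on such edges and say nothing about
  the occurrence of \<open>Inp\<close>.\<close>

definition input_free :: "(nat \<times> nat) list \<Rightarrow> vexp \<Rightarrow> bool" where
  "input_free E e \<longleftrightarrow> (\<forall>(a, b)\<in>set E. \<forall>x W W'. ev E a b W e x = ev E a b W' e x)"

context bounded_edges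
begin

lemma mark_first:
  assumes "snd \<sigma> = edge_arrays E"
  shows "ok B L mark_first \<sigma> \<and> edges_stored E (exec L mark_first \<sigma>)"
proof -
  let ?c = "seqs [CGet 4 0 3, CGet 6 3 4, CConst 7 1, CSub 6 7 6, CPut 2 3 6] (CPut 3 4 7)"
  let ?Inv = "\<lambda>i (\<tau> :: store). snd \<tau> 0 = edge_arrays E 0 \<and> snd \<tau> 1 = edge_arrays E 1 \<and>
    (\<forall>x. snd \<tau> 3 x = of_bool (x \<in> support (take i E))) \<and>
    (\<forall>j<i. snd \<tau> 2 j = of_bool (fst (E ! j) \<notin> support (take j E)))"
  have "ok B L (CFor 3 ?c) \<sigma> \<and> (\<exists>\<tau>. ?Inv L \<tau> \<and> exec L (CFor 3 ?c) \<sigma> = set_reg 3 L \<tau>)"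
  proof (rule loop_invariant)
    show "?Inv 0 \<sigma>" by (simp add: assms) (simp add: edge_arrays_def)
    fix i \<tau> assume i: "i < L" and inv: "?Inv i \<tau>"
    then show "ok B L ?c (set_reg 3 i \<tau>) \<and> ?Inv (Suc i) (exec L ?c (set_reg 3 i \<tau>))"
      using nth_bounded[OF i] one_le L support_take_Suc[of i E]
      by (auto simp: exec_simps edge_arrays_def less_Suc_eq)
  qed
  then obtain \<tau> where t: "ok B L (CFor 3 ?c) \<sigma>" "?Inv L \<tau>"
    "exec L (CFor 3 ?c) \<sigma> = set_reg 3 L \<tau>" by blast
  then show ?thesis
    unfolding mark_first_def t(3) using L
    by (auto simp: edges_stored_def set_reg_def edge_arrays_def simp del: ok.simps)
qed

lemma anchored_eval:
  assumes "edges_stored E \<sigma>" "i < L" "\<And>x. x \<in> support E \<Longrightarrow> snd \<sigma> 4 x = W x"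
    "\<And>x. x \<in> support E \<Longrightarrow> W x \<le> Q ^ g"
    and "L \<le> Q" "1 \<le> Q" "Q ^ deg g e \<le> B" "E ! i = (a, b)" "fst \<sigma> 2 = i"
  defines "c \<equiv> seqs [CGet 0 0 2, CGet 1 1 2, eval_cmd 5 e] (CGet 6 5 0)"
  shows "ok B L c \<sigma> \<and> same_except ({0, 1} \<union> {3..8}) {5..} \<sigma> (exec L c \<sigma>) \<and>
    fst (exec L c \<sigma>) 0 = a \<and> fst (exec L c \<sigma>) 6 = ev E a b W e a"
proof -
  define \<sigma>1 where "\<sigma>1 = set_reg 1 b (set_reg 0 a \<sigma>)"
  have ab: "a \<in> support E" "b \<in> support E" "a \<le> B" "b \<le> B" "i \<le> B" "snd \<sigma> 0 i = a" "snd \<sigma> 1 i = b"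
    using nth_bounded[OF assms(2)] assms(1,2,8) L by (auto simp: edges_stored_def)
  have e1: "edges_stored E \<sigma>1" using assms(1) by (simp add: \<sigma>1_def edges_stored_def set_reg_def)
  have s2: "ok B L (eval_cmd 5 e) \<sigma>1 \<and> same_except {3..8} {5..} \<sigma>1 (exec L (eval_cmd 5 e) \<sigma>1) \<and>
    (\<forall>x\<in>support E. snd (exec L (eval_cmd 5 e) \<sigma>1) 5 x = ev E a b W e x)"
    by (rule eval_cmd[where Q = Q and g = g])
      (use assms(3-7) e1 ab in \<open>simp_all add: \<sigma>1_def set_reg_def\<close>)
  define \<sigma>2 where "\<sigma>2 = exec L (eval_cmd 5 e) \<sigma>1"
  have "\<And>x. x \<in> support E \<union> snd ` set E \<Longrightarrow> W x \<le> Q ^ g" using assms(4) sym by blast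
  then have "ev E a b W e a \<le> Q ^ deg g e" using assms(5,6) ab L by (intro ev_le) auto
  with assms(7) have "ev E a b W e a \<le> B" by linarith
  moreover have "fst \<sigma>2 0 = a" using s2 by (simp add: \<sigma>2_def same_except_def \<sigma>1_def set_reg_def)
  moreover have "exec L (CGet 1 1 2) (exec L (CGet 0 0 2) \<sigma>) = \<sigma>1"
    using assms(9) ab by (simp add: \<sigma>1_def set_reg_def)
  moreover have "ok B L (CGet 0 0 2) \<sigma>" "ok B L (CGet 1 1 2) (exec L (CGet 0 0 2) \<sigma>)"
    using assms(9) ab by (simp_all add: set_reg_def)
  ultimately show ?thesis
    using s2 ab unfolding c_def seq_simps \<sigma>2_def[symmetric]
    by (auto simp: same_except_def \<sigma>2_def[symmetric] set_reg_def)
qed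

text \<open>The table grows in array 4, which is also where \<open>eval_cmd\<close> finds its input
  vector. So each evaluation sees a partial table, and \<open>input_free\<close> gives the value for
  the zero vector in \<open>rooted_sum\<close>.\<close>

lemma scatter:
  assumes "edges_stored E \<sigma>" "\<And>x. x \<in> support E \<Longrightarrow> snd \<sigma> 4 x = 0"
    and "input_free E e" "\<And>x. x \<in> support E \<Longrightarrow> rooted_sum E e x \<le> Q ^ g" "Q ^ g \<le> B"
    and "L \<le> Q" "1 \<le> Q" "Q ^ deg g e \<le> B"
  shows "ok B L (scatter e) \<sigma> \<and> same_except {0..8} {4..} \<sigma> (exec L (scatter e) \<sigma>) \<and>
    (\<forall>x\<in>support E. snd (exec L (scatter e) \<sigma>) 4 x = rooted_sum E e x)"
proof -
  let ?sum = "\<lambda>i x. \<Sum>p\<leftarrow>take i E. of_bool (fst p = x) * ev E (fst p) (snd p) (\<lambda>_. 0) e (fst p)"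
  let ?c = "seqs [CGet 0 0 2, CGet 1 1 2, eval_cmd 5 e, CGet 6 5 0, CGet 7 4 0, CAdd 6 6 7] (CPut 4 0 6)"
  let ?d = "seqs [CGet 0 0 2, CGet 1 1 2, eval_cmd 5 e] (CGet 6 5 0)"
  let ?f = "seqs [CGet 7 4 0, CAdd 6 6 7] (CPut 4 0 6)"
  let ?Inv = "\<lambda>i \<tau>. same_except {0..8} {4..} \<sigma> \<tau> \<and> (\<forall>x\<in>support E. snd \<tau> 4 x = ?sum i x)"
  have split: "ok B L ?c \<tau> \<longleftrightarrow> ok B L ?d \<tau> \<and> ok B L ?f (exec L ?d \<tau>)"
    "exec L ?c \<tau> = exec L ?f (exec L ?d \<tau>)" for \<tau>
    unfolding seq_simps by blast+
  have "ok B L (CFor 2 ?c) \<sigma> \<and> (\<exists>\<tau>. ?Inv L \<tau> \<and> exec L (CFor 2 ?c) \<sigma> = set_reg 2 L \<tau>)"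
  proof (rule loop_invariant)
    show "?Inv 0 \<sigma>" using assms by (simp add: same_except_refl)
    fix i \<tau> assume i: "i < L" and inv: "?Inv i \<tau>"
    obtain a b where ab: "E ! i = (a, b)" by force
    have mem: "a \<in> support E" "a \<le> B" "(a, b) \<in> set E"
      using nth_bounded[OF i] ab i L nth_mem[of i E] by auto
    have suc: "?sum (Suc i) z = ?sum i z + of_bool (a = z) * ev E a b (\<lambda>_. 0) e a" for z
      using i L ab by (simp add: take_Suc_conv_app_nth)
    have le: "?sum l x \<le> Q ^ g" if "x \<in> support E" for l x
      using assms(4)[OF that] take_sum_le[of _ l] order.trans unfolding rooted_sum_def by fastforce
    have st: "edges_stored E \<tau>" using edges_stored_mono[OF assms(1) conjunct1[OF inv]] by auto
    define \<tau>1 where "\<tau>1 = exec L ?d (set_reg 2 i \<tau>)"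
    have "ok B L ?d (set_reg 2 i \<tau>) \<and> same_except ({0, 1} \<union> {3..8}) {5..} (set_reg 2 i \<tau>) \<tau>1 \<and>
      fst \<tau>1 0 = a \<and> fst \<tau>1 6 = ev E a b (?sum i) e a"
      unfolding \<tau>1_def using i inv assms le ab st
      by (intro anchored_eval[where Q = Q and g = g]) (auto simp: set_reg_def edges_stored_def)
    moreover have "ev E a b (?sum i) e a = ev E a b (\<lambda>_. 0) e a"
      using assms(3) mem unfolding input_free_def by fast
    moreover have "?sum i a + ev E a b (\<lambda>_. 0) e a \<le> B" "?sum i a \<le> B"
      using suc[of a] le[OF mem(1), of "Suc i"] le[OF mem(1), of i] assms(5) by auto
    moreover have "snd \<tau>1 4 = snd \<tau> 4" "snd \<tau> 4 a = ?sum i a"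
      using calculation(1) inv mem by (auto simp: same_except_def set_reg_def)
    ultimately show "ok B L ?c (set_reg 2 i \<tau>) \<and> ?Inv (Suc i) (exec L ?c (set_reg 2 i \<tau>))"
      unfolding split \<tau>1_def[symmetric] using mem inv suc
      by (auto simp: exec_simps same_except_def add.commute simp del: eval_cmd.simps)
  qed
  then obtain \<tau> where t: "ok B L (CFor 2 ?c) \<sigma>" "?Inv L \<tau>"
    "exec L (CFor 2 ?c) \<sigma> = set_reg 2 L \<tau>" by blast
  then show ?thesis
    unfolding scatter_def t(3) rooted_sum_def using L
    by (auto simp: same_except_def set_reg_def simp del: ok.simps)
qed

lemma gather:
  assumes "edges_stored E \<sigma>" "\<And>x. x \<in> support E \<Longrightarrow> snd \<sigma> 4 x = W x"
    and "\<And>x. x \<in> support E \<Longrightarrow> W x \<le> Q ^ g" "L \<le> Q" "1 \<le> Q" "Q ^ deg g e \<le> B" "9 \<le> acc"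
    and "fst \<sigma> acc + (\<Sum>p\<leftarrow>E. ev E (fst p) (snd p) W e (fst p)) \<le> B"
  shows "ok B L (gather acc e) \<sigma> \<and> same_except (insert acc {0..8}) {4..} \<sigma> (exec L (gather acc e) \<sigma>) \<and>
    fst (exec L (gather acc e) \<sigma>) acc =
      fst \<sigma> acc + (\<Sum>p\<leftarrow>E. ev E (fst p) (snd p) W e (fst p))"
proof -
  let ?sum = "\<lambda>i. \<Sum>p\<leftarrow>take i E. ev E (fst p) (snd p) W e (fst p)"
  let ?c = "seqs [CGet 0 0 2, CGet 1 1 2, eval_cmd 5 e, CGet 6 5 0] (CAdd acc acc 6)"
  let ?d = "seqs [CGet 0 0 2, CGet 1 1 2, eval_cmd 5 e] (CGet 6 5 0)"
  let ?Inv = "\<lambda>i \<tau>. same_except (insert acc {0..8}) {5..} \<sigma> \<tau> \<and> fst \<tau> acc = fst \<sigma> acc + ?sum i"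
  have split: "ok B L ?c \<tau> \<longleftrightarrow> ok B L ?d \<tau> \<and> ok B L (CAdd acc acc 6) (exec L ?d \<tau>)"
    "exec L ?c \<tau> = exec L (CAdd acc acc 6) (exec L ?d \<tau>)" for \<tau>
    unfolding seq_simps by blast+
  have "ok B L (CFor 2 ?c) \<sigma> \<and> (\<exists>\<tau>. ?Inv L \<tau> \<and> exec L (CFor 2 ?c) \<sigma> = set_reg 2 L \<tau>)"
  proof (rule loop_invariant)
    show "?Inv 0 \<sigma>" using assms by (simp add: same_except_refl)
    fix i \<tau> assume i: "i < L" and inv: "?Inv i \<tau>"
    obtain a b where ab: "E ! i = (a, b)" by force
    have suc: "?sum (Suc i) = ?sum i + ev E a b W e a"
      using i L ab by (simp add: take_Suc_conv_app_nth)
    have le: "fst \<sigma> acc + ?sum (Suc i) \<le> B"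
      using assms(8) take_sum_le[of "\<lambda>p. ev E (fst p) (snd p) W e (fst p)" "Suc i"] by linarith
    have st: "edges_stored E \<tau>" using edges_stored_mono[OF assms(1) conjunct1[OF inv]] by auto
    have "snd \<tau> 4 = snd \<sigma> 4" using inv by (auto simp: same_except_def)
    define \<tau>1 where "\<tau>1 = exec L ?d (set_reg 2 i \<tau>)"
    have "ok B L ?d (set_reg 2 i \<tau>) \<and> same_except ({0, 1} \<union> {3..8}) {5..} (set_reg 2 i \<tau>) \<tau>1 \<and>
      fst \<tau>1 0 = a \<and> fst \<tau>1 6 = ev E a b W e a"
      unfolding \<tau>1_def using i assms ab st \<open>snd \<tau> 4 = snd \<sigma> 4\<close>
      by (intro anchored_eval[where Q = Q and g = g]) (auto simp: set_reg_def edges_stored_def)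
    then show "ok B L ?c (set_reg 2 i \<tau>) \<and> ?Inv (Suc i) (exec L ?c (set_reg 2 i \<tau>))"
      unfolding split \<tau>1_def[symmetric] using inv suc le assms(7)
      by (auto simp: exec_simps same_except_def simp del: eval_cmd.simps)
  qed
  then obtain \<tau> where t: "ok B L (CFor 2 ?c) \<sigma>" "?Inv L \<tau>"
    "exec L (CFor 2 ?c) \<sigma> = set_reg 2 L \<tau>" by blast
  then show ?thesis
    unfolding gather_def t(3) using L assms(7)
    by (auto simp: same_except_def set_reg_def simp del: ok.simps)
qed

text \<open>The exponent \<open>g\<close> of the table differs from term to term, while
  \<open>B\<close> is common to all; hence the quantifier inside.\<close>

definition term_ok :: "vexp \<times> vexp \<Rightarrow> bool" where
  "term_ok t \<longleftrightarrow> input_free E (fst t) \<and>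
     (\<exists>Q g. L \<le> Q \<and> 1 \<le> Q \<and> (\<forall>x\<in>support E. rooted_sum E (fst t) x \<le> Q ^ g) \<and>
       Q ^ g \<le> B \<and> Q ^ deg g (fst t) \<le> B \<and> Q ^ deg g (snd t) \<le> B)"

lemma term_cmd:
  assumes "edges_stored E \<sigma>" "term_ok t" "9 \<le> acc" "fst \<sigma> acc + anchored_sum E t \<le> B"
  shows "ok B L (term_cmd acc t) \<sigma> \<and>
    same_except (insert acc {0..8}) {4..} \<sigma> (exec L (term_cmd acc t) \<sigma>) \<and>
    fst (exec L (term_cmd acc t) \<sigma>) acc = fst \<sigma> acc + anchored_sum E t"
proof -
  from assms(2) obtain Q g where Q: "L \<le> Q" "1 \<le> Q" "input_free E (fst t)"
    "\<And>x. x \<in> support E \<Longrightarrow> rooted_sum E (fst t) x \<le> Q ^ g"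
    "Q ^ g \<le> B" "Q ^ deg g (fst t) \<le> B" "Q ^ deg g (snd t) \<le> B"
    unfolding term_ok_def by blast
  define \<sigma>1 where "\<sigma>1 = exec L (fill 4 0) \<sigma>"
  define \<sigma>2 where "\<sigma>2 = exec L (scatter (fst t)) \<sigma>1"
  have s1: "ok B L (fill 4 0) \<sigma>" "same_except {3..7} {4} \<sigma> \<sigma>1" "\<And>x. x \<in> support E \<Longrightarrow> snd \<sigma>1 4 x = 0"
    using fill[OF assms(1), of 4 0] by (auto simp: \<sigma>1_def)
  have e1: "edges_stored E \<sigma>1" using edges_stored_mono[OF assms(1) s1(2)] by auto
  have s2: "ok B L (scatter (fst t)) \<sigma>1" "same_except {0..8} {4..} \<sigma>1 \<sigma>2"
    "\<And>x. x \<in> support E \<Longrightarrow> snd \<sigma>2 4 x = rooted_sum E (fst t) x"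
    using scatter[OF e1 s1(3) Q(3,4,5,1,2,6)] by (auto simp: \<sigma>2_def)
  have e2: "edges_stored E \<sigma>2" using edges_stored_mono[OF e1 s2(2)] by auto
  have acc: "fst \<sigma>2 acc = fst \<sigma> acc" using s1(2) s2(2) assms(3) by (auto simp: same_except_def)
  have s3: "ok B L (gather acc (snd t)) \<sigma>2 \<and>
    same_except (insert acc {0..8}) {4..} \<sigma>2 (exec L (gather acc (snd t)) \<sigma>2) \<and>
    fst (exec L (gather acc (snd t)) \<sigma>2) acc = fst \<sigma> acc + anchored_sum E t"
    unfolding anchored_sum_def acc[symmetric]
    by (rule gather[OF e2])
      (use s2(3) Q assms(3,4) acc in \<open>simp_all add: anchored_sum_def\<close>)
  have "same_except (insert acc {0..8}) {4..} \<sigma> (exec L (gather acc (snd t)) \<sigma>2)"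
    using s1(2) s2(2) s3 by (auto simp: same_except_def)
  with s1(1) s2(1) s3 show ?thesis
    unfolding term_cmd_def seq_simps \<sigma>1_def[symmetric] \<sigma>2_def[symmetric] by blast
qed

lemma terms_cmd:
  assumes "edges_stored E \<sigma>" "\<forall>t\<in>set ts. term_ok t" "9 \<le> acc"
    and "fst \<sigma> acc + (\<Sum>t\<leftarrow>ts. anchored_sum E t) \<le> B"
  shows "ok B L (terms_cmd acc ts) \<sigma> \<and>
    same_except (insert acc {0..8}) {4..} \<sigma> (exec L (terms_cmd acc ts) \<sigma>) \<and>
    fst (exec L (terms_cmd acc ts) \<sigma>) acc = fst \<sigma> acc + (\<Sum>t\<leftarrow>ts. anchored_sum E t)"
  using assms
proof (induction ts arbitrary: \<sigma>)
  case Nil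
  then show ?case by (auto simp: same_except_def set_reg_def)
next
  case (Cons t ts)
  define \<sigma>1 where "\<sigma>1 = exec L (term_cmd acc t) \<sigma>"
  have s1: "ok B L (term_cmd acc t) \<sigma>" "same_except (insert acc {0..8}) {4..} \<sigma> \<sigma>1"
    "fst \<sigma>1 acc = fst \<sigma> acc + anchored_sum E t"
    using term_cmd[of \<sigma> t acc] Cons.prems by (auto simp: \<sigma>1_def)
  have e1: "edges_stored E \<sigma>1" using edges_stored_mono[OF Cons.prems(1) s1(2)] by auto
  note IH = Cons.IH[OF e1]
  have "same_except (insert acc {0..8}) {4..} \<sigma> (exec L (terms_cmd acc ts) \<sigma>1)"
    using IH s1 Cons.prems by (auto simp: same_except_def)
  with IH s1 Cons.prems show ?case by (simp add: \<sigma>1_def[symmetric])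
qed

lemma main_cmd:
  assumes "snd \<sigma> = edge_arrays E" "\<forall>t\<in>set pos \<union> set neg. term_ok t" "2 \<le> B"
    and "(\<Sum>t\<leftarrow>pos. anchored_sum E t) \<le> B" "(\<Sum>t\<leftarrow>neg. anchored_sum E t) \<le> B"
  shows "ok B L (main_cmd pos neg) \<sigma> \<and> fst (exec L (main_cmd pos neg) \<sigma>) 9 =
    ((\<Sum>t\<leftarrow>pos. anchored_sum E t) - (\<Sum>t\<leftarrow>neg. anchored_sum E t)) div 2"
proof -
  define \<sigma>1 where "\<sigma>1 = exec L mark_first \<sigma>"
  define \<sigma>2 where "\<sigma>2 = set_reg 10 0 (set_reg 9 0 \<sigma>1)"
  define \<sigma>3 where "\<sigma>3 = exec L (terms_cmd 9 pos) \<sigma>2"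
  define \<sigma>4 where "\<sigma>4 = exec L (terms_cmd 10 neg) \<sigma>3"
  have s1: "ok B L mark_first \<sigma>" "edges_stored E \<sigma>1" using mark_first[OF assms(1)] by (auto simp: \<sigma>1_def)
  then have e2: "edges_stored E \<sigma>2" by (simp add: \<sigma>2_def edges_stored_def set_reg_def)
  have s3: "ok B L (terms_cmd 9 pos) \<sigma>2" "same_except (insert 9 {0..8}) {4..} \<sigma>2 \<sigma>3"
    "fst \<sigma>3 9 = (\<Sum>t\<leftarrow>pos. anchored_sum E t)"
    using terms_cmd[OF e2, of pos 9] assms by (auto simp: \<sigma>3_def \<sigma>2_def set_reg_def)
  have e3: "edges_stored E \<sigma>3" using edges_stored_mono[OF e2 s3(2)] by auto
  have "fst \<sigma>3 10 = 0" using s3(2) by (simp add: same_except_def \<sigma>2_def set_reg_def)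
  with terms_cmd[OF e3, of neg 10] assms
  have s4: "ok B L (terms_cmd 10 neg) \<sigma>3" "same_except (insert 10 {0..8}) {4..} \<sigma>3 \<sigma>4"
    "fst \<sigma>4 10 = (\<Sum>t\<leftarrow>neg. anchored_sum E t)"
    by (auto simp: \<sigma>4_def)
  have "fst \<sigma>4 9 = (\<Sum>t\<leftarrow>pos. anchored_sum E t)"
    using s4(2) s3(3) by (simp add: same_except_def)
  moreover have "exec L (CConst 10 0) (exec L (CConst 9 0) \<sigma>1) = \<sigma>2" by (simp add: \<sigma>2_def)
  ultimately show ?thesis
    unfolding main_cmd_def seq_simps \<sigma>1_def[symmetric]
    using s1 s3(1) s4(1,3) assms
    by (auto simp: \<sigma>3_def[symmetric] \<sigma>4_def[symmetric] set_reg_def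
        intro: order.trans[OF div_le_dividend] order.trans[OF diff_le_self] simp del: One_nat_def)
qed

end

section \<open>Homomorphism counts of anchored forests as vector expressions\<close>

section \<open>Weighted homomorphism counts\<close>

definition sym_edges :: "(nat \<times> nat) list \<Rightarrow> bool" where
  "sym_edges E \<longleftrightarrow> distinct E \<and> (\<forall>x y. (x, y) \<in> set E \<longrightarrow> (y, x) \<in> set E \<and> x \<noteq> y)"

definition maps :: "(nat \<times> nat) list \<Rightarrow> 'l set \<Rightarrow> ('l \<Rightarrow> nat) set" where
  "maps E U = U \<rightarrow>\<^sub>E support E"

definition edge_hom :: "(nat \<times> nat) list \<Rightarrow> ('l \<times> 'l) set \<Rightarrow> ('l \<Rightarrow> nat) \<Rightarrow> bool" where
  "edge_hom E F \<phi> \<longleftrightarrow> (\<forall>(u, v)\<in>F. (\<phi> u, \<phi> v) \<in> set E)"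

text \<open>A partition function: the weights of the vertices record what the parts of the graph
  removed so far contribute.\<close>

definition wsum :: "(nat \<times> nat) list \<Rightarrow> 'l set \<Rightarrow> ('l \<times> 'l) set \<Rightarrow> ('l \<Rightarrow> nat \<Rightarrow> nat) \<Rightarrow> nat" where
  "wsum E U F h = (\<Sum>\<phi>\<in>maps E U. (\<Prod>u\<in>U. h u (\<phi> u)) * of_bool (edge_hom E F \<phi>))"

lemma finite_maps: "finite U \<Longrightarrow> finite (maps E U)"
  by (simp add: maps_def finite_PiE)

lemma maps_mem: "\<phi> \<in> maps E U \<Longrightarrow> u \<in> U \<Longrightarrow> \<phi> u \<in> support E"
  by (auto simp: maps_def)

lemma sum_maps_insert:
  assumes "u \<notin> U"
  shows "(\<Sum>\<phi>\<in>maps E (insert u U). f \<phi>) = (\<Sum>\<phi>\<in>maps E U. \<Sum>x\<in>support E. f (\<phi>(u := x)))"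
proof -
  have "(\<Sum>\<phi>\<in>maps E (insert u U). f \<phi>) = (\<Sum>(x, \<phi>)\<in>support E \<times> maps E U. f (\<phi>(u := x)))"
    unfolding maps_def PiE_insert_eq
    by (subst sum.reindex[OF inj_combinator[OF assms]]) (simp add: comp_def case_prod_unfold)
  also have "\<dots> = (\<Sum>x\<in>support E. \<Sum>\<phi>\<in>maps E U. f (\<phi>(u := x)))"
    by (simp add: sum.cartesian_product)
  finally show ?thesis by (subst sum.swap)
qed

lemma sum_maps_Un:
  assumes "finite B" "A \<inter> B = {}"
  shows "(\<Sum>\<phi>\<in>maps E (A \<union> B). f \<phi>) =
    (\<Sum>\<phi>\<in>maps E A. \<Sum>\<psi>\<in>maps E B. f (\<lambda>x. if x \<in> B then \<psi> x else \<phi> x))"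
  using assms
proof (induction B arbitrary: f rule: finite_induct)
  case empty
  then show ?case by (simp add: maps_def)
next
  case (insert b B)
  have "(\<Sum>\<phi>\<in>maps E (A \<union> insert b B). f \<phi>) =
      (\<Sum>\<phi>\<in>maps E (A \<union> B). \<Sum>x\<in>support E. f (\<phi>(b := x)))"
    using insert sum_maps_insert[of b "A \<union> B" f E] by simp
  also have "\<dots> = (\<Sum>\<phi>\<in>maps E A. \<Sum>\<psi>\<in>maps E B. \<Sum>x\<in>support E.
      f ((\<lambda>x. if x \<in> B then \<psi> x else \<phi> x)(b := x)))"
    using insert by (subst insert.IH) auto
  also have "\<dots> = (\<Sum>\<phi>\<in>maps E A. \<Sum>\<psi>\<in>maps E B. \<Sum>x\<in>support E.
      f (\<lambda>y. if y \<in> insert b B then (\<psi>(b := x)) y else \<phi> y))"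
    by (intro sum.cong refl arg_cong[where f = f]) (auto simp: fun_eq_iff)
  also have "\<dots> = (\<Sum>\<phi>\<in>maps E A. \<Sum>\<psi>\<in>maps E (insert b B).
      f (\<lambda>y. if y \<in> insert b B then \<psi> y else \<phi> y))"
    using insert by (subst sum_maps_insert) auto
  finally show ?case .
qed

lemma sum_edges_conv:
  assumes "sym_edges E"
  shows "(\<Sum>p\<leftarrow>E. f p) = (\<Sum>p\<in>set E. f p)"
  using assms by (simp add: sym_edges_def sum_list_distinct_conv_sum_set)

lemma sum_neighbours:
  assumes "sym_edges E"
  shows "(\<Sum>p\<leftarrow>E. of_bool (fst p = x) * h (snd p)) = (\<Sum>y\<in>support E. of_bool ((x, y) \<in> set E) * h y :: nat)"
proof -
  have "(\<Sum>p\<leftarrow>E. of_bool (fst p = x) * h (snd p)) = (\<Sum>p\<in>set E. of_bool (fst p = x) * h (snd p))"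
    by (rule sum_edges_conv[OF assms])
  also have "\<dots> = (\<Sum>p\<in>Pair x ` {y. (x, y) \<in> set E}. h (snd p))"
    by (rule sum.mono_neutral_cong_right) auto
  also have "\<dots> = (\<Sum>y\<in>{y. (x, y) \<in> set E}. h y)"
    by (subst sum.reindex) (auto simp: inj_on_def)
  also have "\<dots> = (\<Sum>y\<in>support E. of_bool ((x, y) \<in> set E) * h y)"
    using assms by (intro sum.mono_neutral_cong_left) (force simp: sym_edges_def image_iff)+
  finally show ?thesis .
qed

text \<open>Only the weight of the leaf \<open>u\<close> and the edge \<open>vu\<close> involve the
  image of \<open>u\<close>. Summing over it gives the adjacency matrix applied to
  \<open>h u\<close>, read at the image of \<open>v\<close>, and this factor is absorbed into the
  weight of \<open>v\<close>.\<close>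

lemma wsum_leaf:
  assumes "sym_edges E" "finite U" "u \<notin> U" "v \<in> U" "F \<subseteq> U \<times> U"
  shows "wsum E (insert u U) (insert (v, u) F) h =
    wsum E U F (h(v := \<lambda>x. h v x * (\<Sum>p\<leftarrow>E. of_bool (fst p = x) * h u (snd p))))"
proof -
  have pointwise: "(\<Prod>w\<in>insert u U. h w ((\<phi>(u := x)) w)) * of_bool (edge_hom E (insert (v, u) F) (\<phi>(u := x))) =
    (\<Prod>w\<in>U. h w (\<phi> w)) * of_bool (edge_hom E F \<phi>) * (of_bool ((\<phi> v, x) \<in> set E) * h u x)" for \<phi> x
  proof -
    have "u \<noteq> v" using assms by auto
    moreover have "a \<noteq> u \<and> b \<noteq> u" if "(a, b) \<in> F" for a b using that assms by auto
    then have "edge_hom E F (\<phi>(u := x)) \<longleftrightarrow> edge_hom E F \<phi>"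
      unfolding edge_hom_def by (intro ball_cong refl) (auto split: prod.splits)
    moreover have "(\<Prod>w\<in>U. h w ((\<phi>(u := x)) w)) = (\<Prod>w\<in>U. h w (\<phi> w))"
      using assms by (intro prod.cong) auto
    ultimately show ?thesis using assms by (auto simp: edge_hom_def)
  qed
  have "wsum E (insert u U) (insert (v, u) F) h = (\<Sum>\<phi>\<in>maps E U. (\<Prod>w\<in>U. h w (\<phi> w)) *
    of_bool (edge_hom E F \<phi>) * (\<Sum>x\<in>support E. of_bool ((\<phi> v, x) \<in> set E) * h u x))"
    unfolding wsum_def sum_maps_insert[OF assms(3)] sum_distrib_left
    by (intro sum.cong pointwise) simp_all
  also have "\<dots> = wsum E U F (h(v := \<lambda>x. h v x * (\<Sum>p\<leftarrow>E. of_bool (fst p = x) * h u (snd p))))"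
    unfolding wsum_def sum_neighbours[OF assms(1)]
  proof (rule sum.cong[OF refl])
    fix \<phi>
    let ?s = "\<lambda>x. \<Sum>y\<in>support E. of_bool ((x, y) \<in> set E) * h u y"
    have "(\<Prod>w\<in>U. (h(v := \<lambda>x. h v x * ?s x)) w (\<phi> w)) =
      h v (\<phi> v) * ?s (\<phi> v) * (\<Prod>w\<in>U - {v}. h w (\<phi> w))"
      using assms by (subst prod.remove[of U v]) (auto intro: prod.cong)
    moreover have "(\<Prod>w\<in>U. h w (\<phi> w)) = h v (\<phi> v) * (\<Prod>w\<in>U - {v}. h w (\<phi> w))"
      using assms by (subst prod.remove[of U v]) auto
    ultimately show "(\<Prod>w\<in>U. h w (\<phi> w)) * of_bool (edge_hom E F \<phi>) * ?s (\<phi> v) =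
      (\<Prod>w\<in>U. (h(v := \<lambda>x. h v x * ?s x)) w (\<phi> w)) * of_bool (edge_hom E F \<phi>)"
      by (simp add: mult_ac)
  qed
  finally show ?thesis .
qed

lemma edge_hom_flip: "sym_edges E \<Longrightarrow> edge_hom E (insert (u, v) F) = edge_hom E (insert (v, u) F)"
  unfolding edge_hom_def sym_edges_def by (auto simp: fun_eq_iff)

section \<open>Forests\<close>

fun untouched :: "'l \<Rightarrow> ('l \<times> 'l) list \<Rightarrow> bool" where
  "untouched u [] = True"
| "untouched u ((a, b) # es) = (if u = a then False else if u = b then False else untouched u es)"

text \<open>The first argument holds the edges that were inspected since the last removal of a leaf.\<close>

function forest :: "('l \<times> 'l) list \<Rightarrow> ('l \<times> 'l) list \<Rightarrow> bool" where
  "forest [] [] = True"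
| "forest (e # bef) [] = False"
| "forest bef ((u, v) # es) =
     (if (if untouched u bef then untouched u es else False) then forest [] (bef @ es)
      else if (if untouched v bef then untouched v es else False) then forest [] (bef @ es)
      else forest ((u, v) # bef) es)"
  by pat_completeness auto
termination
  by (relation "measures [\<lambda>(bef, es). length bef + length es, \<lambda>(bef, es). length es]") auto

lemma untouched_iff: "untouched u es \<longleftrightarrow> u \<notin> fst ` set es \<and> u \<notin> snd ` set es"
  by (induction u es rule: untouched.induct) auto

text \<open>The base case of leaf removal: the vertices of an edgeless graph are mapped
  independently, so its weighted count is a product of totals.\<close>

lemma vexp_prod:
  assumes "finite U"
  shows "\<exists>e. \<forall>E a b W x. ev E a b W e x = (\<Prod>u\<in>U. \<Sum>y\<in>support E. ev E a b W (h u) y)"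
  using assms
proof (induction rule: finite_induct)
  case empty
  then show ?case by (intro exI[of _ One]) simp
next
  case (insert u U)
  then obtain e where "\<forall>E a b W x. ev E a b W e x = (\<Prod>u\<in>U. \<Sum>y\<in>support E. ev E a b W (h u) y)"
    by blast
  with insert show ?case by (intro exI[of _ "Times (Tot (h u)) e"]) simp
qed

text \<open>Every removed leaf turns into a \<open>Step\<close> multiplied onto the expression of
  its neighbour, until isolated vertices remain. The value is a constant vector, and the expression
  depends on the forest and on \<open>h\<close> only, not on \<open>E\<close>, \<open>a\<close>,
  \<open>b\<close> or \<open>W\<close>.\<close>

lemma forest_vexp:
  assumes "forest bef es" "finite U" "\<forall>(u, v)\<in>set (bef @ es). u \<in> U \<and> v \<in> U \<and> u \<noteq> v"
  shows "\<exists>e. \<forall>E a b W x. sym_edges E \<longrightarrow>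
    wsum E U (set (bef @ es)) (\<lambda>u. ev E a b W (h u)) = ev E a b W e x"
  using assms
proof (induction bef es arbitrary: U h rule: forest.induct)
  case 1
  obtain e where e: "\<forall>E a b W x. ev E a b W e x = (\<Prod>u\<in>U. \<Sum>y\<in>support E. ev E a b W (h u) y)"
    using vexp_prod[OF 1(2)] by blast
  have "wsum E U {} (\<lambda>u. ev E a b W (h u)) = (\<Prod>u\<in>U. \<Sum>y\<in>support E. ev E a b W (h u) y)" for E a b W
    using 1(2) by (simp add: wsum_def maps_def edge_hom_def prod_sum_PiE)
  with e show ?case by (intro exI[of _ e]) simp
next
  case (2 e bef)
  then show ?case by simp
next
  case (3 bef u v es)
  \<comment> \<open>Both removal branches at once: \<open>u'\<close> is the end that is a leaf and
    \<open>v'\<close> its neighbour.\<close>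
  have leaf: ?case if IH: "\<And>U h. finite U \<Longrightarrow> \<forall>(u, v)\<in>set ([] @ bef @ es). u \<in> U \<and> v \<in> U \<and> u \<noteq> v \<Longrightarrow>
      \<exists>e. \<forall>E a b W x. sym_edges E \<longrightarrow>
        wsum E U (set ([] @ bef @ es)) (\<lambda>u. ev E a b W (h u)) = ev E a b W e x"
    and uv': "{u', v'} = {u, v}" "untouched u' bef" "untouched u' es" for u' v'
  proof -
    let ?U = "U - {u'}" and ?F = "set (bef @ es)"
    let ?h = "h(v' := Times (h v') (Step (h u')))"
    have F: "\<forall>(a, b)\<in>?F. a \<in> ?U \<and> b \<in> ?U \<and> a \<noteq> b"
    proof (intro ballI, clarify)
      fix a b assume ab: "(a, b) \<in> ?F"
      then have "a \<noteq> u'" "b \<noteq> u'"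
        using uv'(2,3) by (auto simp: untouched_iff image_iff)
      moreover have "a \<in> U \<and> b \<in> U \<and> a \<noteq> b" using "3.prems"(3) ab by auto
      ultimately show "a \<in> ?U \<and> b \<in> ?U \<and> a \<noteq> b" by simp
    qed
    have uv: "u' \<in> U" "v' \<in> ?U" using "3.prems"(3) uv' by (auto simp: doubleton_eq_iff)
    have "finite ?U" using "3.prems"(2) by simp
    from IH[of ?U ?h, unfolded append_Nil, OF this F]
    obtain e where e: "\<forall>E a b W x. sym_edges E \<longrightarrow>
      wsum E ?U ?F (\<lambda>u. ev E a b W (?h u)) = ev E a b W e x" by blast
    have "wsum E U (set (bef @ (u, v) # es)) (\<lambda>u. ev E a b W (h u)) = ev E a b W e x"
      if "sym_edges E" for E a b W x
    proof -
      have "set (bef @ (u, v) # es) = insert (u, v) ?F" by auto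
      then have "edge_hom E (set (bef @ (u, v) # es)) = edge_hom E (insert (v', u') ?F)"
        using uv'(1) edge_hom_flip[OF that, of u v] by (auto simp: doubleton_eq_iff)
      then have "wsum E U (set (bef @ (u, v) # es)) (\<lambda>u. ev E a b W (h u)) =
        wsum E (insert u' ?U) (insert (v', u') ?F) (\<lambda>u. ev E a b W (h u))"
        using uv(1) by (simp add: wsum_def insert_absorb)
      also have "\<dots> = wsum E ?U ?F ((\<lambda>u. ev E a b W (h u))(v' := \<lambda>x. ev E a b W (h v') x *
          (\<Sum>p\<leftarrow>E. of_bool (fst p = x) * ev E a b W (h u') (snd p))))"
        using "3.prems"(2) uv F by (intro wsum_leaf[OF that]) auto
      also have "(\<lambda>u. ev E a b W (h u))(v' := \<lambda>x. ev E a b W (h v') x *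
          (\<Sum>p\<leftarrow>E. of_bool (fst p = x) * ev E a b W (h u') (snd p))) = (\<lambda>u. ev E a b W (?h u))"
        by (auto simp: fun_eq_iff)
      finally show ?thesis using e that by simp
    qed
    then show ?thesis by blast
  qed
  consider "untouched u bef \<and> untouched u es" |
    "\<not> (untouched u bef \<and> untouched u es)" "untouched v bef \<and> untouched v es" |
    "\<not> (untouched u bef \<and> untouched u es)" "\<not> (untouched v bef \<and> untouched v es)" by blast
  then show ?case
  proof cases
    case 1
    then show ?thesis using leaf[of u v] "3.IH"(1) "3.prems"(1) by auto
  next
    case 2
    then show ?thesis using leaf[of v u] "3.IH"(2) "3.prems"(1) by (auto split: if_splits)
  next
    case 4: 3
    have "set (((u, v) # bef) @ es) = set (bef @ (u, v) # es)" by auto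
    with 4 "3.IH"(3)[of U h] "3.prems" show ?thesis by (auto split: if_splits)
  qed
qed

section \<open>Anchor edges\<close>

fun del :: "'l \<Rightarrow> ('l \<times> 'l) list \<Rightarrow> ('l \<times> 'l) list" where
  "del p [] = []"
| "del p ((a, b) # es) = (if p = a then del p es else if p = b then del p es else (a, b) # del p es)"

lemma set_del: "set (del p es) = {(u, v) \<in> set es. u \<noteq> p \<and> v \<noteq> p}"
  by (induction p es rule: del.induct) auto

lemma del_commute: "del p (del q es) = del q (del p es)"
  by (induction p es rule: del.induct) auto

lemma prod_of_bool:
  "finite U \<Longrightarrow> (\<Prod>u\<in>U. of_bool (P u)) = (of_bool (\<forall>u\<in>U. P u) :: nat)"
  by (induction U rule: finite_induct) auto

text \<open>The adjacency matrix maps the indicator of a vertex to that of its neighbourhood; so an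
  edge to a fixed vertex becomes a vertex weight.\<close>

lemma ev_Step_Hot:
  assumes "sym_edges E"
  shows "ev E a b W (Step Hot1) x = of_bool ((x, a) \<in> set E)"
    "ev E a b W (Step Hot2) x = of_bool ((x, b) \<in> set E)"
proof -
  have key: "(\<Sum>y\<in>support E. of_bool ((x, y) \<in> set E) * of_bool (y = c)) = (of_bool ((x, c) \<in> set E) :: nat)" for c
  proof (cases "c \<in> support E")
    case True
    then have "(\<Sum>y\<in>support E. of_bool ((x, y) \<in> set E) * of_bool (y = c)) =
      (\<Sum>y\<in>{c}. of_bool ((x, y) \<in> set E) :: nat)"
      by (intro sum.mono_neutral_cong_right) auto
    then show ?thesis by simp
  next
    case False
    then have "(x, c) \<notin> set E" using assms by (force simp: sym_edges_def)
    with False show ?thesis by auto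
  qed
  show "ev E a b W (Step Hot1) x = of_bool ((x, a) \<in> set E)"
    "ev E a b W (Step Hot2) x = of_bool ((x, b) \<in> set E)"
    using sum_neighbours[OF assms, of x "\<lambda>y. of_bool (y = a)"] key[of a]
      sum_neighbours[OF assms, of x "\<lambda>y. of_bool (y = b)"] key[of b]
    by (simp_all only: ev.simps)
qed

text \<open>Once both ends of an anchor edge are fixed, the edges at them become vertex weights.\<close>

lemma anchor_vexp:
  assumes "forest [] (del q (del p es))" "finite U" "\<forall>(u, v)\<in>set es. u \<in> U \<and> v \<in> U \<and> u \<noteq> v"
    and "p \<in> U" "q \<in> U" "p \<noteq> q"
  shows "\<exists>e. \<forall>E a b W x. sym_edges E \<longrightarrow> (a, b) \<in> set E \<longrightarrow> ev E a b W e x =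
    (\<Sum>\<phi>\<in>maps E U. of_bool (\<phi> p = a \<and> \<phi> q = b) *
      ((\<Prod>u\<in>U. if g u then W (\<phi> u) else 1) * of_bool (edge_hom E (set es) \<phi>)))"
proof -
  define adj where "adj u v \<longleftrightarrow> (u, v) \<in> set es \<or> (v, u) \<in> set es" for u v
  \<comment> \<open>The vertices \<open>p\<close> and \<open>q\<close> stay in \<open>U\<close> as
    isolated vertices whose weights force the images \<open>a\<close> and \<open>b\<close>. Every
    other vertex carries neighbourhood indicators in place of its deleted edges.\<close>
  define k where "k u = (if u = p then Hot1 else if u = q then Hot2 else
    Times (if adj u p then Step Hot1 else One) (if adj u q then Step Hot2 else One))" for u
  define h where "h u = Times (if g u then Inp else One) (k u)" for u
  let ?es = "del q (del p es)"
  have "\<forall>(u, v)\<in>set ([] @ ?es). u \<in> U \<and> v \<in> U \<and> u \<noteq> v"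
    using assms(3) by (auto simp: set_del)
  from forest_vexp[OF assms(1,2) this, of h, unfolded append_Nil]
  obtain e where e: "\<forall>E a b W x. sym_edges E \<longrightarrow>
      wsum E U (set ?es) (\<lambda>u. ev E a b W (h u)) = ev E a b W e x"
    by blast
  have "ev E a b W e x = (\<Sum>\<phi>\<in>maps E U. of_bool (\<phi> p = a \<and> \<phi> q = b) *
      ((\<Prod>u\<in>U. if g u then W (\<phi> u) else 1) * of_bool (edge_hom E (set es) \<phi>)))"
    if E: "sym_edges E" and ab: "(a, b) \<in> set E" for E a b W x
  proof -
    define K where "K u y \<longleftrightarrow> (if u = p then y = a else if u = q then y = b else
      (adj u p \<longrightarrow> (y, a) \<in> set E) \<and> (adj u q \<longrightarrow> (y, b) \<in> set E))" for u y
    have "ev E a b W (k u) y = of_bool (K u y)" for u y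
      by (simp add: k_def K_def ev_Step_Hot[OF E] del: ev.simps(5))
    then have h: "ev E a b W (h u) y = (if g u then W y else 1) * of_bool (K u y)" for u y
      by (simp add: h_def)
    have ba: "(b, a) \<in> set E" "\<And>x y. (x, y) \<in> set E \<Longrightarrow> (y, x) \<in> set E"
      using E ab by (auto simp: sym_edges_def)
    \<comment> \<open>An edge between \<open>p\<close> and \<open>q\<close> holds by
      \<open>(a, b) \<in> set E\<close>, an edge with one end in \<open>{p, q}\<close> by the weight
      of its other end, and the remaining ones survive the deletion.\<close>
    have K: "(\<forall>u\<in>U. K u (\<phi> u)) \<and> edge_hom E (set ?es) \<phi> \<longleftrightarrow>
      (\<phi> p = a \<and> \<phi> q = b) \<and> edge_hom E (set es) \<phi>" for \<phi>
    proof (cases "\<phi> p = a \<and> \<phi> q = b")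
      case True
      have "edge_hom E (set es) \<phi>" if "\<forall>u\<in>U. K u (\<phi> u)" "edge_hom E (set ?es) \<phi>"
        unfolding edge_hom_def
      proof (intro ballI, clarify)
        fix u v assume uv: "(u, v) \<in> set es"
        then have U: "u \<in> U" "v \<in> U" "u \<noteq> v" using assms(3) by auto
        have "K u (\<phi> u)" "K v (\<phi> v)" using that U by auto
        with uv U True ab ba that(2) show "(\<phi> u, \<phi> v) \<in> set E"
          by (auto simp: K_def adj_def edge_hom_def set_del split: if_splits)
      qed
      moreover have "(\<forall>u\<in>U. K u (\<phi> u)) \<and> edge_hom E (set ?es) \<phi>" if "edge_hom E (set es) \<phi>"
      proof
        have "(\<phi> u, \<phi> v) \<in> set E" if "adj u v" for u v
          using that \<open>edge_hom E (set es) \<phi>\<close> E unfolding adj_def edge_hom_def sym_edges_def by blast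
        then show "\<forall>u\<in>U. K u (\<phi> u)" using True by (auto simp: K_def)
        show "edge_hom E (set ?es) \<phi>" using that by (auto simp: edge_hom_def set_del)
      qed
      ultimately show ?thesis using True by blast
    next
      case False
      have "\<not> (K p (\<phi> p) \<and> K q (\<phi> q))" using False assms(6) by (simp add: K_def)
      then show ?thesis using False assms(4,5) by blast
    qed
    have "(\<Prod>u\<in>U. ev E a b W (h u) (\<phi> u)) * of_bool (edge_hom E (set ?es) \<phi>) =
      of_bool (\<phi> p = a \<and> \<phi> q = b) *
      ((\<Prod>u\<in>U. if g u then W (\<phi> u) else 1) * of_bool (edge_hom E (set es) \<phi>))" for \<phi>
    proof -
      have "(\<Prod>u\<in>U. ev E a b W (h u) (\<phi> u)) * of_bool (edge_hom E (set ?es) \<phi>) =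
        (\<Prod>u\<in>U. if g u then W (\<phi> u) else 1) *
        of_bool ((\<forall>u\<in>U. K u (\<phi> u)) \<and> edge_hom E (set ?es) \<phi>)"
        unfolding h prod.distrib prod_of_bool[OF assms(2)] by (simp add: of_bool_conj)
      then show ?thesis unfolding K by (simp add: of_bool_conj mult_ac)
    qed
    then have "wsum E U (set ?es) (\<lambda>u. ev E a b W (h u)) =
      (\<Sum>\<phi>\<in>maps E U. of_bool (\<phi> p = a \<and> \<phi> q = b) *
        ((\<Prod>u\<in>U. if g u then W (\<phi> u) else 1) * of_bool (edge_hom E (set es) \<phi>)))"
      unfolding wsum_def by (intro sum.cong refl)
    with e E show ?thesis by simp
  qed
  then show ?thesis by blast
qed

text \<open>As \<open>pq\<close> is an edge, every homomorphism sends \<open>(p, q)\<close> to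
  exactly one listed pair, so the pairs partition the homomorphisms. The weight \<open>c\<close> is
  constant for a full count and the indicator of a vertex for one entry of a table.\<close>

lemma anchored_total:
  fixes c :: "nat \<Rightarrow> nat"
  assumes E: "sym_edges E" and pq: "(p, q) \<in> set es \<or> (q, p) \<in> set es"
    and e: "\<And>a b x. (a, b) \<in> set E \<Longrightarrow> ev E a b W e x =
      (\<Sum>\<phi>\<in>maps E U. of_bool (\<phi> p = a \<and> \<phi> q = b) * (T \<phi> * of_bool (edge_hom E (set es) \<phi>)))"
  shows "(\<Sum>\<phi>\<in>maps E U. c (\<phi> p) * (T \<phi> * of_bool (edge_hom E (set es) \<phi>))) =
    (\<Sum>r\<leftarrow>E. c (fst r) * ev E (fst r) (snd r) W e (fst r))"
proof -
  let ?T = "\<lambda>\<phi>. T \<phi> * of_bool (edge_hom E (set es) \<phi>)"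
  have "c (\<phi> p) * ?T \<phi> = (\<Sum>r\<in>set E. c (fst r) * (of_bool (\<phi> p = fst r \<and> \<phi> q = snd r) * ?T \<phi>))" for \<phi>
  proof (cases "edge_hom E (set es) \<phi>")
    case True
    then have "(\<phi> p, \<phi> q) \<in> set E" using pq E by (auto simp: edge_hom_def sym_edges_def)
    then have "(\<Sum>r\<in>set E. c (fst r) * (of_bool (\<phi> p = fst r \<and> \<phi> q = snd r) * ?T \<phi>)) =
      (\<Sum>r\<in>{(\<phi> p, \<phi> q)}. c (fst r) * ?T \<phi>)"
      by (intro sum.mono_neutral_cong_right) auto
    then show ?thesis by simp
  qed simp
  then have "(\<Sum>\<phi>\<in>maps E U. c (\<phi> p) * ?T \<phi>) =
    (\<Sum>\<phi>\<in>maps E U. \<Sum>r\<in>set E. c (fst r) * (of_bool (\<phi> p = fst r \<and> \<phi> q = snd r) * ?T \<phi>))"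
    by (intro sum.cong refl)
  also have "\<dots> = (\<Sum>r\<in>set E. c (fst r) * ev E (fst r) (snd r) W e (fst r))"
    by (subst sum.swap, intro sum.cong refl) (simp add: e sum_distrib_left)
  finally show ?thesis by (simp add: sum_edges_conv[OF E])
qed

section \<open>Homomorphism counts of words\<close>

text \<open>Homomorphisms appear as lists of images along the word. This avoids values outside the
  letters, makes renaming harmless, and agrees with \<open>walks\<close> for an empty list of
  inequalities.\<close>

definition hom :: "(nat \<times> nat) list \<Rightarrow> 'l list \<Rightarrow> nat" where
  "hom E w = card {xs. set xs \<subseteq> support E \<and> successively (\<lambda>x y. (x, y) \<in> set E) xs \<and>
     (\<exists>\<phi>. xs = map \<phi> w)}"

lemma hom_map:
  assumes "inj_on f (set w)"
  shows "hom E (map f w) = hom E w"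
proof -
  have "(\<exists>\<phi>. xs = map \<phi> (map f w)) \<longleftrightarrow> (\<exists>\<phi>. xs = map \<phi> w)" for xs :: "nat list"
  proof
    assume "\<exists>\<phi>. xs = map \<phi> w"
    then obtain \<phi> where "xs = map \<phi> w" by blast
    then have "xs = map (\<phi> \<circ> inv_into (set w) f) (map f w)"
      using assms by simp
    then show "\<exists>\<phi>. xs = map \<phi> (map f w)" by blast
  qed auto
  then show ?thesis by (simp only: hom_def)
qed

fun joined :: "'l \<Rightarrow> 'l \<Rightarrow> ('l \<times> 'l) list \<Rightarrow> bool" where
  "joined u v [] = False"
| "joined u v ((a, b) # es) =
     (if u = a then (if v = b then True else joined u v es)
      else if u = b then (if v = a then True else joined u v es) else joined u v es)"

lemma joined_iff: "u \<noteq> v \<Longrightarrow> joined u v es \<longleftrightarrow> (u, v) \<in> set es \<or> (v, u) \<in> set es"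
  by (induction u v es rule: joined.induct) auto

text \<open>Each edge is listed once and in one orientation; a second copy, even a reversed one,
  would look like a cycle to \<open>forest\<close>.\<close>

fun edges_of :: "'l list \<Rightarrow> ('l \<times> 'l) list" where
  "edges_of [] = []"
| "edges_of [x] = []"
| "edges_of (x # y # w) =
     (if joined x y (edges_of (y # w)) then edges_of (y # w) else (x, y) # edges_of (y # w))"

lemma edges_of_letters:
  "successively (\<noteq>) w \<Longrightarrow> \<forall>(u, v)\<in>set (edges_of w). u \<in> set w \<and> v \<in> set w \<and> u \<noteq> v"
  by (induction w rule: edges_of.induct) auto

lemma edge_hom_edges_of:
  "sym_edges E \<Longrightarrow> successively (\<noteq>) w \<Longrightarrow>
   edge_hom E (set (edges_of w)) \<phi> \<longleftrightarrow> successively (\<lambda>x y. (\<phi> x, \<phi> y) \<in> set E) w"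
proof (induction w rule: edges_of.induct)
  case (3 x y w)
  have "edge_hom E (set (edges_of (x # y # w))) \<phi> \<longleftrightarrow>
    (\<phi> x, \<phi> y) \<in> set E \<and> edge_hom E (set (edges_of (y # w))) \<phi>"
    using "3.prems" joined_iff[of x y "edges_of (y # w)"]
    by (auto simp: edge_hom_def sym_edges_def)
  with 3 show ?case by simp
qed (auto simp: edge_hom_def)

lemma hom_conv_maps:
  assumes "sym_edges E" "successively (\<noteq>) w"
  shows "hom E w = (\<Sum>\<phi>\<in>maps E (set w). of_bool (edge_hom E (set (edges_of w)) \<phi>))"
proof -
  let ?A = "{\<phi> \<in> maps E (set w). edge_hom E (set (edges_of w)) \<phi>}"
  let ?B = "{xs. set xs \<subseteq> support E \<and> successively (\<lambda>x y. (x, y) \<in> set E) xs \<and> (\<exists>\<phi>. xs = map \<phi> w)}"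
  have "bij_betw (\<lambda>\<phi>. map \<phi> w) ?A ?B"
    unfolding bij_betw_def
  proof
    show "inj_on (\<lambda>\<phi>. map \<phi> w) ?A"
      by (auto simp: inj_on_def maps_def intro: PiE_ext)
    show "(\<lambda>\<phi>. map \<phi> w) ` ?A = ?B"
    proof (intro equalityI subsetI)
      fix xs assume "xs \<in> ?B"
      then obtain \<phi> where \<phi>: "xs = map \<phi> w" "set xs \<subseteq> support E"
        "successively (\<lambda>x y. (x, y) \<in> set E) xs" by blast
      let ?\<phi> = "restrict \<phi> (set w)"
      have xs: "xs = map ?\<phi> w" using \<phi>(1) by simp
      with \<phi>(3) have "edge_hom E (set (edges_of w)) ?\<phi>"
        unfolding edge_hom_edges_of[OF assms] by (simp only: successively_map)
      moreover have "?\<phi> \<in> maps E (set w)" using \<phi>(1,2) by (auto simp: maps_def)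
      ultimately show "xs \<in> (\<lambda>\<phi>. map \<phi> w) ` ?A" using xs by blast
    qed (auto simp: edge_hom_edges_of[OF assms] successively_map maps_mem)
  qed
  then have "hom E w = card ?A" by (simp add: hom_def bij_betw_same_card)
  also have "\<dots> = (\<Sum>\<phi>\<in>maps E (set w). of_bool (edge_hom E (set (edges_of w)) \<phi>))"
    by (simp add: finite_maps Int_def)
  finally show ?thesis .
qed

definition computable :: "'l list \<Rightarrow> bool" where
  "computable w \<longleftrightarrow> (\<exists>e e'. \<forall>E. sym_edges E \<longrightarrow> input_free E e \<and> hom E w = anchored_sum E (e, e'))"

lemma computable_map: "inj_on f (set w) \<Longrightarrow> computable (map f w) \<longleftrightarrow> computable w"
  by (simp add: computable_def hom_map)

lemma computable_anchor:
  assumes "successively (\<noteq>) w" "(p, q) \<in> set (edges_of w)"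
    and "forest [] (del q (del p (edges_of w)))"
  shows "computable w"
proof -
  note letters = edges_of_letters[OF assms(1)]
  have pq: "p \<in> set w" "q \<in> set w" "p \<noteq> q" using letters assms(2) by auto
  from anchor_vexp[OF assms(3) finite_set letters pq, of "\<lambda>_. False"]
  obtain e where e: "\<forall>E a b W x. sym_edges E \<longrightarrow> (a, b) \<in> set E \<longrightarrow> ev E a b W e x =
    (\<Sum>\<phi>\<in>maps E (set w). of_bool (\<phi> p = a \<and> \<phi> q = b) *
      (1 * of_bool (edge_hom E (set (edges_of w)) \<phi>)))"
    by auto
  have "input_free E One \<and> hom E w = anchored_sum E (One, e)" if E: "sym_edges E" for E
    using anchored_total[OF E, where p = p and q = q and es = "edges_of w" and e = e and U = "set w"
        and T = "\<lambda>_. 1" and c = "\<lambda>_. 1" and W = "rooted_sum E One"] e E assms(1,2)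
    by (simp add: input_free_def anchored_sum_def hom_conv_maps)
  then show ?thesis unfolding computable_def by blast
qed

lemma edge_hom_cong: "(\<And>u v. (u, v) \<in> F \<Longrightarrow> \<phi> u = \<psi> u \<and> \<phi> v = \<psi> v) \<Longrightarrow> edge_hom E F \<phi> = edge_hom E F \<psi>"
  unfolding edge_hom_def by (intro ball_cong refl) (auto split: prod.splits)

text \<open>The graphs of \<open>u @ [r]\<close> and \<open>r # v\<close> share only the vertex
  \<open>r\<close>, which may recur in both. For a fixed image \<open>z\<close> of \<open>r\<close>
  their homomorphisms are independent, so the count of the second part rooted at \<open>z\<close> is
  a vertex weight at \<open>r\<close> in the first. The second anchor contains \<open>r\<close>
  because the table is indexed by an end of the anchor edge.\<close>

lemma computable_split:
  assumes w: "successively (\<noteq>) (u @ r # v)" and cut: "set u \<inter> set v \<subseteq> {r}"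
    and 1: "(p, q) \<in> set (edges_of (u @ [r]))" "forest [] (del q (del p (edges_of (u @ [r]))))"
    and 2: "(r, s) \<in> set (edges_of (r # v)) \<or> (s, r) \<in> set (edges_of (r # v))"
      "forest [] (del s (del r (edges_of (r # v))))"
  shows "computable (u @ r # v)"
proof -
  let ?x = "u @ [r]" and ?y = "r # v"
  define U V where "U = set ?x" and "V = set ?y"
  have wx: "successively (\<noteq>) ?x" and wy: "successively (\<noteq>) ?y"
    using w by (auto simp: successively_append_iff)
  note lx = edges_of_letters[OF wx, folded U_def] and ly = edges_of_letters[OF wy, folded V_def]
  have pq: "p \<in> U" "q \<in> U" "p \<noteq> q" using lx 1 by auto
  have rs: "r \<in> V" "s \<in> V" "r \<noteq> s" using ly 2 by auto
  have fin: "finite U" "finite V" by (auto simp: U_def V_def)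
  from anchor_vexp[OF 2(2) fin(2) ly rs, of "\<lambda>_. False"]
  obtain e where e: "\<forall>E a b W x. sym_edges E \<longrightarrow> (a, b) \<in> set E \<longrightarrow> ev E a b W e x =
    (\<Sum>\<phi>\<in>maps E V. of_bool (\<phi> r = a \<and> \<phi> s = b) * (1 * of_bool (edge_hom E (set (edges_of ?y)) \<phi>)))"
    by auto
  from anchor_vexp[OF 1(2) fin(1) lx pq, of "\<lambda>u. u = r"]
  obtain e' where e': "\<forall>E a b W x. sym_edges E \<longrightarrow> (a, b) \<in> set E \<longrightarrow> ev E a b W e' x =
    (\<Sum>\<phi>\<in>maps E U. of_bool (\<phi> p = a \<and> \<phi> q = b) *
      ((\<Prod>u\<in>U. if u = r then W (\<phi> u) else 1) * of_bool (edge_hom E (set (edges_of ?x)) \<phi>)))"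
    by auto
  have "r \<in> U" by (simp add: U_def)
  have "input_free E e \<and> hom E (u @ r # v) = anchored_sum E (e, e')" if E: "sym_edges E" for E
  proof
    show "input_free E e" unfolding input_free_def using e E by auto
    let ?T = "\<lambda>\<phi>. of_bool (edge_hom E (set (edges_of ?y)) \<phi>) :: nat"
    let ?S = "\<lambda>\<phi>. of_bool (edge_hom E (set (edges_of ?x)) \<phi>) :: nat"
    define W where "W = rooted_sum E e"
    have W: "W z = (\<Sum>\<phi>\<in>maps E V. of_bool (\<phi> r = z) * ?T \<phi>)" for z
      using anchored_total[OF E 2(1), where e = e and U = V and T = "\<lambda>_. 1"
          and c = "\<lambda>y. of_bool (y = z)" and W = "\<lambda>_. 0"] e E
      by (simp add: W_def rooted_sum_def)
    let ?B = "V - {r}"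
    have UV: "set (u @ r # v) = U \<union> ?B" "U \<inter> ?B = {}" "insert r ?B = V" "r \<notin> ?B"
      using cut by (auto simp: U_def V_def)
    have W': "W z = (\<Sum>\<psi>\<in>maps E ?B. ?T (\<psi>(r := z)))" if z: "z \<in> support E" for z
    proof -
      have "W z = (\<Sum>\<psi>\<in>maps E ?B. \<Sum>x\<in>support E. of_bool (x = z) * ?T (\<psi>(r := x)))"
        using sum_maps_insert[OF UV(4), of "\<lambda>\<phi>. of_bool (\<phi> r = z) * ?T \<phi>" E]
        unfolding W UV(3) by simp
      moreover have "(\<Sum>x\<in>support E. of_bool (x = z) * ?T (\<psi>(r := x))) = ?T (\<psi>(r := z))" for \<psi>
        using z sum.mono_neutral_cong_right[of "support E" "{z}"
            "\<lambda>x. of_bool (x = z) * ?T (\<psi>(r := x))" "\<lambda>x. ?T (\<psi>(r := x))"] by auto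
      ultimately show ?thesis by (simp only:)
    qed
    have "hom E (u @ r # v) = (\<Sum>\<phi>\<in>maps E (U \<union> ?B).
        of_bool (edge_hom E (set (edges_of (u @ r # v))) \<phi>))"
      using hom_conv_maps[OF E w] UV(1) by simp
    also have "\<dots> = (\<Sum>\<phi>\<in>maps E (U \<union> ?B). ?S \<phi> * ?T \<phi>)"
    proof (intro sum.cong refl)
      fix \<phi>
      have "edge_hom E (set (edges_of (u @ r # v))) \<phi> \<longleftrightarrow>
        edge_hom E (set (edges_of ?x)) \<phi> \<and> edge_hom E (set (edges_of ?y)) \<phi>"
        unfolding edge_hom_edges_of[OF E w] edge_hom_edges_of[OF E wx] edge_hom_edges_of[OF E wy]
        by (auto simp: successively_append_iff)
      then show "of_bool (edge_hom E (set (edges_of (u @ r # v))) \<phi>) = ?S \<phi> * ?T \<phi>"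
        by simp
    qed
    also have "\<dots> = (\<Sum>\<phi>\<in>maps E U. \<Sum>\<psi>\<in>maps E ?B.
        ?S (\<lambda>x. if x \<in> ?B then \<psi> x else \<phi> x) * ?T (\<lambda>x. if x \<in> ?B then \<psi> x else \<phi> x))"
      using fin UV by (intro sum_maps_Un) auto
    also have "\<dots> = (\<Sum>\<phi>\<in>maps E U. \<Sum>\<psi>\<in>maps E ?B. ?S \<phi> * ?T (\<psi>(r := \<phi> r)))"
    \<comment> \<open>Edges of the first part avoid \<open>V - {r}\<close>, and those of the second
      see \<open>\<phi>\<close> only at \<open>r\<close>.\<close>
    proof (intro sum.cong refl arg_cong2[where f = "(*)"] arg_cong[where f = of_bool] edge_hom_cong)
      fix \<phi> \<psi> :: "'a \<Rightarrow> nat" and a b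
      show "(if a \<in> ?B then \<psi> a else \<phi> a) = \<phi> a \<and> (if b \<in> ?B then \<psi> b else \<phi> b) = \<phi> b"
        if "(a, b) \<in> set (edges_of ?x)"
        using lx that UV(2) by auto
      show "(if a \<in> ?B then \<psi> a else \<phi> a) = (\<psi>(r := \<phi> r)) a \<and>
        (if b \<in> ?B then \<psi> b else \<phi> b) = (\<psi>(r := \<phi> r)) b"
        if "(a, b) \<in> set (edges_of ?y)"
        using ly that by auto
    qed
    also have "\<dots> = (\<Sum>\<phi>\<in>maps E U. 1 * (W (\<phi> r) * ?S \<phi>))"
      using W' maps_mem[OF _ \<open>r \<in> U\<close>] by (intro sum.cong) (simp_all add: sum_distrib_left mult.commute)
    also have "\<dots> = (\<Sum>\<phi>\<in>maps E U. 1 * ((\<Prod>u\<in>U. if u = r then W (\<phi> u) else 1) * ?S \<phi>))"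
      using fin(1) \<open>r \<in> U\<close> by simp
    also have "\<dots> = (\<Sum>t\<leftarrow>E. 1 * ev E (fst t) (snd t) W e' (fst t))"
      using 1(1) e' E by (intro anchored_total[OF E]) auto
    finally show "hom E (u @ r # v) = anchored_sum E (e, e')"
      by (simp add: anchored_sum_def W_def)
  qed
  then show ?thesis unfolding computable_def by blast
qed

section \<open>Exhaustive verification for short words\<close>

section \<open>All words with at most ten letters\<close>

fun has_anchor :: "('l \<times> 'l) list \<Rightarrow> ('l \<times> 'l) list \<Rightarrow> bool" where
  "has_anchor [] es = False"
| "has_anchor ((p, q) # fs) es = (if forest [] (del q (del p es)) then True else has_anchor fs es)"

fun has_anchor_at :: "'l \<Rightarrow> ('l \<times> 'l) list \<Rightarrow> ('l \<times> 'l) list \<Rightarrow> bool" where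
  "has_anchor_at r [] es = False"
| "has_anchor_at r ((p, q) # fs) es =
     (if (p = r \<or> q = r) \<and> forest [] (del q (del p es)) then True else has_anchor_at r fs es)"

text \<open>The candidate \<open>r\<close> runs through the positions of the word. Only the part to
  its right has its anchor at \<open>r\<close>; the part to its left may be anchored anywhere, since
  \<open>r\<close> enters there merely with a weight.\<close>

fun has_split :: "'l list \<Rightarrow> 'l list \<Rightarrow> bool" where
  "has_split u [] = False"
| "has_split u (r # v) =
     (if (\<forall>x\<in>set u. x = r \<or> x \<notin> set v) \<and>
         has_anchor (edges_of (u @ [r])) (edges_of (u @ [r])) \<and>
         has_anchor_at r (edges_of (r # v)) (edges_of (r # v))
      then True else has_split (u @ [r]) v)"

text \<open>
  Words are enumerated up to renaming: each letter prepended to \<open>x # w\<close> is either one of the used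
  letters \<open>us\<close> or the first of the fresh letters.
\<close>

fun check :: "'l list \<Rightarrow> 'l list \<Rightarrow> 'l \<Rightarrow> 'l list \<Rightarrow> ('l \<times> 'l) list \<Rightarrow> nat \<Rightarrow> bool"
  and checks :: "'l list \<Rightarrow> 'l list \<Rightarrow> 'l list \<Rightarrow> 'l \<Rightarrow> 'l list \<Rightarrow> ('l \<times> 'l) list \<Rightarrow> nat \<Rightarrow> bool" where
  "check us fr x w es 0 = True"
| "check us fr x w es (Suc n) =
     (if (if has_anchor es es then True else has_split [] (x # w))
      then (case fr of [] \<Rightarrow> True | m # fr' \<Rightarrow>
        if check (m # us) fr' m (x # w) ((m, x) # es) n then checks us us fr x w es n else False)
      else False)"
| "checks us [] fr x w es n = True"
| "checks us (y # ys) fr x w es n =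
     (if (if x = y then True
          else if joined y x es then check us fr y (x # w) es n
          else check us fr y (x # w) ((y, x) # es) n)
      then checks us ys fr x w es n else False)"

lemma has_anchor_iff:
  "has_anchor fs es \<longleftrightarrow> (\<exists>(p, q)\<in>set fs. forest [] (del q (del p es)))"
  by (induction fs es rule: has_anchor.induct) auto

lemma has_anchor_at_iff:
  "has_anchor_at r fs es \<longleftrightarrow> (\<exists>(p, q)\<in>set fs. (p = r \<or> q = r) \<and> forest [] (del q (del p es)))"
  by (induction r fs es rule: has_anchor_at.induct) auto

lemma computable_has_split:
  "has_split u w \<Longrightarrow> successively (\<noteq>) (u @ w) \<Longrightarrow> computable (u @ w)"
proof (induction u w rule: has_split.induct)
  case (2 u r v)
  show ?case
  proof (cases "(\<forall>x\<in>set u. x = r \<or> x \<notin> set v) \<and>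
         has_anchor (edges_of (u @ [r])) (edges_of (u @ [r])) \<and>
         has_anchor_at r (edges_of (r # v)) (edges_of (r # v))")
    case True
    then obtain p q p' q' where *: "(p, q) \<in> set (edges_of (u @ [r]))"
      "forest [] (del q (del p (edges_of (u @ [r]))))"
      "(p', q') \<in> set (edges_of (r # v))" "p' = r \<or> q' = r"
      "forest [] (del q' (del p' (edges_of (r # v))))"
      unfolding has_anchor_iff has_anchor_at_iff by blast
    have cut: "set u \<inter> set v \<subseteq> {r}" using True by auto
    from *(4) show ?thesis
    proof
      assume "p' = r"
      with * show ?thesis by (intro computable_split[OF "2.prems"(2) cut *(1,2), of q']) auto
    next
      assume "q' = r"
      with * show ?thesis
        by (intro computable_split[OF "2.prems"(2) cut *(1,2), of p']) (auto simp: del_commute)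
    qed
  next
    case False
    with 2 show ?thesis by (auto split: if_splits)
  qed
qed simp

lemma check_good:
  assumes "check us fr x w (edges_of (x # w)) (Suc n)" "successively (\<noteq>) (x # w)"
  shows "computable (x # w)"
proof (cases "has_anchor (edges_of (x # w)) (edges_of (x # w))")
  case True
  then show ?thesis using computable_anchor[OF assms(2)] by (auto simp: has_anchor_iff)
next
  case False
  then show ?thesis using computable_has_split[of "[]" "x # w"] assms by (auto split: if_splits)
qed

lemma checksD:
  "checks us ys fr x w (edges_of (x # w)) n \<Longrightarrow> y \<in> set ys \<Longrightarrow> x \<noteq> y \<Longrightarrow>
   check us fr y (x # w) (edges_of (y # x # w)) n"
  by (induction ys) (auto split: if_splits)

text \<open>Words are read from the end: \<open>x # w\<close>, renamed by \<open>f\<close>, is the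
  suffix already matched and \<open>u\<close> the unread prefix, whose last letter is either an
  image of a used letter or becomes the image of the next fresh one. The bound on \<open>n\<close>
  by \<open>length fr\<close> provides a fresh letter as long as \<open>u\<close> is nonempty, and
  \<open>length u < n\<close> makes the search deep enough.\<close>

lemma check_sound:
  assumes "check us fr x w (edges_of (x # w)) n" "set (x # w) \<subseteq> set us" "distinct (us @ fr)"
    and "n \<le> length fr + 1" "inj_on f (set us)" "successively (\<noteq>) (u @ map f (x # w))" "length u < n"
  shows "computable (u @ map f (x # w))"
  using assms
proof (induction n arbitrary: us fr x w f u)
  case (Suc n)
  show ?case
  proof (cases u rule: rev_cases)
    case Nil
    have "successively (\<noteq>) (x # w)"
      using Suc.prems(6) unfolding Nil append_Nil successively_map by (rule successively_mono) auto
    then have "computable (x # w)" by (rule check_good[OF Suc.prems(1)])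
    moreover have "inj_on f (set (x # w))" using Suc.prems(2,5) inj_on_subset by blast
    ultimately show ?thesis using computable_map Nil by fastforce
  next
    case (snoc u' z)
    have z: "z \<noteq> f x" using Suc.prems(6) snoc by (auto simp: successively_append_iff)
    have "1 \<le> n" "length u' < n" using Suc.prems(7) snoc by auto
    with Suc.prems(4) obtain m fr' where fr: "fr = m # fr'" by (cases fr) auto
    show ?thesis
    proof (cases "z \<in> f ` set us")
      case True
      then obtain y where y: "y \<in> set us" "z = f y" by blast
      have "checks us us fr x w (edges_of (x # w)) n"
        using Suc.prems(1) fr by (auto split: if_splits)
      with y z have "check us fr y (x # w) (edges_of (y # x # w)) n" by (intro checksD) auto
      then have "computable (u' @ map f (y # x # w))"
        using Suc.prems y snoc \<open>length u' < n\<close> by (intro Suc.IH[of us fr]) auto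
      then show ?thesis using snoc y by simp
    next
      case False
      have m: "m \<notin> set us" using Suc.prems(3) fr by auto
      have "successively (\<lambda>x y. f x \<noteq> f y) (x # w)"
        using Suc.prems(6) unfolding successively_append_iff successively_map by blast
      then have "successively (\<noteq>) (x # w)" by (rule successively_mono) auto
      then have "(m, x) \<notin> set (edges_of (x # w))" "(x, m) \<notin> set (edges_of (x # w))"
        using m edges_of_letters[of "x # w"] Suc.prems(2) by auto
      moreover have "m \<noteq> x" using m Suc.prems(2) by auto
      ultimately have "\<not> joined m x (edges_of (x # w))" by (simp add: joined_iff)
      then have e: "edges_of (m # x # w) = (m, x) # edges_of (x # w)" by simp
      have ck: "check (m # us) fr' m (x # w) (edges_of (m # x # w)) n"
        using Suc.prems(1) fr unfolding e by (auto split: if_splits)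
      have *: "map (f(m := z)) (m # x # w) = z # map f (x # w)"
        using m Suc.prems(2) by auto
      have inj: "inj_on (f(m := z)) (set (m # us))"
        using Suc.prems(5) m False by (auto simp: inj_on_def)
      have "computable (u' @ map (f(m := z)) (m # x # w))"
      proof (rule Suc.IH[OF ck _ _ _ inj])
        show "successively (\<noteq>) (u' @ map (f(m := z)) (m # x # w))"
          unfolding * using Suc.prems(6) snoc by simp
      qed (use Suc.prems(2-4) fr \<open>length u' < n\<close> in auto)
      then show ?thesis unfolding * using snoc by simp
    qed
  qed
qed simp

text \<open>Up to renaming, the four-letter words without equal neighbours are 1010, 2010, 0210,
  1210 and 3210; each subtree is evaluated on its own. Depth 7 allows six further letters. In all,
  the number of ten-letter words is the Bell number 21147.\<close>

lemma check_ten_01: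
  "check [1, 0] [2, 3, 4, 5, 6, 7, 8, 9] (1 :: nat) [0, 1, 0] [(1, 0)] 7"
  by code_simp

lemma check_ten_02:
  "check [2, 1, 0] [3, 4, 5, 6, 7, 8, 9] (2 :: nat) [0, 1, 0] [(2, 0), (1, 0)] 7"
  by code_simp

lemma check_ten_20:
  "check [2, 1, 0] [3, 4, 5, 6, 7, 8, 9] (0 :: nat) [2, 1, 0] [(0, 2), (2, 1), (1, 0)] 7"
  by code_simp

lemma check_ten_21:
  "check [2, 1, 0] [3, 4, 5, 6, 7, 8, 9] (1 :: nat) [2, 1, 0] [(2, 1), (1, 0)] 7"
  by code_simp

lemma check_ten_23:
  "check [3, 2, 1, 0] [4, 5, 6, 7, 8, 9] (3 :: nat) [2, 1, 0] [(3, 2), (2, 1), (1, 0)] 7"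
  by code_simp

text \<open>The word 10 and depth 9 cover eight further letters. Exposing two successors unfolds two
  levels, down to the five words above.\<close>

lemma check_ten: "check [1, 0] [2, 3, 4, 5, 6, 7, 8, 9] (1 :: nat) [0] [(1, 0)] (Suc (Suc 7))"
  by (simp add: check_ten_01 check_ten_02 check_ten_20 check_ten_21 check_ten_23
      del: One_nat_def Suc_numeral)

text \<open>The last two letters differ, so they can be renamed to 1 and 0, the root of the search.
  The bound of ten letters comes from the depth of that search.\<close>

lemma computable_short:
  assumes "successively (\<noteq>) v" "2 \<le> length v" "length v \<le> 10"
  shows "computable v"
proof -
  define u where "u = take (length v - 2) v"
  have "length (drop (length v - 2) v) = 2" using assms(2) by simp
  moreover have "\<exists>b a. ys = [b, a]" if "length ys = 2" for ys :: "'a list"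
    using that by (auto simp: numeral_2_eq_2 length_Suc_conv)
  ultimately obtain b a where ba: "drop (length v - 2) v = [b, a]" by blast
  then have v: "v = u @ [b, a]" using append_take_drop_id[of "length v - 2" v] by (simp add: u_def)
  let ?f = "\<lambda>i :: nat. if i = 0 then a else b"
  have "a \<noteq> b" using assms(1) v by (auto simp: successively_append_iff)
  then have "computable (u @ map ?f (1 # [0]))"
    using check_ten assms v
    by (intro check_sound[of "[1, 0]" "[2, 3, 4, 5, 6, 7, 8, 9]" 1 "[0]" "Suc (Suc 7)"]) (auto simp: inj_on_def)
  then show ?thesis using v by simp
qed

section \<open>Inclusion-exclusion from homomorphisms to injective walks\<close>

section \<open>Injective homomorphisms\<close>

text \<open>The word imposes equalities between positions, by repeated letters, and \<open>N\<close>
  imposes inequalities.\<close>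

definition walks :: "(nat \<times> nat) list \<Rightarrow> 'l list \<Rightarrow> (nat \<times> nat) list \<Rightarrow> nat list set" where
  "walks E w N = {xs. set xs \<subseteq> support E \<and> successively (\<lambda>x y. (x, y) \<in> set E) xs \<and>
     (\<exists>\<phi>. xs = map \<phi> w) \<and> (\<forall>(i, j)\<in>set N. xs ! i \<noteq> xs ! j)}"

lemma finite_walks: "finite (walks E w N)"
proof (rule finite_subset)
  show "walks E w N \<subseteq> {xs. set xs \<subseteq> support E \<and> length xs = length w}"
    by (auto simp: walks_def)
qed (simp add: finite_lists_length_eq)

text \<open>A walk counted without the constraint either satisfies it or has equal vertices at
  \<open>i\<close> and \<open>j\<close>; the latter are the walks of the word with the two letters
  identified.\<close>

lemma walks_Cons:
  assumes "i < length w" "j < length w"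
  defines "w' \<equiv> map (\<lambda>l. if l = w ! i then w ! j else l) w"
  shows "card (walks E w ((i, j) # N)) + card (walks E w' N) = card (walks E w N)"
proof -
  have merge: "(\<exists>\<phi>. xs = map \<phi> w') \<longleftrightarrow> (\<exists>\<phi>. xs = map \<phi> w) \<and> xs ! i = xs ! j" for xs :: "nat list"
  proof
    assume "\<exists>\<phi>. xs = map \<phi> w'"
    then obtain \<phi> where "xs = map \<phi> w'" by blast
    then have "xs = map (\<lambda>l. \<phi> (if l = w ! i then w ! j else l)) w" "xs ! i = xs ! j"
      using assms by (auto simp: w'_def)
    then show "(\<exists>\<phi>. xs = map \<phi> w) \<and> xs ! i = xs ! j" by blast
  next
    assume "(\<exists>\<phi>. xs = map \<phi> w) \<and> xs ! i = xs ! j"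
    then obtain \<phi> where "xs = map \<phi> w" "xs ! i = xs ! j" by blast
    then have "xs = map \<phi> w'" using assms by (auto simp: w'_def)
    then show "\<exists>\<phi>. xs = map \<phi> w'" by blast
  qed
  have "walks E w N = walks E w ((i, j) # N) \<union> walks E w' N"
    unfolding walks_def merge by auto
  moreover have "walks E w ((i, j) # N) \<inter> walks E w' N = {}"
    unfolding walks_def merge by auto
  ultimately show ?thesis by (simp add: card_Un_disjoint finite_walks)
qed

text \<open>The contracted word enters with a minus sign, so its two lists change sides. A word with
  equal neighbours has no walks, as \<open>E\<close> has no loops, and contributes empty
  lists.\<close>

lemma walks_hom_expansion:
  fixes w :: "nat list"
  assumes "length w = k" "\<forall>(i, j)\<in>set N. i < k \<and> j < k"
  shows "\<exists>pos neg :: nat list list.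
    (\<forall>v\<in>set pos \<union> set neg. length v = k \<and> successively (\<noteq>) v) \<and>
    (\<forall>E. sym_edges E \<longrightarrow>
      card (walks E w N) + (\<Sum>v\<leftarrow>neg. hom E v) = (\<Sum>v\<leftarrow>pos. hom E v))"
  using assms
proof (induction N arbitrary: w)
  case Nil
  show ?case
  proof (cases "successively (\<noteq>) w")
    case True
    with Nil show ?thesis
      by (intro exI[of _ "[w]"] exI[of _ "[]"]) (simp add: walks_def hom_def)
  next
    case False
    have "walks E w [] = {}" if "sym_edges E" for E
    proof -
      have "successively (\<noteq>) w" if "successively (\<lambda>x y. (\<phi> x, \<phi> y) \<in> set E) w" for \<phi>
        using that \<open>sym_edges E\<close> by (elim successively_mono) (auto simp: sym_edges_def)
      then show ?thesis using False by (auto simp: walks_def successively_map)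
    qed
    then show ?thesis by (intro exI[of _ "[]"]) simp
  qed
next
  case (Cons ij N)
  obtain i j where ij: "ij = (i, j)" "i < k" "j < k" using Cons.prems(2) by (cases ij) auto
  define w' where "w' = map (\<lambda>l. if l = w ! i then w ! j else l) w"
  have N: "\<forall>(i, j)\<in>set N. i < k \<and> j < k" using Cons.prems by auto
  obtain pos neg :: "nat list list" where 1: "\<forall>v\<in>set pos \<union> set neg. length v = k \<and> successively (\<noteq>) v"
    "\<forall>E. sym_edges E \<longrightarrow> card (walks E w N) + (\<Sum>v\<leftarrow>neg. hom E v) = (\<Sum>v\<leftarrow>pos. hom E v)"
    using Cons.IH[OF Cons.prems(1) N] by blast
  have "length w' = k" using Cons.prems(1) by (simp add: w'_def)
  from Cons.IH[OF this N] obtain pos' neg' :: "nat list list" where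
    2: "\<forall>v\<in>set pos' \<union> set neg'. length v = k \<and> successively (\<noteq>) v"
    "\<forall>E. sym_edges E \<longrightarrow> card (walks E w' N) + (\<Sum>v\<leftarrow>neg'. hom E v) = (\<Sum>v\<leftarrow>pos'. hom E v)"
    by blast
  have 3: "card (walks E w (ij # N)) + card (walks E w' N) = card (walks E w N)" for E
    using walks_Cons[of i w j E N] ij Cons.prems(1) by (simp add: w'_def)
  have "card (walks E w (ij # N)) + (\<Sum>v\<leftarrow>neg @ pos'. hom E v) = (\<Sum>v\<leftarrow>pos @ neg'. hom E v)"
    if E: "sym_edges E" for E
    using 1(2)[rule_format, OF E] 2(2)[rule_format, OF E] 3[of E] by simp
  with 1(1) 2(1) show ?case by (intro exI[of _ "pos @ neg'"] exI[of _ "neg @ pos'"]) auto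
qed

definition inj_walks :: "(nat \<times> nat) list \<Rightarrow> nat \<Rightarrow> nat list set" where
  "inj_walks E k = {xs. length xs = k \<and> distinct xs \<and> set xs \<subseteq> support E \<and>
     successively (\<lambda>x y. (x, y) \<in> set E) xs}"

lemma inj_walks_expansion:
  assumes "2 \<le> k" "k \<le> 10"
  shows "\<exists>pos neg :: (vexp \<times> vexp) list. \<forall>E. sym_edges E \<longrightarrow>
    (\<forall>t\<in>set pos \<union> set neg. input_free E (fst t)) \<and>
    card (inj_walks E k) + (\<Sum>t\<leftarrow>neg. anchored_sum E t) = (\<Sum>t\<leftarrow>pos. anchored_sum E t)"
proof -
  define N where "N = filter (\<lambda>(i, j). i \<noteq> j) (List.product [0..<k] [0..<k])"
  have N: "set N = {(i, j). i < k \<and> j < k \<and> i \<noteq> j}" by (auto simp: N_def)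
  have "(\<exists>\<phi>. xs = map \<phi> [0..<k]) \<longleftrightarrow> length xs = k" for xs :: "nat list"
    by (metis length_map length_upt map_nth minus_nat.diff_0)
  then have eq: "walks E [0..<k] N = inj_walks E k" for E
    unfolding walks_def inj_walks_def N by (auto simp: distinct_conv_nth)
  obtain ps ns :: "nat list list" where w:
    "\<forall>v\<in>set ps \<union> set ns. length v = k \<and> successively (\<noteq>) v"
    "\<forall>E. sym_edges E \<longrightarrow> card (inj_walks E k) + (\<Sum>v\<leftarrow>ns. hom E v) = (\<Sum>v\<leftarrow>ps. hom E v)"
    using walks_hom_expansion[of "[0..<k]" k N] N eq by auto
  have "\<forall>v\<in>set ps \<union> set ns. \<exists>t. \<forall>E. sym_edges E \<longrightarrow> input_free E (fst t) \<and> hom E v = anchored_sum E t"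
    using w(1) computable_short assms unfolding computable_def by fastforce
  then obtain t where t: "\<forall>v\<in>set ps \<union> set ns. \<forall>E. sym_edges E \<longrightarrow>
      input_free E (fst (t v)) \<and> hom E v = anchored_sum E (t v)"
    by metis
  have "(\<Sum>t\<leftarrow>map t vs. anchored_sum E t) = (\<Sum>v\<leftarrow>vs. hom E v)"
    if "sym_edges E" "set vs \<subseteq> set ps \<union> set ns" for E vs
    using that t by (auto simp: comp_def intro!: arg_cong[where f = sum_list] map_cong)
  with w t show ?thesis by (intro exI[of _ "map t ps"] exI[of _ "map t ns"]) auto
qed

section \<open>Paths as subgraphs and their two traversals\<close>

section \<open>Path subgraphs\<close>

fun path_edges :: "'a list \<Rightarrow> 'a set set" where
  "path_edges (x # y # xs) = insert {x, y} (path_edges (y # xs))"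
| "path_edges _ = {}"

lemma path_edges_subset: "e \<in> path_edges xs \<Longrightarrow> e \<subseteq> set xs"
  by (induction xs rule: path_edges.induct) auto

lemma path_edges_conv: "path_edges xs = {{xs ! i, xs ! Suc i} |i. Suc i < length xs}"
proof (induction xs rule: path_edges.induct)
  case (1 x y xs)
  have "{{(x # y # xs) ! i, (x # y # xs) ! Suc i} |i. Suc i < length (x # y # xs)} =
    insert {x, y} {{(y # xs) ! i, (y # xs) ! Suc i} |i. Suc i < length (y # xs)}" (is "?A = ?B")
  proof (intro equalityI subsetI)
    fix e assume "e \<in> ?A"
    then obtain i where "e = {(x # y # xs) ! i, (x # y # xs) ! Suc i}" "Suc i < length (x # y # xs)"
      by blast
    then show "e \<in> ?B" by (cases i) auto
  next
    fix e assume "e \<in> ?B"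
    then consider "e = {x, y}" |
      i where "e = {(y # xs) ! i, (y # xs) ! Suc i}" "Suc i < length (y # xs)" by blast
    then show "e \<in> ?A"
    proof cases
      case 1
      then show ?thesis by (intro CollectI exI[of _ 0]) auto
    next
      case 2
      then show ?thesis by (intro CollectI exI[of _ "Suc i"]) auto
    qed
  qed
  with 1 show ?case by simp
qed auto

lemma path_edges_snoc:
  "path_edges (xs @ [y]) = (if xs = [] then {} else insert {last xs, y} (path_edges xs))"
  by (induction xs rule: path_edges.induct) (auto simp: insert_commute)

lemma path_edges_rev: "path_edges (rev xs) = path_edges xs"
proof (induction xs rule: path_edges.induct)
  case (1 x y xs)
  then show ?case
    using path_edges_snoc[of "rev (y # xs)" x] by (simp add: insert_commute)
qed auto

lemma path_edges_middle: "{a, b} \<in> path_edges (us @ a # b # ws)"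
  by (induction us rule: path_edges.induct) auto

text \<open>The first vertex lies in a single edge, which determines the second vertex; removing it
  gives the same situation for the tails.\<close>

lemma path_edges_same_hd:
  "distinct (x # xs) \<Longrightarrow> distinct (x # ys) \<Longrightarrow> path_edges (x # xs) = path_edges (x # ys) \<Longrightarrow> xs = ys"
proof (induction xs arbitrary: x ys)
  case Nil
  then show ?case by (cases ys) auto
next
  case (Cons y zs)
  then obtain y' zs' where ys: "ys = y' # zs'" by (cases ys) auto
  have n: "e \<notin> path_edges (y # zs) \<and> e \<notin> path_edges (y' # zs')" if "x \<in> e" for e
    using Cons.prems that path_edges_subset[of e "y # zs"] path_edges_subset[of e "y' # zs'"] ys by auto
  have "{x, y} \<in> insert {x, y'} (path_edges (y' # zs'))"
    using Cons.prems(3) ys by auto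
  with n[of "{x, y}"] have "{x, y} = {x, y'}" by auto
  then have y: "y = y'" by (auto simp: doubleton_eq_iff)
  have "path_edges (y # zs) = path_edges (y # zs')"
    using Cons.prems(3) n[of "{x, y}"] ys y by (auto simp: insert_eq_iff)
  with Cons.IH[of y zs'] Cons.prems ys y show ?case by auto
qed

text \<open>The first vertex of \<open>ys\<close> lies in one edge, an inner vertex of
  \<open>xs\<close> in two. So it is an end of \<open>xs\<close>, and \<open>xs\<close> or its
  reverse starts with it.\<close>

lemma path_edges_eq_cases:
  assumes "distinct xs" "distinct ys" "set xs = set ys" "path_edges xs = path_edges ys"
    and "2 \<le> length ys"
  shows "ys = xs \<or> ys = rev xs"
proof -
  obtain y y' zs where ys: "ys = y # y' # zs"
    using assms(5) by (metis Suc_le_length_iff numeral_2_eq_2)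
  have "xs \<noteq> []" using assms(3) ys by auto
  have uniq: "e = {y, y'}" if "e \<in> path_edges ys" "y \<in> e" for e
    using that assms(2) ys path_edges_subset[of e "y' # zs"] by auto
  have "y \<in> set xs" using assms(3) ys by auto
  have "y = hd xs \<or> y = last xs"
  proof (rule ccontr)
    assume *: "\<not> (y = hd xs \<or> y = last xs)"
    obtain us ws where xs: "xs = us @ y # ws" using split_list[OF \<open>y \<in> set xs\<close>] by blast
    with * have "us \<noteq> []" "ws \<noteq> []" by auto
    then obtain us' a b ws' where "us = us' @ [a]" "ws = b # ws'"
      by (metis neq_Nil_conv rev_exhaust)
    with xs have xs: "xs = us' @ a # y # b # ws'" "xs = (us' @ [a]) @ y # b # ws'" by auto
    have "{a, y} \<in> path_edges xs" "{y, b} \<in> path_edges xs"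
      using path_edges_middle[of a y us' "b # ws'"] path_edges_middle[of y b "us' @ [a]" ws'] xs
      by auto
    then have "{a, y} = {y, y'}" "{y, b} = {y, y'}"
      using uniq[of "{a, y}"] uniq[of "{y, b}"] assms(4) by simp_all
    then have "a = b" by (auto simp: doubleton_eq_iff)
    then show False using assms(1) xs by auto
  qed
  then show ?thesis
  proof
    assume "y = hd xs"
    then obtain xs' where "xs = y # xs'" using \<open>xs \<noteq> []\<close> by (cases xs) auto
    then show ?thesis using path_edges_same_hd[of y xs' "y' # zs"] assms ys by auto
  next
    assume "y = last xs"
    then have "y = hd (rev xs)" using \<open>xs \<noteq> []\<close> by (simp add: hd_rev)
    then obtain xs' where xs': "rev xs = y # xs'" using \<open>xs \<noteq> []\<close> by (cases "rev xs") auto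
    have "distinct (rev xs)" using assms(1) by simp
    then show ?thesis
      using path_edges_same_hd[of y xs' "y' # zs"] assms ys xs' path_edges_rev[of xs] by auto
  qed
qed

lemma isomorphic_path_graph:
  assumes "distinct xs"
  shows "isomorphic (set xs, path_edges xs) (path_graph (length xs))"
proof -
  let ?k = "length xs"
  define f where "f = the_inv_into {..<?k} ((!) xs)"
  have inj: "inj_on ((!) xs) {..<?k}" using assms by (auto simp: inj_on_def nth_eq_iff_index_eq)
  have f: "f (xs ! i) = i" if "i < ?k" for i
    unfolding f_def using the_inv_into_f_f[OF inj] that by auto
  have "(!) xs ` {..<?k} = set xs" by (auto simp: set_conv_nth)
  then have "bij_betw f (set xs) {..<?k}"
    unfolding f_def using bij_betw_the_inv_into[of "(!) xs" "{..<?k}" "set xs"] inj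
    by (simp add: bij_betw_def)
  moreover have "{u, v} \<in> path_edges xs \<longleftrightarrow> {f u, f v} \<in> edges (path_graph ?k)"
    if uv: "u \<in> set xs" "v \<in> set xs" for u v
  proof -
    obtain a b where ab: "u = xs ! a" "a < ?k" "v = xs ! b" "b < ?k"
      using uv by (auto simp: in_set_conv_nth)
    have "{xs ! a, xs ! b} = {xs ! i, xs ! Suc i} \<longleftrightarrow> {a, b} = {i, Suc i}" if "Suc i < ?k" for i
      using that ab nth_eq_iff_index_eq[OF assms] by (auto simp: doubleton_eq_iff)
    then show ?thesis
      using ab f by (auto simp: path_edges_conv path_graph_def)
  qed
  ultimately show ?thesis
    unfolding isomorphic_def by (intro exI[of _ f]) (auto simp: path_graph_def)
qed

lemma path_subgraph_listing:
  assumes "simple_graph S" "isomorphic S (path_graph k)"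
  shows "\<exists>xs. length xs = k \<and> distinct xs \<and> S = (set xs, path_edges xs)"
proof -
  obtain f where f: "bij_betw f (verts S) {..<k}"
    "\<And>u v. u \<in> verts S \<Longrightarrow> v \<in> verts S \<Longrightarrow> {u, v} \<in> edges S \<longleftrightarrow> {f u, f v} \<in> edges (path_graph k)"
    using assms(2) unfolding isomorphic_def by (auto simp: path_graph_def)
  define g where "g = the_inv_into (verts S) f"
  have g: "bij_betw g {..<k} (verts S)" unfolding g_def by (rule bij_betw_the_inv_into[OF f(1)])
  have gf: "g (f u) = u" if "u \<in> verts S" for u
    unfolding g_def using f(1) that by (simp add: bij_betw_def the_inv_into_f_f)
  have fg: "f (g i) = i" if "i < k" for i
    unfolding g_def using f(1) that by (auto simp: bij_betw_def intro: f_the_inv_into_f)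
  have gS: "g i \<in> verts S" if "i < k" for i using g that by (auto simp: bij_betw_def)
  let ?xs = "map g [0..<k]"
  have "distinct ?xs" using g by (auto simp: distinct_map bij_betw_def atLeast0LessThan)
  moreover have "set ?xs = verts S" using g by (auto simp: bij_betw_def atLeast0LessThan)
  moreover have "path_edges ?xs = edges S"
  proof (intro equalityI subsetI)
    fix e assume "e \<in> path_edges ?xs"
    then obtain i where i: "e = {g i, g (Suc i)}" "Suc i < k"
      unfolding path_edges_conv by auto
    then have "{f (g i), f (g (Suc i))} \<in> edges (path_graph k)"
      using fg[of i] fg[of "Suc i"] by (auto simp: path_graph_def)
    then show "e \<in> edges S" using f(2)[of "g i" "g (Suc i)"] gS i by auto
  next
    fix e assume e: "e \<in> edges S"
    then obtain u v where uv: "e = {u, v}" "u \<in> verts S" "v \<in> verts S"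
      using assms(1) unfolding simple_graph_def by (metis card_2_iff insert_subset)
    then have "{f u, f v} \<in> edges (path_graph k)" using f(2) e by blast
    then obtain i where i: "{f u, f v} = {i, Suc i}" "Suc i < k" by (auto simp: path_graph_def)
    have "e = g ` {f u, f v}" using uv gf by auto
    then have "e = {g i, g (Suc i)}" unfolding i(1) by simp
    then have "e = {?xs ! i, ?xs ! Suc i}" "Suc i < length ?xs" using i(2) by auto
    then show "e \<in> path_edges ?xs" unfolding path_edges_conv by blast
  qed
  ultimately show ?thesis by (intro exI[of _ ?xs]) (simp add: prod_eq_iff)
qed

lemma represents_sym_edges:
  assumes "simple_graph H" "represents R H"
  shows "sym_edges (edge_list R)"
proof -
  have "(y, x) \<in> set (edge_list R) \<and> x \<noteq> y" if "(x, y) \<in> set (edge_list R)" for x y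
  proof -
    have "{x, y} \<in> edges H" using that assms(2) by (auto simp: represents_def)
    then have "card {x, y} = 2" using assms(1) by (auto simp: simple_graph_def)
    then have "x \<noteq> y" by auto
    with \<open>{x, y} \<in> edges H\<close> show ?thesis
      using assms(2) by (auto simp: represents_def insert_commute)
  qed
  then show ?thesis using assms(2) by (auto simp: sym_edges_def represents_def)
qed

lemma path_edges_successively:
  "path_edges xs \<subseteq> A \<longleftrightarrow> successively (\<lambda>x y. {x, y} \<in> A) xs"
  by (induction xs rule: path_edges.induct) auto

text \<open>The fibre of a path under \<open>G\<close> consists of a traversal and its reverse. They
  differ because \<open>k\<close> is at least 2; shorter paths are counted separately.\<close>

lemma count_path_subgraphs:
  assumes "simple_graph H" "represents R H" "2 \<le> k"
  shows "2 * count_subgraphs (path_graph k) H = card (inj_walks (edge_list R) k)"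
proof -
  let ?E = "edge_list R"
  define G :: "nat list \<Rightarrow> nat graph" where "G xs = (set xs, path_edges xs)" for xs
  have E: "sym_edges ?E" by (rule represents_sym_edges[OF assms(1,2)])
  have setE: "(x, y) \<in> set ?E \<longleftrightarrow> {x, y} \<in> edges H" for x y
    using assms(2) by (auto simp: represents_def)
  have supp: "support ?E \<subseteq> verts H"
    using assms(1) setE by (force simp: simple_graph_def)
  have walk: "path_edges xs \<subseteq> edges H \<longleftrightarrow> successively (\<lambda>x y. (x, y) \<in> set ?E) xs" for xs
    unfolding path_edges_successively setE ..
  have in_supp: "set xs \<subseteq> support ?E"
    if "successively (\<lambda>x y. (x, y) \<in> set ?E) xs" "2 \<le> length xs" for xs
    using that
  proof (induction xs rule: path_edges.induct)
    case (1 x y xs)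
    then have "(x, y) \<in> set ?E" "(y, x) \<in> set ?E" using E by (auto simp: sym_edges_def)
    then have "x \<in> support ?E" "y \<in> support ?E" by force+
    with 1 show ?case by (cases xs) auto
  qed auto
  have img: "{S. subgraph_of S H \<and> isomorphic S (path_graph k)} = G ` inj_walks ?E k"
  proof (intro equalityI subsetI)
    fix S assume "S \<in> {S. subgraph_of S H \<and> isomorphic S (path_graph k)}"
    then have S: "simple_graph S" "verts S \<subseteq> verts H" "edges S \<subseteq> edges H"
      "isomorphic S (path_graph k)" by (auto simp: subgraph_of_def)
    obtain xs where xs: "length xs = k" "distinct xs" "S = G xs"
      using path_subgraph_listing[OF S(1,4)] by (auto simp: G_def)
    then have "successively (\<lambda>x y. (x, y) \<in> set ?E) xs" using S(3) walk by (auto simp: G_def)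
    then have "xs \<in> inj_walks ?E k" using xs in_supp assms(3) by (auto simp: inj_walks_def)
    then show "S \<in> G ` inj_walks ?E k" using xs by blast
  next
    fix S assume "S \<in> G ` inj_walks ?E k"
    then obtain xs where xs: "S = G xs" "length xs = k" "distinct xs" "set xs \<subseteq> support ?E"
      "successively (\<lambda>x y. (x, y) \<in> set ?E) xs" by (auto simp: inj_walks_def)
    have "path_edges xs \<subseteq> edges H" using xs walk by blast
    then have "simple_graph S"
      using assms(1) xs(1) path_edges_subset by (auto simp: simple_graph_def G_def)
    then have "subgraph_of S H"
      using xs supp \<open>path_edges xs \<subseteq> edges H\<close> by (auto simp: subgraph_of_def G_def)
    moreover have "isomorphic S (path_graph k)"
      using isomorphic_path_graph[OF xs(3)] xs by (simp add: G_def)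
    ultimately show "S \<in> {S. subgraph_of S H \<and> isomorphic S (path_graph k)}" by simp
  qed
  have fin: "finite (inj_walks ?E k)"
    by (rule finite_subset[of _ "{xs. set xs \<subseteq> support ?E \<and> length xs = k}"])
      (auto simp: inj_walks_def finite_lists_length_eq)
  have "card {xs \<in> inj_walks ?E k. G xs = S} = 2" if S: "S \<in> G ` inj_walks ?E k" for S
  proof -
    obtain xs where xs: "xs \<in> inj_walks ?E k" "S = G xs" using S by blast
    have rev: "rev ys \<in> inj_walks ?E k" if "ys \<in> inj_walks ?E k" for ys
      using that E unfolding inj_walks_def sym_edges_def
      by (auto elim!: successively_mono)
    have "G (rev xs) = S" using xs by (simp add: G_def path_edges_rev)
    moreover have "ys = xs \<or> ys = rev xs" if "ys \<in> inj_walks ?E k" "G ys = S" for ys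
      using that xs assms(3) by (intro path_edges_eq_cases) (auto simp: G_def inj_walks_def)
    ultimately have "{xs \<in> inj_walks ?E k. G xs = S} = {xs, rev xs}"
      using rev xs by auto
    moreover have "xs \<noteq> rev xs"
    proof
      assume eq: "xs = rev xs"
      have "distinct xs" "2 \<le> length xs" using xs assms(3) by (auto simp: inj_walks_def)
      then obtain a b ys where "xs = a # b # ys" by (metis Suc_le_length_iff numeral_2_eq_2)
      with eq have "hd xs = last xs" by (metis hd_rev)
      with \<open>xs = a # b # ys\<close> \<open>distinct xs\<close> show False by (auto split: if_splits)
    qed
    ultimately show ?thesis by simp
  qed
  then have "(\<Sum>S\<in>G ` inj_walks ?E k. card {xs \<in> inj_walks ?E k. G xs = S}) =
    2 * card (G ` inj_walks ?E k)" by simp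
  moreover have "card (inj_walks ?E k) = (\<Sum>S\<in>G ` inj_walks ?E k. card {xs \<in> inj_walks ?E k. G xs = S})"
    using sum.image_gen[OF fin, of "\<lambda>_. 1 :: nat" G] by simp
  ultimately show ?thesis by (simp add: count_subgraphs_def img)
qed

lemma count_path_0:
  fixes H :: "'a graph"
  shows "count_subgraphs (path_graph 0) H = 1"
proof -
  have "S = ({}, {})" if "simple_graph S" "isomorphic S (path_graph 0)" for S :: "'a graph"
    using path_subgraph_listing[OF that] by auto
  moreover have "subgraph_of ({}, {}) H" by (simp add: subgraph_of_def simple_graph_def)
  moreover have "isomorphic ({} :: 'a set, {}) (path_graph 0)"
    using isomorphic_path_graph[of "[] :: 'a list"] by simp
  ultimately have "{S. subgraph_of S H \<and> isomorphic S (path_graph 0)} = {({}, {})}"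
    unfolding subgraph_of_def by blast
  then show ?thesis by (simp add: count_subgraphs_def)
qed

lemma count_path_1:
  fixes H :: "'a graph"
  assumes "simple_graph H"
  shows "count_subgraphs (path_graph 1) H = card (verts H)"
proof -
  have "{S. subgraph_of S H \<and> isomorphic S (path_graph 1)} = (\<lambda>v. ({v}, {})) ` verts H"
  proof (intro equalityI subsetI)
    fix S :: "'a graph" assume "S \<in> {S. subgraph_of S H \<and> isomorphic S (path_graph 1)}"
    then have S: "simple_graph S" "verts S \<subseteq> verts H" "isomorphic S (path_graph 1)"
      by (auto simp: subgraph_of_def)
    from path_subgraph_listing[OF S(1,3)] obtain v where "S = ({v}, {})"
      by (auto simp: length_Suc_conv)
    with S show "S \<in> (\<lambda>v. ({v}, {})) ` verts H" by auto
  next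
    fix S :: "'a graph" assume "S \<in> (\<lambda>v. ({v}, {})) ` verts H"
    then show "S \<in> {S. subgraph_of S H \<and> isomorphic S (path_graph 1)}"
      using isomorphic_path_graph[of "[v]" for v]
      by (auto simp: subgraph_of_def simple_graph_def)
  qed
  then show ?thesis by (simp add: count_subgraphs_def card_image inj_on_def)
qed

section \<open>Assembly, word size and running time\<close>

section \<open>The counting program\<close>

text \<open>The prelude occupies positions 0 to 16. Cell 14 is register 9, the accumulator with the
  answer, and is moved to the output cell 0 by adding it to 0.\<close>

definition counting_program :: "nat \<Rightarrow> cmd \<Rightarrow> instr list" where
  "counting_program S c = prelude S @ compile 17 c @ [Const 0 0, Add 0 0 14, Halt]"

lemma runs_counting_program:
  assumes "16 \<le> S" "width c \<le> S" "wf_loops c" "(B + 2) * S < w" "length (edge_list R) \<le> B"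
    and "\<And>x y. (x, y) \<in> set (edge_list R) \<Longrightarrow> x \<le> B \<and> y \<le> B"
    and run: "\<And>\<sigma>. snd \<sigma> = edge_arrays (edge_list R) \<Longrightarrow>
      ok B (length (edge_list R)) c \<sigma> \<and> fst (exec (length (edge_list R)) c \<sigma>) 9 = r"
    and "r \<le> B" "n < w"
  shows "computes w R (counting_program S c) n
    (8 + (\<Sum>i\<le>length (edge_list R). scan_cost R i) + 13 * length (edge_list R) +
      cost (length (edge_list R)) c) r"
proof -
  let ?P = "counting_program S c"
  let ?L = "length (edge_list R)"
  let ?pc = "17 + length (compile 17 c)"
  have "code_at ?P 0 ?P" by (auto simp: code_at_def)
  then have code: "code_at ?P 0 (prelude S)" "code_at ?P 17 (compile 17 c)"
    "code_at ?P ?pc [Const 0 0, Add 0 0 14, Halt]"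
    by (auto simp: counting_program_def code_at_append length_prelude)
  have "11 \<le> S" using assms(1) by simp
  from steps_prelude[OF code(1) this assms(4) refl assms(5,6)]
  obtain M \<sigma> where 1: "steps w R ?P (0, (\<lambda>_. 0)(0 := n), 0)
      (5 + (\<Sum>i\<le>?L. scan_cost R i) + 13 * ?L) (17, M, ?L)"
    "encodes S ?L \<sigma> M" "snd \<sigma> = edge_arrays (edge_list R)" by blast
  obtain M' where 2: "steps w R ?P (17, M, ?L) (cost ?L c) (?pc, M', ?L)"
    "encodes S ?L (exec ?L c \<sigma>) M'"
    using steps_compile[OF 1(2) _ assms(3,2,5,4) code(2)] run[OF 1(3)] by blast
  have "\<forall>r. r + 5 < S \<longrightarrow> M' (r + 5) = fst (exec ?L c \<sigma>) r"
    using 2(2) unfolding encodes_def by blast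
  from this[rule_format, of 9] assms(1) have "M' 14 = fst (exec ?L c \<sigma>) 9" by simp
  then have M': "M' 14 = r" using run[OF 1(3)] by simp
  have "(B + 2) * 1 \<le> (B + 2) * S" using assms(1) by (intro mult_le_mono2) simp
  also note assms(4)
  finally have w: "0 < w" "r < w" using assms(8) by simp_all
  have r1: "runs w R ?P (Suc (Suc ?pc), M'(0 := 0, 0 := r), ?L) 1 ((M'(0 := 0, 0 := r)) 0)"
    using code(3) by (intro runs.halt) (auto simp: code_at_Cons)
  have r2: "runs w R ?P (Suc ?pc, M'(0 := 0), ?L) (1 + 1) r"
    by (rule runs.step[where s = "(Suc (Suc ?pc), M'(0 := 0, 0 := r), ?L)"])
      (use r1 code(3) w M' in \<open>auto simp: code_at_Cons put_def\<close>)
  have "runs w R ?P (?pc, M', ?L) (1 + (1 + 1)) r"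
    by (rule runs.step[where s = "(Suc ?pc, M'(0 := 0), ?L)"])
      (use r2 code(3) w in \<open>auto simp: code_at_Cons put_def\<close>)
  from steps_runs[OF 1(1) steps_runs[OF 2(1) this]] assms(9) show ?thesis
    unfolding computes_def by (simp add: algebra_simps numeral_eq_Suc)
qed

text \<open>A listed pair is determined by its edge together with the order of its
  components.\<close>

lemma length_edge_list:
  assumes "simple_graph H" "represents R H"
  shows "length (edge_list R) \<le> 2 * card (edges H)"
proof -
  have fin: "finite (edges H)"
    using assms(1) finite_subset[of "edges H" "Pow (verts H)"] by (auto simp: simple_graph_def)
  let ?f = "\<lambda>(x, y). ({x, y}, x < (y :: nat))"
  have "inj_on ?f (set (edge_list R))"
  proof (rule inj_onI, clarify)
    fix a b c d assume "{a, b} = {c, d}" "(a < b) = (c < d)" and "(a, b) \<in> set (edge_list R)"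
    moreover have "a \<noteq> b"
      using represents_sym_edges[OF assms] \<open>(a, b) \<in> _\<close> by (auto simp: sym_edges_def)
    ultimately show "a = c \<and> b = d" by (auto simp: doubleton_eq_iff)
  qed
  moreover have "?f ` set (edge_list R) \<subseteq> edges H \<times> UNIV"
    using assms(2) by (auto simp: represents_def)
  ultimately have "card (set (edge_list R)) \<le> card (edges H \<times> (UNIV :: bool set))"
    using fin by (intro card_inj_on_le) auto
  moreover have "card (set (edge_list R)) = length (edge_list R)"
    using assms(2) distinct_card unfolding represents_def by blast
  ultimately show ?thesis by (simp add: card_cartesian_product)
qed

lemma rooted_sum_le:
  assumes "sym_edges E" "length E \<le> Q" "1 \<le> Q"
  shows "rooted_sum E e x \<le> Q ^ Suc (deg 0 e)"
proof -
  have "ev E (fst p) (snd p) (\<lambda>_. 0) e (fst p) \<le> Q ^ deg 0 e" if "p \<in> set E" for p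
    using that assms by (intro ev_le) auto
  then have "rooted_sum E e x \<le> length E * Q ^ deg 0 e"
    unfolding rooted_sum_def by (intro sum_list_le_length) (auto simp: of_bool_def)
  also have "\<dots> \<le> Q * Q ^ deg 0 e" using assms(2) by simp
  finally show ?thesis by simp
qed

lemma anchored_sum_le:
  assumes "sym_edges E" "length E \<le> Q" "1 \<le> Q"
  shows "anchored_sum E t \<le> Q ^ Suc (deg (Suc (deg 0 (fst t))) (snd t))"
proof -
  let ?g = "Suc (deg 0 (fst t))"
  have "ev E (fst p) (snd p) (rooted_sum E (fst t)) (snd t) (fst p) \<le> Q ^ deg ?g (snd t)"
    if "p \<in> set E" for p
    using that rooted_sum_le[OF assms] assms by (intro ev_le) auto
  then have "anchored_sum E t \<le> length E * Q ^ deg ?g (snd t)"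
    unfolding anchored_sum_def by (intro sum_list_le_length) auto
  also have "\<dots> \<le> Q * Q ^ deg ?g (snd t)" using assms(2) by simp
  finally show ?thesis by simp
qed

text \<open>With \<open>x = max 1 m\<close> one has \<open>L \<le> 2 * x\<close> and
  \<open>L + 1 \<le> 3 * x\<close>. So 34 is \<open>8 + 13 * 2\<close> and the factor 9 is the
  square of 3. The absolute value caters for a negative \<open>A\<close>.\<close>

lemma counting_cost:
  fixes A :: real
  assumes "efficient_rep A a R H" "L = length (edge_list R)" "L \<le> 2 * card (edges H)"
    and "c \<le> K * (L + 1) ^ 2" "m = card (edges H)"
  shows "real (8 + (\<Sum>i\<le>L. scan_cost R i) + 13 * L + c) \<le>
    real (max 1 m) ^ 2 * polylog (34 + 9 * real K + \<bar>A\<bar>) a (graph_size H)"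
proof -
  define x where "x = real (max 1 m)"
  define l where "l = log 2 (real (graph_size H) + 2) ^ a"
  have x: "1 \<le> x" by (simp add: x_def)
  have "1 \<le> log 2 (real (graph_size H) + 2)" by (subst le_log_iff) auto
  then have l: "1 \<le> l" by (simp add: l_def)
  have "real L \<le> 2 * x" using assms(3,5) by (simp add: x_def)
  then have "(real L + 1)\<^sup>2 \<le> (3 * x)\<^sup>2" using x by (intro power_mono) auto
  then have c: "real c \<le> 9 * real K * x\<^sup>2"
  proof -
    have "real c \<le> real (K * (L + 1) ^ 2)" using assms(4) of_nat_le_iff by blast
    also have "\<dots> = real K * (real L + 1)\<^sup>2" by (simp add: add.commute)
    also have "\<dots> \<le> real K * (3 * x)\<^sup>2" using \<open>(real L + 1)\<^sup>2 \<le> _\<close> by (intro mult_left_mono) auto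
    finally show ?thesis by (simp add: power_mult_distrib)
  qed
  have "real (\<Sum>i\<le>L. scan_cost R i) \<le> x * (A * l)"
    using assms(1,2,5) by (simp add: efficient_rep_def polylog_def x_def l_def)
  also have "\<dots> \<le> x * (\<bar>A\<bar> * l)" using x l by (intro mult_left_mono mult_right_mono) auto
  also have "\<dots> \<le> x\<^sup>2 * (\<bar>A\<bar> * l)"
    using x l by (intro mult_right_mono) (auto simp: power2_eq_square)
  finally have s: "real (\<Sum>i\<le>L. scan_cost R i) \<le> x\<^sup>2 * (\<bar>A\<bar> * l)" .
  have "x * 1 \<le> x * x" using x by (intro mult_left_mono) auto
  then have "1 \<le> x\<^sup>2" "x \<le> x\<^sup>2" unfolding power2_eq_square using x by linarith+
  then have "8 + 13 * real L + real c \<le> (34 + 9 * real K) * x\<^sup>2"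
    using c \<open>real L \<le> 2 * x\<close> by (simp add: algebra_simps)
  also have "(34 + 9 * real K) * x\<^sup>2 * 1 \<le> (34 + 9 * real K) * x\<^sup>2 * l"
    using l by (intro mult_left_mono) auto
  then have "(34 + 9 * real K) * x\<^sup>2 \<le> (34 + 9 * real K) * x\<^sup>2 * l" by simp
  finally show ?thesis
    using s unfolding polylog_def x_def[symmetric] l_def[symmetric] by (simp add: algebra_simps)
qed

theorem theorem10:
  fixes k :: nat
  assumes "k \<le> 10"
  shows "\<exists>(P :: instr list) (d :: nat). \<forall>(A :: real) (a :: nat). \<exists>(C :: real) (c :: nat).
    \<forall>(H :: nat graph) (R :: graph_rep) (n :: nat) (m :: nat).
      simple_graph H \<and> verts H = {..<n} \<and> card (edges H) = m \<and>
      represents R H \<and> efficient_rep A a R H \<longrightarrow>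
      (\<exists>t. computes ((graph_size H + 2) ^ d) R P n t (count_subgraphs (path_graph k) H) \<and>
           real t \<le> real (max 1 m) ^ 2 * polylog C c (graph_size H))"
proof -
  consider "k = 0" | "k = 1" | "2 \<le> k" by linarith
  then show ?thesis
  proof cases
    case 1
    have "computes ((graph_size H + 2) ^ 1) R [Const 0 1, Halt] n (1 + 1) (count_subgraphs (path_graph k) H)"
      if "verts H = {..<n}" for H :: "nat graph" and R n
    proof -
      define M M' where "M = (\<lambda>_::nat. 0::nat)(0 := n)" and "M' = M(0 := 1)"
      have r1: "runs (graph_size H + 2) R [Const 0 1, Halt] (Suc 0, M', 0) 1 (M' 0)"
        by (intro runs.halt) auto
      have "runs (graph_size H + 2) R [Const 0 1, Halt] (0, M, 0) (1 + 1) 1"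
        by (rule runs.step[where s = "(Suc 0, M', 0)"]) (use r1 in \<open>auto simp: put_def M'_def\<close>)
      then have "runs (graph_size H + 2) R [Const 0 1, Halt] (0, (\<lambda>_. 0)(0 := n), 0) (1 + 1) 1"
        by (simp only: M_def)
      then show ?thesis using that 1 by (simp add: computes_def count_path_0 graph_size_def)
    qed
    moreover have "real (1 + 1) \<le> real (max 1 m) ^ 2 * polylog 2 0 N" for m N
      by (simp add: polylog_def)
    ultimately show ?thesis by metis
  next
    case 2
    \<comment> \<open>The answer is the number \<open>n\<close> of vertices, which the output cell
      holds from the start.\<close>
    have "computes ((graph_size H + 2) ^ 1) R [Halt] n 1 (count_subgraphs (path_graph k) H)"
      if "simple_graph H" "verts H = {..<n}" for H :: "nat graph" and R n
    proof -
      define M where "M = (\<lambda>_::nat. 0::nat)(0 := n)"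
      have "runs (graph_size H + 2) R [Halt] (0, M, 0) 1 (M 0)"
        by (intro runs.halt) auto
      then have "runs (graph_size H + 2) R [Halt] (0, (\<lambda>_. 0)(0 := n), 0) 1 n"
        by (simp add: M_def)
      then show ?thesis
        using that 2 count_path_1[OF that(1)] by (simp add: computes_def graph_size_def)
    qed
    moreover have "real 1 \<le> real (max 1 m) ^ 2 * polylog 1 0 N" for m N
      by (simp add: polylog_def)
    ultimately show ?thesis by metis
  next
    case 3
    obtain pos neg :: "(vexp \<times> vexp) list" where terms: "\<forall>E. sym_edges E \<longrightarrow>
      (\<forall>t\<in>set pos \<union> set neg. input_free E (fst t)) \<and>
      card (inj_walks E k) + (\<Sum>t\<leftarrow>neg. anchored_sum E t) = (\<Sum>t\<leftarrow>pos. anchored_sum E t)"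
      using inj_walks_expansion[OF 3 assms] by blast
    define c where "c = main_cmd pos neg"
    define S where "S = max 16 (width c)"
    define g where "g t = Suc (deg 0 (fst t))" for t :: "vexp \<times> vexp"
    \<comment> \<open>A common bound for all exponents of single terms. In \<open>D'\<close>, the
      length of the lists pays for adding up the terms, since a list of length \<open>l\<close> has
      at most \<open>2 ^ l \<le> Q ^ l\<close> of them, and the 1 ensures
      \<open>Q \<le> B\<close>.\<close>
    define D where "D = (\<Sum>t\<leftarrow>pos @ neg. g t + deg (g t) (fst t) + Suc (deg (g t) (snd t)))"
    define D' where "D' = D + length (pos @ neg) + 1"
    \<comment> \<open>The word bound has to exceed \<open>(B + 2) * S\<close>: the power
      \<open>2 * D'\<close> is \<open>B\<close>, since \<open>Q\<close> is a square, and
      \<open>S + 1\<close> covers the factor \<open>2 * S < 2 ^ (S + 1)\<close>.\<close>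
    define d where "d = 2 * D' + S + 1"
    obtain K where K: "\<And>L. cost L c \<le> K * (L + 1) ^ loop_depth c" using cost_le by blast
    have depth: "loop_depth c \<le> 2" "wf_loops c" using main_cmd_shape by (auto simp: c_def)
    have "\<exists>t. computes ((graph_size H + 2) ^ d) R (counting_program S c) n t
          (count_subgraphs (path_graph k) H) \<and>
        real t \<le> real (max 1 m) ^ 2 * polylog (34 + 9 * real K + \<bar>A\<bar>) a (graph_size H)"
      if H: "simple_graph H" "verts H = {..<n}" "card (edges H) = m" "represents R H"
        "efficient_rep A a R H" for A :: real and a H R n m
    proof -
      let ?E = "edge_list R" and ?N = "graph_size H + 2"
      define L where "L = length ?E"
      \<comment> \<open>The square absorbs the factor 2 in \<open>L \<le> 2 * m\<close>, because
        \<open>?N\<close> is at least 2.\<close>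
      define Q where "Q = ?N ^ 2"
      define B where "B = Q ^ D'"
      have E: "sym_edges ?E" by (rule represents_sym_edges[OF H(1,4)])
      have "L \<le> 2 * m" using length_edge_list[OF H(1,4)] H(3) by (simp add: L_def)
      have N: "n \<le> ?N" "m \<le> ?N" using H by (auto simp: graph_size_def)
      have "2 * ?N \<le> Q" unfolding Q_def power2_eq_square by (intro mult_le_mono1) simp
      then have Q: "L \<le> Q" "2 \<le> Q" "1 \<le> Q" "?N \<le> Q" using N \<open>L \<le> 2 * m\<close> by auto
      have QB: "Q ^ i \<le> B" if "i \<le> D'" for i
        unfolding B_def using that Q by (intro power_increasing) auto
      have B: "Q \<le> B" using QB[of 1] by (simp add: D'_def)
      have vert: "x < n" if "x \<in> support ?E \<union> snd ` set ?E" for x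
      proof -
        from that obtain y z where "{y, z} \<in> edges H" "x = y \<or> x = z"
          using H(4) by (force simp: represents_def)
        then show ?thesis using H(1,2) by (auto simp: simple_graph_def)
      qed
      interpret bounded_edges ?E L B
      proof
        show "snd ` set ?E \<subseteq> support ?E"
          using E by (force simp: sym_edges_def)
        show "x \<le> B" if "x \<in> support ?E" for x
          using vert[of x] that N(1) Q(4) B by auto
      qed (use Q B in \<open>auto simp: L_def\<close>)
      have deg_le: "g t + deg (g t) (fst t) + Suc (deg (g t) (snd t)) \<le> D"
        if "t \<in> set (pos @ neg)" for t
        unfolding D_def using that by (intro member_le_sum_list) auto
      have ok: "\<forall>t\<in>set pos \<union> set neg. term_ok t"
      proof
        fix t assume t: "t \<in> set pos \<union> set neg"
        then have t': "t \<in> set (pos @ neg)" by simp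
        have "input_free ?E (fst t)" using terms E t by blast
        moreover have "rooted_sum ?E (fst t) x \<le> Q ^ g t" for x
          using rooted_sum_le[OF E] Q by (simp add: g_def L_def del: power_Suc)
        moreover have "Q ^ g t \<le> B" "Q ^ deg (g t) (fst t) \<le> B" "Q ^ deg (g t) (snd t) \<le> B"
          using deg_le[OF t'] by (intro QB; simp add: D'_def)+
        ultimately show "term_ok t" unfolding term_ok_def using Q by blast
      qed
      have sums: "(\<Sum>t\<leftarrow>ts. anchored_sum ?E t) \<le> B" if "set ts \<subseteq> set (pos @ neg)"
        "length ts \<le> length (pos @ neg)" for ts
      proof -
        have "anchored_sum ?E t \<le> Q ^ D" if t: "t \<in> set ts" for t
        proof -
          have "anchored_sum ?E t \<le> Q ^ Suc (deg (g t) (snd t))"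
            using anchored_sum_le[OF E] Q by (simp add: g_def L_def del: power_Suc)
          also have "\<dots> \<le> Q ^ D"
            using deg_le[of t] t \<open>set ts \<subseteq> _\<close> Q by (intro power_increasing) auto
          finally show ?thesis .
        qed
        then have "(\<Sum>t\<leftarrow>ts. anchored_sum ?E t) \<le> length ts * Q ^ D"
          by (rule sum_list_le_length)
        also have "length ts \<le> 2 ^ length (pos @ neg)"
          using that(2) less_exp[of "length (pos @ neg)"] by linarith
        also have "(2 :: nat) ^ length (pos @ neg) \<le> Q ^ length (pos @ neg)"
          using Q by (intro power_mono) auto
        also have "Q ^ length (pos @ neg) * Q ^ D \<le> B"
          unfolding power_add[symmetric] by (intro QB) (simp add: D'_def)
        finally show ?thesis by simp
      qed
      have "card (inj_walks ?E k) + (\<Sum>t\<leftarrow>neg. anchored_sum ?E t) = (\<Sum>t\<leftarrow>pos. anchored_sum ?E t)"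
        using terms E by blast
      then have count: "((\<Sum>t\<leftarrow>pos. anchored_sum ?E t) - (\<Sum>t\<leftarrow>neg. anchored_sum ?E t)) div 2 =
          count_subgraphs (path_graph k) H"
        using count_path_subgraphs[OF H(1,4) 3] by linarith
      have le: "count_subgraphs (path_graph k) H \<le> B"
        unfolding count[symmetric] using sums[of pos] by (simp add: div_le_dividend le_trans)
      have run: "ok B L c \<sigma> \<and> fst (exec L c \<sigma>) 9 = count_subgraphs (path_graph k) H"
        if "snd \<sigma> = edge_arrays ?E" for \<sigma>
        unfolding c_def count[symmetric] using that ok sums[of pos] sums[of neg] Q B
        by (intro main_cmd) auto
      have w: "(B + 2) * S < ?N ^ d"
      proof -
        have "(B + 2) * S \<le> B * 2 * S" using Q(2) B by (intro mult_le_mono1) linarith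
        also have "\<dots> < B * 2 ^ (S + 1)"
          using less_exp[of S] Q B by simp
        also have "\<dots> \<le> B * ?N ^ (S + 1)" by (intro mult_le_mono2 power_mono) auto
        also have "\<dots> = ?N ^ d" unfolding B_def Q_def d_def
          by (simp only: power_mult[symmetric] power_add[symmetric] add.assoc)
        finally show ?thesis .
      qed
      have "n < ?N ^ d"
      proof -
        have "(B + 2) * 1 \<le> (B + 2) * S" unfolding S_def by (intro mult_le_mono2) simp
        also note w
        finally show ?thesis using N(1) Q(4) B by simp
      qed
      then have "computes (?N ^ d) R (counting_program S c) n
        (8 + (\<Sum>i\<le>L. scan_cost R i) + 13 * L + cost L c) (count_subgraphs (path_graph k) H)"
        unfolding L_def
        using run[unfolded L_def] w depth le Q B vert N(1)
        by (intro runs_counting_program[where B = B]) (force simp: S_def L_def)+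
      moreover have "cost L c \<le> K * (L + 1) ^ 2"
      proof -
        have "K * (L + 1) ^ loop_depth c \<le> K * (L + 1) ^ 2"
          using depth(1) by (intro mult_le_mono2 power_increasing) auto
        with K[of L] show ?thesis by linarith
      qed
      from counting_cost[OF H(5) L_def _ this H(3)[symmetric]] \<open>L \<le> 2 * m\<close> H(3)
      have "real (8 + (\<Sum>i\<le>L. scan_cost R i) + 13 * L + cost L c) \<le>
        real (max 1 m) ^ 2 * polylog (34 + 9 * real K + \<bar>A\<bar>) a (graph_size H)" by simp
      ultimately show ?thesis by blast
    qed
    then show ?thesis by blast
  qed
qed

end
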